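(* The \textsc{MU-VC} problem can be solved by an algorithm running in time $n^{O(2^d)}$, where $n$ is the number of vertices of the input graph $G$ and $d$ is the treewidth of $G$; in particular it is in \textsf{XP} parameterized by treewidth.
   Context: All graphs are finite, simple, undirected. A vertex cover of $G$ is a set of vertices intersecting every edge; a minimum vertex cover is one of smallest cardinality. For $S\subseteq V(G)$, $G-S$ is the subgraph induced by $V(G)\setminus S$. \textsc{MU-VC}: given a graph $G=(V,E)$ and an integer $k$, find a set $S\subseteq V$ with $|S|\le k$ such that $G-S$ has a unique minimum vertex cover (or report none exists). A tree-decomposition of $G$ is a pair $(T,\{B_x\}_{x\in V(T)})$ with $T$ a tree and bags $B_x\subseteq V(G)$ such that every edge of $G$ has both endpoints in some bag and for every vertex $v$ the nodes whose bags contain $v$ induce a connected subtree of $T$; its width is $\max_x |B_x|-1$, and the treewidth of $G$ is the minimum width of a tree-decomposition of $G$. *)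

theory Defs
  imports "HOL-Library.Log_Nat"
begin

section \<open>Graphs, vertex covers and treewidth\<close>

record 'a graph =
  verts :: "'a set"
  edges :: "'a set set"

definition simple_graph :: "'a graph \<Rightarrow> bool" where
  "simple_graph G \<longleftrightarrow> finite (verts G) \<and> (\<forall>e\<in>edges G. e \<subseteq> verts G \<and> card e = 2)"

definition induced :: "'a graph \<Rightarrow> 'a set \<Rightarrow> 'a graph" where
  "induced G U = \<lparr>verts = verts G \<inter> U, edges = {e \<in> edges G. e \<subseteq> U}\<rparr>"

definition delete_verts :: "'a graph \<Rightarrow> 'a set \<Rightarrow> 'a graph" where
  "delete_verts G S = induced G (verts G - S)"

definition vertex_cover :: "'a graph \<Rightarrow> 'a set \<Rightarrow> bool" where
  "vertex_cover G C \<longleftrightarrow> C \<subseteq> verts G \<and> (\<forall>e\<in>edges G. e \<inter> C \<noteq> {})"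

definition minimum_vertex_cover :: "'a graph \<Rightarrow> 'a set \<Rightarrow> bool" where
  "minimum_vertex_cover G C \<longleftrightarrow>
     vertex_cover G C \<and> (\<forall>D. vertex_cover G D \<longrightarrow> card C \<le> card D)"

definition connected_graph :: "'a graph \<Rightarrow> bool" where
  "connected_graph G \<longleftrightarrow>
     (\<forall>x\<in>verts G. \<forall>y\<in>verts G. (x, y) \<in> {(u, v). {u, v} \<in> edges G}\<^sup>*)"

definition is_cycle :: "'a graph \<Rightarrow> 'a list \<Rightarrow> bool" where
  "is_cycle G xs \<longleftrightarrow>
     3 \<le> length xs \<and> distinct xs \<and> {last xs, hd xs} \<in> edges G \<and>
     (\<forall>i. Suc i < length xs \<longrightarrow> {xs ! i, xs ! Suc i} \<in> edges G)"

definition is_tree :: "'a graph \<Rightarrow> bool" where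
  "is_tree T \<longleftrightarrow>
     simple_graph T \<and> verts T \<noteq> {} \<and> connected_graph T \<and> (\<nexists>xs. is_cycle T xs)"

text \<open>Since trees are nonempty, the last condition also forces every vertex of the graph
  to lie in some bag.\<close>

definition tree_decomposition :: "'a graph \<Rightarrow> 'b graph \<Rightarrow> ('b \<Rightarrow> 'a set) \<Rightarrow> bool" where
  "tree_decomposition G T B \<longleftrightarrow>
     is_tree T \<and>
     (\<forall>x\<in>verts T. B x \<subseteq> verts G) \<and>
     (\<forall>e\<in>edges G. \<exists>x\<in>verts T. e \<subseteq> B x) \<and>
     (\<forall>v\<in>verts G. is_tree (induced T {x. v \<in> B x}))"

text \<open>The truncated subtraction matters only for the graph without vertices, whose
  treewidth becomes 0 instead of -1.\<close>

definition td_width :: "'b graph \<Rightarrow> ('b \<Rightarrow> 'a set) \<Rightarrow> nat" where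
  "td_width T B = Max ((\<lambda>x. card (B x)) ` verts T) - 1"

text \<open>Trees are finite, so it is no restriction to take natural numbers as their nodes.\<close>

definition treewidth :: "'a graph \<Rightarrow> nat" where
  "treewidth G =
     (LEAST w. \<exists>(T :: nat graph) B. tree_decomposition G T B \<and> td_width T B = w)"


section \<open>Model of computation\<close>

text \<open>
  Algorithms are programs of a first-order, call-by-value functional language (pure LISP with
  integers). Data are binary trees with integer leaves. A program is a finite list of function
  bodies that may call each other recursively; a body refers to its arguments and to locally
  bound values by position in the environment. The running time is the number of evaluated
  expression nodes.

  For a fixed program, a random access machine that stores each tree node in a heap cell
  (with pointers to its children) performs each such step with a constant number of elementary
  operations. There is no multiplication and no built-in comparison of trees, so that in
  \<open>t\<close> steps the bit length of the integers grows by at most \<open>O(t)\<close>. Running times in this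
  model, on random access machines (unit or logarithmic cost, with addition and subtraction)
  and on Turing machines therefore agree up to polynomials.
\<close>

datatype data = Atom int | Node data data

datatype prim = Add | Sub | Less | Equal

datatype expr =
    Var nat
  | Lit int
  | Prim prim expr expr
  | MkNode expr expr
  | LeftOf expr
  | RightOf expr
  | IsNode expr
  | Cond expr expr expr
  | Bind expr expr
  | Call nat "expr list"

type_synonym program = "expr list"

fun prim_op :: "prim \<Rightarrow> int \<Rightarrow> int \<Rightarrow> int" where
  "prim_op Add a b = a + b"
| "prim_op Sub a b = a - b"
| "prim_op Less a b = (if a < b then 1 else 0)"
| "prim_op Equal a b = (if a = b then 1 else 0)"

text \<open>\<open>eval P \<rho> e v t\<close>: in environment \<open>\<rho>\<close>, expression \<open>e\<close> evaluates to \<open>v\<close> in exactly \<open>t\<close>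
  steps. Computations that diverge or get stuck have no derivation.\<close>

inductive
  eval :: "program \<Rightarrow> data list \<Rightarrow> expr \<Rightarrow> data \<Rightarrow> nat \<Rightarrow> bool" and
  evals :: "program \<Rightarrow> data list \<Rightarrow> expr list \<Rightarrow> data list \<Rightarrow> nat \<Rightarrow> bool"
  for P :: program
where
  eval_Var: "i < length \<rho> \<Longrightarrow> eval P \<rho> (Var i) (\<rho> ! i) 1"
| eval_Lit: "eval P \<rho> (Lit a) (Atom a) 1"
| eval_Prim: "eval P \<rho> e1 (Atom a) t1 \<Longrightarrow> eval P \<rho> e2 (Atom b) t2 \<Longrightarrow>
    eval P \<rho> (Prim f e1 e2) (Atom (prim_op f a b)) (1 + t1 + t2)"
| eval_MkNode: "eval P \<rho> e1 v1 t1 \<Longrightarrow> eval P \<rho> e2 v2 t2 \<Longrightarrow>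
    eval P \<rho> (MkNode e1 e2) (Node v1 v2) (1 + t1 + t2)"
| eval_LeftOf: "eval P \<rho> e (Node v1 v2) t \<Longrightarrow> eval P \<rho> (LeftOf e) v1 (1 + t)"
| eval_RightOf: "eval P \<rho> e (Node v1 v2) t \<Longrightarrow> eval P \<rho> (RightOf e) v2 (1 + t)"
| eval_IsNode_Node: "eval P \<rho> e (Node v1 v2) t \<Longrightarrow> eval P \<rho> (IsNode e) (Atom 1) (1 + t)"
| eval_IsNode_Atom: "eval P \<rho> e (Atom a) t \<Longrightarrow> eval P \<rho> (IsNode e) (Atom 0) (1 + t)"
| eval_Cond_True: "eval P \<rho> e (Atom a) t \<Longrightarrow> a \<noteq> 0 \<Longrightarrow> eval P \<rho> e1 v t1 \<Longrightarrow>
    eval P \<rho> (Cond e e1 e2) v (1 + t + t1)"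
| eval_Cond_False: "eval P \<rho> e (Atom 0) t \<Longrightarrow> eval P \<rho> e2 v t2 \<Longrightarrow>
    eval P \<rho> (Cond e e1 e2) v (1 + t + t2)"
| eval_Bind: "eval P \<rho> e1 v1 t1 \<Longrightarrow> eval P (v1 # \<rho>) e2 v2 t2 \<Longrightarrow>
    eval P \<rho> (Bind e1 e2) v2 (1 + t1 + t2)"
| eval_Call: "i < length P \<Longrightarrow> evals P \<rho> es vs t1 \<Longrightarrow> eval P vs (P ! i) v t2 \<Longrightarrow>
    eval P \<rho> (Call i es) v (1 + t1 + t2)"
| evals_Nil: "evals P \<rho> [] [] 0"
| evals_Cons: "eval P \<rho> e v t1 \<Longrightarrow> evals P \<rho> es vs t2 \<Longrightarrow>
    evals P \<rho> (e # es) (v # vs) (t1 + t2)"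

inductive_cases eval_VarE: "eval P \<rho> (Var i) v t"
inductive_cases eval_LitE: "eval P \<rho> (Lit a) v t"
inductive_cases eval_PrimE: "eval P \<rho> (Prim f e1 e2) v t"
inductive_cases eval_MkNodeE: "eval P \<rho> (MkNode e1 e2) v t"
inductive_cases eval_LeftOfE: "eval P \<rho> (LeftOf e) v t"
inductive_cases eval_RightOfE: "eval P \<rho> (RightOf e) v t"
inductive_cases eval_IsNodeE: "eval P \<rho> (IsNode e) v t"
inductive_cases eval_CondE: "eval P \<rho> (Cond e e1 e2) v t"
inductive_cases eval_BindE: "eval P \<rho> (Bind e1 e2) v t"
inductive_cases eval_CallE: "eval P \<rho> (Call i es) v t"
inductive_cases evals_NilE: "evals P \<rho> [] vs t"
inductive_cases evals_ConsE: "evals P \<rho> (e # es) vs t"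

lemma eval_deterministic_aux:
  "eval P \<rho> e v t \<Longrightarrow> \<forall>v' t'. eval P \<rho> e v' t' \<longrightarrow> v' = v \<and> t' = t"
  "evals P \<rho> es vs s \<Longrightarrow> \<forall>vs' s'. evals P \<rho> es vs' s' \<longrightarrow> vs' = vs \<and> s' = s"
proof (induction \<rho> e v t and \<rho> es vs s rule: eval_evals.inducts)
  case eval_Var
  then show ?case
    by (intro allI impI, elim eval_VarE)
      (metis data.inject data.distinct(1) add_Suc plus_1_eq_Suc One_nat_def)+
next
  case eval_Lit
  then show ?case
    by (intro allI impI, elim eval_LitE)
      (metis data.inject data.distinct(1) add_Suc plus_1_eq_Suc One_nat_def)+
next
  case eval_Prim
  then show ?case
    by (intro allI impI, elim eval_PrimE)
      (metis data.inject data.distinct(1) add_Suc plus_1_eq_Suc One_nat_def)+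
next
  case eval_MkNode
  then show ?case
    by (intro allI impI, elim eval_MkNodeE)
      (metis data.inject data.distinct(1) add_Suc plus_1_eq_Suc One_nat_def)+
next
  case eval_LeftOf
  then show ?case
    by (intro allI impI, elim eval_LeftOfE)
      (metis data.inject data.distinct(1) add_Suc plus_1_eq_Suc One_nat_def)+
next
  case eval_RightOf
  then show ?case
    by (intro allI impI, elim eval_RightOfE)
      (metis data.inject data.distinct(1) add_Suc plus_1_eq_Suc One_nat_def)+
next
  case eval_IsNode_Node
  then show ?case
    by (intro allI impI, elim eval_IsNodeE)
      (metis data.inject data.distinct(1) add_Suc plus_1_eq_Suc One_nat_def)+
next
  case eval_IsNode_Atom
  then show ?case
    by (intro allI impI, elim eval_IsNodeE)
      (metis data.inject data.distinct(1) add_Suc plus_1_eq_Suc One_nat_def)+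
next
  case eval_Cond_True
  then show ?case
    by (intro allI impI, elim eval_CondE)
      (metis data.inject data.distinct(1) add_Suc plus_1_eq_Suc One_nat_def)+
next
  case eval_Cond_False
  then show ?case
    by (intro allI impI, elim eval_CondE)
      (metis data.inject data.distinct(1) add_Suc plus_1_eq_Suc One_nat_def)+
next
  case eval_Bind
  then show ?case
    by (intro allI impI, elim eval_BindE)
      (metis data.inject data.distinct(1) add_Suc plus_1_eq_Suc One_nat_def)+
next
  case eval_Call
  then show ?case
    by (intro allI impI, elim eval_CallE)
      (metis data.inject data.distinct(1) add_Suc plus_1_eq_Suc One_nat_def)+
next
  case evals_Nil
  then show ?case
    by (intro allI impI, elim evals_NilE)
      (metis data.inject data.distinct(1) add_Suc plus_1_eq_Suc One_nat_def)+
next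
  case evals_Cons
  then show ?case
    by (intro allI impI, elim evals_ConsE)
      (metis data.inject data.distinct(1) add_Suc plus_1_eq_Suc One_nat_def)+
qed

lemma eval_deterministic:
  "eval P \<rho> e v t \<Longrightarrow> eval P \<rho> e v' t' \<Longrightarrow> v' = v \<and> t' = t"
  using eval_deterministic_aux(1) by blast

text \<open>The first function of a program is its entry point.\<close>

definition runs :: "program \<Rightarrow> data \<Rightarrow> data \<Rightarrow> nat \<Rightarrow> bool" where
  "runs P x y t \<longleftrightarrow> P \<noteq> [] \<and> eval P [x] (hd P) y t"

fun data_size :: "data \<Rightarrow> nat" where
  "data_size (Atom a) = 1 + floorlog 2 (nat \<bar>a\<bar>)"
| "data_size (Node x y) = 1 + data_size x + data_size y"

fun data_list :: "data list \<Rightarrow> data" where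
  "data_list [] = Atom 0"
| "data_list (x # xs) = Node x (data_list xs)"

definition computable_nat_fun :: "(nat \<Rightarrow> nat) \<Rightarrow> bool" where
  "computable_nat_fun f \<longleftrightarrow>
     (\<exists>P. \<forall>n. \<exists>t. runs P (Atom (int n)) (Atom (int (f n))) t)"


section \<open>Search problems and XP\<close>

text \<open>\<open>answer i y\<close>: the datum \<open>y\<close> is a correct output for the instance \<open>i\<close>.\<close>

record 'i problem =
  instances :: "'i set"
  encode :: "'i \<Rightarrow> data"
  answer :: "'i \<Rightarrow> data \<Rightarrow> bool"

definition solves_within :: "program \<Rightarrow> 'i problem \<Rightarrow> ('i \<Rightarrow> nat) \<Rightarrow> bool" where
  "solves_within P Q b \<longleftrightarrow>
     (\<forall>i\<in>instances Q. \<exists>y t. runs P (encode Q i) y t \<and> answer Q i y \<and> t \<le> b i)"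

text \<open>The parameter \<open>\<kappa> i\<close> is a function of the instance and not part of the input.\<close>

definition in_XP :: "'i problem \<Rightarrow> ('i \<Rightarrow> nat) \<Rightarrow> bool" where
  "in_XP Q \<kappa> \<longleftrightarrow>
     (\<exists>P f g. computable_nat_fun f \<and> computable_nat_fun g \<and>
        solves_within P Q (\<lambda>i. f (\<kappa> i) * data_size (encode Q i) ^ g (\<kappa> i)))"


section \<open>The problem MU-VC\<close>

definition mu_vc_solution :: "'a graph \<Rightarrow> int \<Rightarrow> 'a set \<Rightarrow> bool" where
  "mu_vc_solution G k S \<longleftrightarrow>
     S \<subseteq> verts G \<and> int (card S) \<le> k \<and> (\<exists>!C. minimum_vertex_cover (delete_verts G S) C)"

text \<open>As inputs of algorithms, graphs with \<open>n\<close> vertices have vertex set \<open>{0..<n}\<close> and are given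
  by \<open>n\<close> and their adjacency matrix.\<close>

definition encode_mu_vc :: "nat graph \<times> int \<Rightarrow> data" where
  "encode_mu_vc = (\<lambda>(G, k).
     let n = card (verts G) in
     Node (Atom (int n)) (Node (Atom k)
       (data_list (map (\<lambda>i. data_list (map (\<lambda>j. Atom (if {i, j} \<in> edges G then 1 else 0))
         [0..<n])) [0..<n]))))"

text \<open>\<open>Atom 0\<close> reports that there is no solution; a solution is returned as \<open>Node (Atom 1) L\<close>
  where \<open>L\<close> lists its elements in any order, so the empty solution is not confused with it.\<close>

definition answer_mu_vc :: "nat graph \<times> int \<Rightarrow> data \<Rightarrow> bool" where
  "answer_mu_vc = (\<lambda>(G, k) y.
     if \<exists>S. mu_vc_solution G k S
     then \<exists>xs. distinct xs \<and> mu_vc_solution G k (set xs) \<and>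
            y = Node (Atom 1) (data_list (map (\<lambda>v. Atom (int v)) xs))
     else y = Atom 0)"

definition mu_vc :: "(nat graph \<times> int) problem" where
  "mu_vc =
     \<lparr>instances = {(G, k). simple_graph G \<and> verts G = {0..<card (verts G)}},
      encode = encode_mu_vc,
      answer = answer_mu_vc\<rparr>"

end

(* The algorithm processes pieces: connected vertex sets C whose neighbourhood N(C) is small. For a
   set S of deleted vertices inside C, all that matters outside C is the profile of S, which maps every
   set Q of vertices of N(C) that are left uncovered to the minimum size of a cover of C - S that also
   covers the edges to Q, together with the information whether this optimum is unique. If |N(C)| <= d,
   there are at most (2(n+1))^(2^d) profiles, and it suffices to keep one S for every pair of a profile
   and a size |S|.

   No tree decomposition is computed. For w = 0, 1, 2, ... the algorithm saturates a table of pieces: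
   for every tuple Y of w + 1 vertices with first element v, it unites v with all known pieces C'
   such that N(C') contains v and is contained in Y; the union is a new piece if its neighbourhood lies
   in Y. Let G have treewidth w. If C is connected and N(C)
   is contained in a bag, then some v in C lies in a common bag with N(C), because in a tree no path
   can bypass an edge; the components of C - v then have their neighbourhoods in that bag too. Hence by
   induction on |C| all such C enter the table, among them the components of G. *)

theory Submission
  imports Defs
begin

section \<open>Evaluation of programs by rewriting\<close>

text \<open>Seen from inside a piece, a deleted outside vertex and one in the cover are alike:
  neither imposes a condition. So a profile only records which boundary vertices are uncovered,
  which gives \<open>2^d\<close> entries instead of \<open>3^d\<close>. Keeping one set per size and
  profile is an exchange argument: the profile of a union of disjoint non-adjacent pieces, or of a
  piece extended by a vertex, is a function of the old profiles. This includes uniqueness: a pair of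
  independent optima is unique iff both are, and of two alternatives the better one decides, a tie
  excluding uniqueness.

  Neither the treewidth nor a decomposition is given, so soundness and completeness are separated.
  Table entries are correct whatever \<open>w\<close> is, and the loop may stop as soon as the
  pieces without neighbours exhaust the vertices. The decomposition occurs only in the analysis, to
  show that this happens at the latest when \<open>w\<close> is the treewidth.

  Sizes and times are measured by powers of one number \<open>N\<close>, which exceeds the number of
  pairs of a size and a profile and the number of derivation attempts. The total time is a fixed
  power of \<open>N\<close>.\<close>

definition halts :: "program \<Rightarrow> nat \<Rightarrow> data list \<Rightarrow> bool" where
  "halts P i vs \<longleftrightarrow> i < length P \<and> (\<exists>v t. eval P vs (P ! i) v t)"

definition fun_val :: "program \<Rightarrow> nat \<Rightarrow> data list \<Rightarrow> data" where
  "fun_val P i vs = (THE v. \<exists>t. eval P vs (P ! i) v t)"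

definition fun_time :: "program \<Rightarrow> nat \<Rightarrow> data list \<Rightarrow> nat" where
  "fun_time P i vs = (THE t. \<exists>v. eval P vs (P ! i) v t)"

lemma fun_val_time_eq:
  assumes "eval P vs (P ! i) v t"
  shows "fun_val P i vs = v" "fun_time P i vs = t"
  unfolding fun_val_def fun_time_def using assms eval_deterministic by blast+

lemma halts_eval: "halts P i vs \<Longrightarrow> eval P vs (P ! i) (fun_val P i vs) (fun_time P i vs)"
  unfolding halts_def using fun_val_time_eq by metis

fun left_of :: "data \<Rightarrow> data" where
  "left_of (Node x y) = x" | "left_of (Atom a) = Atom a"
fun right_of :: "data \<Rightarrow> data" where
  "right_of (Node x y) = y" | "right_of (Atom a) = Atom a"
fun is_node :: "data \<Rightarrow> bool" where
  "is_node (Node x y) = True" | "is_node (Atom a) = False"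
fun int_of :: "data \<Rightarrow> int" where
  "int_of (Node x y) = 0" | "int_of (Atom a) = a"

lemma is_node_iff: "is_node d \<longleftrightarrow> (\<exists>x y. d = Node x y)" by (cases d) auto
lemma not_is_node_iff: "\<not> is_node d \<longleftrightarrow> (\<exists>a. d = Atom a)" by (cases d) auto

text \<open>A compositional reading of expressions relative to the behaviour of the called functions,
  so that a function body can be evaluated by rewriting. The values of stuck expressions are junk,
  which \<open>expr_safe\<close> excludes.\<close>

primrec expr_val :: "program \<Rightarrow> data list \<Rightarrow> expr \<Rightarrow> data" where
  "expr_val P \<rho> (Var i) = \<rho> ! i"
| "expr_val P \<rho> (Lit a) = Atom a"
| "expr_val P \<rho> (Prim f a b) = Atom (prim_op f (int_of (expr_val P \<rho> a)) (int_of (expr_val P \<rho> b)))"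
| "expr_val P \<rho> (MkNode a b) = Node (expr_val P \<rho> a) (expr_val P \<rho> b)"
| "expr_val P \<rho> (LeftOf a) = left_of (expr_val P \<rho> a)"
| "expr_val P \<rho> (RightOf a) = right_of (expr_val P \<rho> a)"
| "expr_val P \<rho> (IsNode a) = Atom (if is_node (expr_val P \<rho> a) then 1 else 0)"
| "expr_val P \<rho> (Cond a b c) = (if int_of (expr_val P \<rho> a) \<noteq> 0 then expr_val P \<rho> b else expr_val P \<rho> c)"
| "expr_val P \<rho> (Bind a b) = expr_val P (expr_val P \<rho> a # \<rho>) b"
| "expr_val P \<rho> (Call i es) = fun_val P i (map (expr_val P \<rho>) es)"

primrec expr_time :: "program \<Rightarrow> data list \<Rightarrow> expr \<Rightarrow> nat" where
  "expr_time P \<rho> (Var i) = 1"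
| "expr_time P \<rho> (Lit a) = 1"
| "expr_time P \<rho> (Prim f a b) = 1 + expr_time P \<rho> a + expr_time P \<rho> b"
| "expr_time P \<rho> (MkNode a b) = 1 + expr_time P \<rho> a + expr_time P \<rho> b"
| "expr_time P \<rho> (LeftOf a) = 1 + expr_time P \<rho> a"
| "expr_time P \<rho> (RightOf a) = 1 + expr_time P \<rho> a"
| "expr_time P \<rho> (IsNode a) = 1 + expr_time P \<rho> a"
| "expr_time P \<rho> (Cond a b c) = 1 + expr_time P \<rho> a + (if int_of (expr_val P \<rho> a) \<noteq> 0 then expr_time P \<rho> b else expr_time P \<rho> c)"
| "expr_time P \<rho> (Bind a b) = 1 + expr_time P \<rho> a + expr_time P (expr_val P \<rho> a # \<rho>) b"
| "expr_time P \<rho> (Call i es) = 1 + sum_list (map (expr_time P \<rho>) es) + fun_time P i (map (expr_val P \<rho>) es)"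

primrec expr_safe :: "program \<Rightarrow> data list \<Rightarrow> expr \<Rightarrow> bool" where
  "expr_safe P \<rho> (Var i) = (i < length \<rho>)"
| "expr_safe P \<rho> (Lit a) = True"
| "expr_safe P \<rho> (Prim f a b) = (expr_safe P \<rho> a \<and> expr_safe P \<rho> b \<and> \<not> is_node (expr_val P \<rho> a) \<and> \<not> is_node (expr_val P \<rho> b))"
| "expr_safe P \<rho> (MkNode a b) = (expr_safe P \<rho> a \<and> expr_safe P \<rho> b)"
| "expr_safe P \<rho> (LeftOf a) = (expr_safe P \<rho> a \<and> is_node (expr_val P \<rho> a))"
| "expr_safe P \<rho> (RightOf a) = (expr_safe P \<rho> a \<and> is_node (expr_val P \<rho> a))"
| "expr_safe P \<rho> (IsNode a) = expr_safe P \<rho> a"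
| "expr_safe P \<rho> (Cond a b c) =
     (expr_safe P \<rho> a \<and> \<not> is_node (expr_val P \<rho> a) \<and> (if int_of (expr_val P \<rho> a) \<noteq> 0 then expr_safe P \<rho> b else expr_safe P \<rho> c))"
| "expr_safe P \<rho> (Bind a b) = (expr_safe P \<rho> a \<and> expr_safe P (expr_val P \<rho> a # \<rho>) b)"
| "expr_safe P \<rho> (Call i es) = (list_all (expr_safe P \<rho>) es \<and> halts P i (map (expr_val P \<rho>) es))"

lemma evals_map:
  "list_all (\<lambda>e. eval P \<rho> e (f e) (g e)) es \<Longrightarrow> evals P \<rho> es (map f es) (sum_list (map g es))"
  by (induction es) (auto intro: eval_evals.intros)

lemma expr_safe_eval: "expr_safe P \<rho> e \<Longrightarrow> eval P \<rho> e (expr_val P \<rho> e) (expr_time P \<rho> e)"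
proof (induction e arbitrary: \<rho>)
  case (Prim f a b)
  then obtain x y where "expr_val P \<rho> a = Atom x" "expr_val P \<rho> b = Atom y"
    by (auto simp: not_is_node_iff)
  then show ?case
    using Prim.prems Prim.IH[of \<rho>] eval_Prim[of P \<rho> a x "expr_time P \<rho> a" b y "expr_time P \<rho> b" f] by auto
next
  case (LeftOf e)
  then obtain x y where "expr_val P \<rho> e = Node x y" by (auto simp: is_node_iff)
  then show ?case using LeftOf.prems LeftOf.IH[of \<rho>] eval_LeftOf[of P \<rho> e x y "expr_time P \<rho> e"] by auto
next
  case (RightOf e)
  then obtain x y where "expr_val P \<rho> e = Node x y" by (auto simp: is_node_iff)
  then show ?case using RightOf.prems RightOf.IH[of \<rho>] eval_RightOf[of P \<rho> e x y "expr_time P \<rho> e"] by auto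
next
  case (MkNode a b)
  then show ?case using eval_MkNode[of P \<rho> a _ _ b] by auto
next
  case (Var i)
  then show ?case using eval_Var[of i \<rho> P] by simp
next
  case (Lit i)
  then show ?case using eval_Lit[of P \<rho> i] by simp
next
  case (IsNode e)
  then have *: "eval P \<rho> e (expr_val P \<rho> e) (expr_time P \<rho> e)" by simp
  show ?case using eval_IsNode_Node[of P \<rho> e _ _ "expr_time P \<rho> e"] eval_IsNode_Atom[of P \<rho> e _ "expr_time P \<rho> e"] *
    by (cases "expr_val P \<rho> e") auto
next
  case (Cond a b c)
  then obtain x where "expr_val P \<rho> a = Atom x" by (auto simp: not_is_node_iff)
  then show ?case using Cond.prems Cond.IH[of \<rho>] eval_Cond_True[of P \<rho> a x "expr_time P \<rho> a" b] eval_Cond_False[of P \<rho> a "expr_time P \<rho> a" c]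
    by (auto split: if_splits)
next
  case (Bind a b)
  then show ?case using eval_Bind[OF Bind.IH(1)[of \<rho>] Bind.IH(2)[of "expr_val P \<rho> a # \<rho>"]] by auto
next
  case (Call i es)
  then have "list_all (\<lambda>e. eval P \<rho> e (expr_val P \<rho> e) (expr_time P \<rho> e)) es"
    by (auto simp: list_all_iff)
  note evals_map[OF this]
  then show ?case using Call.prems halts_eval[of P i "map (expr_val P \<rho>) es"]
      eval_Call[of i P \<rho> es] by (auto simp: halts_def)
qed

text \<open>The value is exact and the time only an upper bound. Facts of this form about the called
  functions act as rewrite rules when \<open>okI\<close> evaluates one body; recursion is left to an
  outer induction.\<close>

definition ok :: "program \<Rightarrow> nat \<Rightarrow> data list \<Rightarrow> data \<Rightarrow> nat \<Rightarrow> bool" where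
  "ok P i vs v b \<longleftrightarrow> halts P i vs \<and> fun_val P i vs = v \<and> fun_time P i vs \<le> b"

lemma okI:
  assumes "i < length P" "expr_safe P vs (P ! i)" "expr_val P vs (P ! i) = v" "expr_time P vs (P ! i) \<le> b"
  shows "ok P i vs v b"
  using assms expr_safe_eval[OF assms(2)] fun_val_time_eq[OF expr_safe_eval[OF assms(2)]]
  unfolding ok_def halts_def by auto

lemma ok_mono: "ok P i vs v b \<Longrightarrow> b \<le> b' \<Longrightarrow> ok P i vs v b'"
  by (auto simp: ok_def)

section \<open>The program\<close>

definition "f_main = (0::nat)"
definition "f_down = (1::nat)"
definition "f_mem = (2::nat)"
definition "f_all = (3::nat)"
definition "f_nth = (4::nat)"
definition "f_adjany = (5::nat)"
definition "f_nbrs = (6::nat)"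
definition "f_app = (7::nat)"
definition "f_consall = (8::nat)"
definition "f_ext = (9::nat)"
definition "f_get = (10::nat)"
definition "f_addleaf = (11::nat)"
definition "f_minleaf = (12::nat)"
definition "f_leaf = (13::nat)"
definition "f_tab = (14::nat)"
definition "f_eqd = (15::nat)"
definition "f_haskey = (16::nat)"
definition "f_ins = (17::nat)"
definition "f_mergein = (18::nat)"
definition "f_merge = (19::nat)"
definition "f_fits = (20::nat)"
definition "f_gather = (21::nat)"
definition "f_start = (22::nat)"
definition "f_close = (23::nat)"
definition "f_derive = (24::nat)"
definition "f_loop_y = (25::nat)"
definition "f_loop_r = (26::nat)"
definition "f_loop_w = (27::nat)"
definition "f_choose = (28::nat)"

text \<open>
  The parameters of the functions, in the order in which the bodies refer to them:
  \<open>main(x)\<close>, \<open>down(n)\<close>, \<open>mem(x,A)\<close>,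
  \<open>all(A,B,b)\<close>, \<open>nth(A,i)\<close>, \<open>adjany(M,u,A)\<close>,
  \<open>nbrs(M,C,A)\<close>, \<open>app(A,B)\<close>, \<open>consall(v,A,B)\<close>,
  \<open>ext(A,B)\<close>, \<open>get(p,Y,O)\<close>, \<open>addleaf(a,b)\<close>,
  \<open>minleaf(a,b,c)\<close>, \<open>leaf(O,p,Y,g,X,M)\<close>,
  \<open>tab(Z,O,p,Y,g,X,M)\<close>, \<open>eqd(a,b)\<close>, \<open>haskey(k,A)\<close>,
  \<open>ins(i,A)\<close>, \<open>mergein(i,Q,A,Y,X,Z,M)\<close>,
  \<open>merge(B,Q,A,Y,X,Z,M)\<close>, \<open>fits(C,X,Y,U)\<close>,
  \<open>gather(T,Y,U,A,M)\<close>, \<open>start(T,Y,M)\<close>,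
  \<open>close(M,Y,T,r,X)\<close>, \<open>derive(M,V,Y,T)\<close>,
  \<open>loop_y(M,V,A,T)\<close>, \<open>loop_r(M,V,W,A,T)\<close>,
  \<open>loop_w(M,V,k,A)\<close>, \<open>choose(A,k)\<close>.
  Here \<open>M\<close> is the adjacency matrix, \<open>V\<close> the list of all vertices, \<open>T\<close> the table of pieces \<open>(C, (N(C), items))\<close>,
  \<open>Y\<close> and \<open>Z\<close> are bags, \<open>p\<close> and \<open>g\<close> are profiles over \<open>Y\<close> and \<open>X\<close>, and \<open>O\<close> is a set of uncovered vertices.
  Since a profile is never an atom, \<open>leaf\<close> uses atoms for \<open>g\<close> to select other operations: \<open>2\<close> is the
  profile of the empty piece, \<open>1\<close> and \<open>0\<close> add the vertex \<open>hd Y\<close> as a deleted or a remaining vertex.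
\<close>

definition "b_main =
    Call f_loop_w [RightOf (RightOf (Var 0)), Call f_down [LeftOf (Var 0)], LeftOf (RightOf
    (Var 0)), MkNode (Lit 0) (Lit 0)]"
definition "b_down =
    Cond (Var 0) (MkNode (Prim Sub (Var 0) (Lit 1)) (Call f_down [Prim Sub (Var 0) (Lit
    1)])) (Lit 0)"
definition "b_mem =
    Cond (IsNode (Var 1)) (Cond (Prim Equal (Var 0) (LeftOf (Var 1))) (Lit 1) (Call f_mem
    [Var 0, RightOf (Var 1)])) (Lit 0)"
definition "b_all =
    Cond (IsNode (Var 0)) (Cond (Prim Equal (Call f_mem [LeftOf (Var 0), Var 1]) (Var 2))
    (Call f_all [RightOf (Var 0), Var 1, Var 2]) (Lit 0)) (Lit 1)"
definition "b_nth =
    Cond (Var 1) (Call f_nth [RightOf (Var 0), Prim Sub (Var 1) (Lit 1)]) (LeftOf (Var 0))"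
definition "b_adjany =
    Cond (IsNode (Var 2)) (Cond (Call f_nth [Call f_nth [Var 0, Var 1], LeftOf (Var 2)])
    (Lit 1) (Call f_adjany [Var 0, Var 1, RightOf (Var 2)])) (Lit 0)"
definition "b_nbrs =
    Cond (IsNode (Var 2)) (Cond (Call f_mem [LeftOf (Var 2), Var 1]) (Call f_nbrs [Var 0,
    Var 1, RightOf (Var 2)]) (Cond (Call f_adjany [Var 0, LeftOf (Var 2), Var 1]) (MkNode
    (LeftOf (Var 2)) (Call f_nbrs [Var 0, Var 1, RightOf (Var 2)])) (Call f_nbrs [Var 0, Var
    1, RightOf (Var 2)]))) (Lit 0)"
definition "b_app =
    Cond (IsNode (Var 0)) (MkNode (LeftOf (Var 0)) (Call f_app [RightOf (Var 0), Var 1]))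
    (Var 1)"
definition "b_consall =
    Cond (IsNode (Var 1)) (MkNode (MkNode (Var 0) (LeftOf (Var 1))) (Call f_consall [Var 0,
    RightOf (Var 1), Var 2])) (Var 2)"
definition "b_ext =
    Cond (IsNode (Var 0)) (Call f_consall [LeftOf (Var 0), Var 1, Call f_ext [RightOf (Var
    0), Var 1]]) (Lit 0)"
definition "b_get =
    Cond (IsNode (Var 1)) (Call f_get [Cond (Call f_mem [LeftOf (Var 1), Var 2]) (RightOf
    (Var 0)) (LeftOf (Var 0)), RightOf (Var 1), Var 2]) (Var 0)"
definition "b_addleaf =
    MkNode (Prim Add (LeftOf (Var 0)) (LeftOf (Var 1))) (Cond (RightOf (Var 0)) (RightOf
    (Var 1)) (Lit 0))"
definition "b_minleaf =
    Cond (Var 2) (MkNode (Prim Add (LeftOf (Var 0)) (Lit 1)) (RightOf (Var 0))) (Cond (Prim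
    Less (Prim Add (LeftOf (Var 0)) (Lit 1)) (LeftOf (Var 1))) (MkNode (Prim Add (LeftOf
    (Var 0)) (Lit 1)) (RightOf (Var 0))) (Cond (Prim Less (LeftOf (Var 1)) (Prim Add (LeftOf
    (Var 0)) (Lit 1))) (Var 1) (MkNode (LeftOf (Var 1)) (Lit 0))))"
definition "b_leaf =
    Cond (IsNode (Var 3)) (Call f_addleaf [Call f_get [Var 1, Var 2, Var 0], Call f_get [Var
    3, Var 4, Var 0]]) (Cond (Prim Equal (Var 3) (Lit 2)) (MkNode (Lit 0) (Lit 1)) (Cond
    (Prim Equal (Var 3) (Lit 1)) (Call f_get [Var 1, Var 2, Var 0]) (Call f_minleaf [Call
    f_get [Var 1, Var 2, Var 0], Call f_get [Var 1, Var 2, MkNode (LeftOf (Var 2)) (Var 0)],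
    Call f_adjany [Var 5, LeftOf (Var 2), Var 0]])))"
definition "b_tab =
    Cond (IsNode (Var 0)) (MkNode (Call f_tab [RightOf (Var 0), Var 1, Var 2, Var 3, Var 4,
    Var 5, Var 6]) (Call f_tab [RightOf (Var 0), MkNode (LeftOf (Var 0)) (Var 1), Var 2, Var
    3, Var 4, Var 5, Var 6])) (Call f_leaf [Var 1, Var 2, Var 3, Var 4, Var 5, Var 6])"
definition "b_eqd =
    Cond (IsNode (Var 0)) (Cond (IsNode (Var 1)) (Cond (Call f_eqd [LeftOf (Var 0), LeftOf
    (Var 1)]) (Call f_eqd [RightOf (Var 0), RightOf (Var 1)]) (Lit 0)) (Lit 0)) (Cond
    (IsNode (Var 1)) (Lit 0) (Prim Equal (Var 0) (Var 1)))"
definition "b_haskey =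
    Cond (IsNode (Var 1)) (Cond (Call f_eqd [Var 0, LeftOf (LeftOf (Var 1))]) (Lit 1) (Call
    f_haskey [Var 0, RightOf (Var 1)])) (Lit 0)"
definition "b_ins =
    Cond (Call f_haskey [LeftOf (Var 0), Var 1]) (Var 1) (MkNode (Var 0) (Var 1))"
definition "b_mergein =
    Cond (IsNode (Var 1)) (Call f_mergein [Var 0, RightOf (Var 1), Call f_ins [MkNode
    (MkNode (Prim Add (LeftOf (LeftOf (Var 0))) (LeftOf (LeftOf (LeftOf (Var 1))))) (Call
    f_tab [Var 5, Lit 0, RightOf (LeftOf (Var 0)), Var 3, RightOf (LeftOf (LeftOf (Var 1))),
    Var 4, Var 6])) (Call f_app [RightOf (Var 0), RightOf (LeftOf (Var 1))]), Var 2], Var 3,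
    Var 4, Var 5, Var 6]) (Var 2)"
definition "b_merge =
    Cond (IsNode (Var 0)) (Call f_merge [RightOf (Var 0), Var 1, Call f_mergein [LeftOf (Var
    0), Var 1, Var 2, Var 3, Var 4, Var 5, Var 6], Var 3, Var 4, Var 5, Var 6]) (Var 2)"
definition "b_fits =
    Cond (Cond (IsNode (Var 2)) (Call f_mem [LeftOf (Var 2), Var 1]) (Lit 1)) (Cond (Call
    f_all [Var 1, Var 2, Lit 1]) (Cond (Call f_all [Var 0, Var 2, Lit 0]) (Call f_all [Var
    0, Var 3, Lit 0]) (Lit 0)) (Lit 0)) (Lit 0)"
definition "b_gather =
    Cond (IsNode (Var 0)) (Cond (Call f_fits [LeftOf (LeftOf (Var 0)), LeftOf (RightOf
    (LeftOf (Var 0))), Var 1, Var 2]) (Call f_gather [RightOf (Var 0), Var 1, Call f_app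
    [LeftOf (LeftOf (Var 0)), Var 2], Call f_merge [Var 3, RightOf (RightOf (LeftOf (Var
    0))), Lit 0, Var 1, LeftOf (RightOf (LeftOf (Var 0))), Var 1, Var 4], Var 4]) (Call
    f_gather [RightOf (Var 0), Var 1, Var 2, Var 3, Var 4])) (MkNode (Var 2) (Var 3))"
definition "b_start =
    Call f_gather [Var 0, Var 1, Lit 0, MkNode (MkNode (MkNode (Lit 0) (Call f_tab [Var 1,
    Lit 0, Lit 0, Lit 0, Lit 2, Lit 0, Lit 0])) (Lit 0)) (Lit 0), Var 2]"
definition "b_close =
    Cond (Call f_all [Var 4, Var 1, Lit 1]) (MkNode (MkNode (MkNode (LeftOf (Var 1)) (LeftOf
    (Var 3))) (MkNode (Var 4) (Call f_merge [RightOf (Var 3), MkNode (MkNode (MkNode (Lit 1)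
    (Lit 1)) (MkNode (LeftOf (Var 1)) (Lit 0))) (MkNode (MkNode (MkNode (Lit 0) (Lit 0))
    (Lit 0)) (Lit 0)), Lit 0, Var 1, Lit 0, Var 4, Var 0]))) (Var 2)) (Var 2)"
definition "b_derive =
    Bind (Call f_start [Var 3, Var 2, Var 0]) (Call f_close [Var 1, Var 3, Var 4, Var 0,
    Call f_nbrs [Var 1, MkNode (LeftOf (Var 3)) (LeftOf (Var 0)), Var 2]])"
definition "b_loop_y =
    Cond (IsNode (Var 2)) (Call f_loop_y [Var 0, Var 1, RightOf (Var 2), Call f_derive [Var
    0, Var 1, LeftOf (Var 2), Var 3]]) (Var 3)"
definition "b_loop_r =
    Cond (IsNode (Var 2)) (Call f_loop_r [Var 0, Var 1, RightOf (Var 2), Var 3, Call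
    f_loop_y [Var 0, Var 1, Var 3, Var 4]]) (Var 4)"
definition "b_loop_w =
    Bind (Call f_ext [Var 1, Var 3]) (Bind (Call f_start [Call f_loop_r [Var 1, Var 2, Var
    2, Var 0, Lit 0], Lit 0, Var 1]) (Cond (Call f_all [Var 3, LeftOf (Var 0), Lit 1]) (Call
    f_choose [RightOf (Var 0), Var 4]) (Call f_loop_w [Var 2, Var 3, Var 4, Var 1])))"
definition "b_choose =
    Cond (IsNode (Var 0)) (Cond (RightOf (RightOf (LeftOf (LeftOf (Var 0))))) (Cond (Prim
    Less (Var 1) (LeftOf (LeftOf (LeftOf (Var 0))))) (Call f_choose [RightOf (Var 0), Var
    1]) (MkNode (Lit 1) (RightOf (LeftOf (Var 0))))) (Call f_choose [RightOf (Var 0), Var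
    1])) (Lit 0)"

definition mu_prog :: program where
  "mu_prog = [b_main, b_down, b_mem, b_all, b_nth, b_adjany, b_nbrs, b_app, b_consall,
     b_ext, b_get, b_addleaf, b_minleaf, b_leaf, b_tab, b_eqd, b_haskey, b_ins, b_mergein,
     b_merge, b_fits, b_gather, b_start, b_close, b_derive, b_loop_y, b_loop_r, b_loop_w,
     b_choose]"

lemmas f_defs =
  f_main_def f_down_def f_mem_def f_all_def f_nth_def f_adjany_def f_nbrs_def f_app_def
  f_consall_def f_ext_def f_get_def f_addleaf_def f_minleaf_def f_leaf_def f_tab_def
  f_eqd_def f_haskey_def f_ins_def f_mergein_def f_merge_def f_fits_def f_gather_def
  f_start_def f_close_def f_derive_def f_loop_y_def f_loop_r_def f_loop_w_def f_choose_def

lemma mu_prog_nth [simp]: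
  "mu_prog ! f_main = b_main"
  "mu_prog ! f_down = b_down"
  "mu_prog ! f_mem = b_mem"
  "mu_prog ! f_all = b_all"
  "mu_prog ! f_nth = b_nth"
  "mu_prog ! f_adjany = b_adjany"
  "mu_prog ! f_nbrs = b_nbrs"
  "mu_prog ! f_app = b_app"
  "mu_prog ! f_consall = b_consall"
  "mu_prog ! f_ext = b_ext"
  "mu_prog ! f_get = b_get"
  "mu_prog ! f_addleaf = b_addleaf"
  "mu_prog ! f_minleaf = b_minleaf"
  "mu_prog ! f_leaf = b_leaf"
  "mu_prog ! f_tab = b_tab"
  "mu_prog ! f_eqd = b_eqd"
  "mu_prog ! f_haskey = b_haskey"
  "mu_prog ! f_ins = b_ins"
  "mu_prog ! f_mergein = b_mergein"
  "mu_prog ! f_merge = b_merge"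
  "mu_prog ! f_fits = b_fits"
  "mu_prog ! f_gather = b_gather"
  "mu_prog ! f_start = b_start"
  "mu_prog ! f_close = b_close"
  "mu_prog ! f_derive = b_derive"
  "mu_prog ! f_loop_y = b_loop_y"
  "mu_prog ! f_loop_r = b_loop_r"
  "mu_prog ! f_loop_w = b_loop_w"
  "mu_prog ! f_choose = b_choose"
  by (simp_all add: mu_prog_def f_defs)

lemma length_mu_prog [simp]:
  "f_main < length mu_prog"
  "f_down < length mu_prog"
  "f_mem < length mu_prog"
  "f_all < length mu_prog"
  "f_nth < length mu_prog"
  "f_adjany < length mu_prog"
  "f_nbrs < length mu_prog"
  "f_app < length mu_prog"
  "f_consall < length mu_prog"
  "f_ext < length mu_prog"
  "f_get < length mu_prog"
  "f_addleaf < length mu_prog"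
  "f_minleaf < length mu_prog"
  "f_leaf < length mu_prog"
  "f_tab < length mu_prog"
  "f_eqd < length mu_prog"
  "f_haskey < length mu_prog"
  "f_ins < length mu_prog"
  "f_mergein < length mu_prog"
  "f_merge < length mu_prog"
  "f_fits < length mu_prog"
  "f_gather < length mu_prog"
  "f_start < length mu_prog"
  "f_close < length mu_prog"
  "f_derive < length mu_prog"
  "f_loop_y < length mu_prog"
  "f_loop_r < length mu_prog"
  "f_loop_w < length mu_prog"
  "f_choose < length mu_prog"
  by (simp_all add: mu_prog_def f_defs)

section \<open>Elementary functions on lists\<close>

abbreviation computes :: "nat \<Rightarrow> data list \<Rightarrow> data \<Rightarrow> nat \<Rightarrow> bool" where
  "computes \<equiv> ok mu_prog"

abbreviation el :: "nat list \<Rightarrow> data" where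
  "el xs \<equiv> data_list (map (\<lambda>x. Atom (int x)) xs)"

abbreviation bool_atom :: "bool \<Rightarrow> data" where
  "bool_atom b \<equiv> Atom (if b then 1 else 0)"

text \<open>Pattern for the later functions: induction on the recursion argument, one unfolding of
  the body by \<open>okI\<close>, and a generous constant per call.\<close>

lemma mem_computes:
  "computes f_mem [Atom (int x), el A] (bool_atom (x \<in> set A)) (20 * (length A + 1))"
  by (induction A) (rule okI; simp add: b_mem_def ok_def)+

text \<open>The flag \<open>b\<close> lets one function test both inclusion and
  disjointness.\<close>

lemma all_computes:
  "length B < N \<Longrightarrow> computes f_all [el A, el B, bool_atom b]
     (bool_atom (\<forall>x\<in>set A. (x \<in> set B) = b)) ((length A + 1) * (50 * N))"
proof (induction A)
  case (Cons x A)
  show ?case using Cons mem_computes[of x B]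
    by (intro okI; auto simp: b_all_def ok_def)
qed (rule okI; simp add: b_all_def ok_def)

lemma nth_computes:
  "i < length ds \<Longrightarrow> computes f_nth [data_list ds, Atom (int i)] (ds ! i) (20 * (i + 1))"
proof (induction ds arbitrary: i)
  case (Cons d ds)
  show ?case
  proof (cases i)
    case 0
    then show ?thesis by (intro okI; simp add: b_nth_def ok_def)
  next
    case (Suc j)
    then show ?thesis using Cons.IH[of j] Cons.prems by (intro okI; simp add: b_nth_def ok_def)
  qed
qed simp

section \<open>Optimal members of set families\<close>

definition opt :: "'a set set \<Rightarrow> nat" where
  "opt F = (LEAST k. \<exists>D\<in>F. card D = k)"

definition uniq_opt :: "'a set set \<Rightarrow> bool" where
  "uniq_opt F \<longleftrightarrow> (\<exists>!D. D \<in> F \<and> card D = opt F)"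

lemma opt_eqI: "D \<in> F \<Longrightarrow> card D = k \<Longrightarrow> (\<And>D. D \<in> F \<Longrightarrow> k \<le> card D) \<Longrightarrow> opt F = k"
  unfolding opt_def by (rule Least_equality) auto

lemma opt_le: "D \<in> F \<Longrightarrow> opt F \<le> card D"
  unfolding opt_def by (rule Least_le) auto

lemma opt_attained: "F \<noteq> {} \<Longrightarrow> \<exists>D\<in>F. card D = opt F"
  unfolding opt_def by (rule LeastI_ex) auto

text \<open>As the members live on disjoint ground sets, a union determines its two parts. Hence
  sizes add, and the optimal unions correspond to the pairs of optimal parts.\<close>

lemma opt_Un_disjoint:
  assumes "F1 \<noteq> {}" "F2 \<noteq> {}" "\<And>D. D \<in> F1 \<Longrightarrow> D \<subseteq> U1" "\<And>D. D \<in> F2 \<Longrightarrow> D \<subseteq> U2"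
    "U1 \<inter> U2 = {}" "finite U1" "finite U2"
  defines "F \<equiv> {D1 \<union> D2 | D1 D2. D1 \<in> F1 \<and> D2 \<in> F2}"
  shows "opt F = opt F1 + opt F2" "uniq_opt F \<longleftrightarrow> uniq_opt F1 \<and> uniq_opt F2"
proof -
  have cd: "card (D1 \<union> D2) = card D1 + card D2" if "D1 \<in> F1" "D2 \<in> F2" for D1 D2
    using assms(3)[OF that(1)] assms(4)[OF that(2)] assms(5-7)
    by (intro card_Un_disjoint) (auto intro: finite_subset)
  obtain A1 A2 where A: "A1 \<in> F1" "card A1 = opt F1" "A2 \<in> F2" "card A2 = opt F2"
    using opt_attained assms(1,2) by metis
  show o: "opt F = opt F1 + opt F2"
  proof (rule opt_eqI)
    show "A1 \<union> A2 \<in> F" unfolding F_def using A by blast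
    show "card (A1 \<union> A2) = opt F1 + opt F2" using cd A by simp
    show "opt F1 + opt F2 \<le> card D" if "D \<in> F" for D
    proof -
      obtain D1 D2 where "D = D1 \<union> D2" "D1 \<in> F1" "D2 \<in> F2"
        using \<open>D \<in> F\<close> unfolding F_def by auto
      then show ?thesis using cd opt_le[of D1 F1] opt_le[of D2 F2] by simp
    qed
  qed
  have inj: "D1 = E1 \<and> D2 = E2"
    if "D1 \<union> D2 = E1 \<union> E2" "D1 \<in> F1" "E1 \<in> F1" "D2 \<in> F2" "E2 \<in> F2" for D1 D2 E1 E2
  proof -
    have "D1 = (D1 \<union> D2) \<inter> U1" "E1 = (E1 \<union> E2) \<inter> U1"
      "D2 = (D1 \<union> D2) \<inter> U2" "E2 = (E1 \<union> E2) \<inter> U2"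
      using that(2-) assms(3,4,5) by blast+
    then show ?thesis using that(1) by metis
  qed
  have mem: "D \<in> F \<and> card D = opt F \<longleftrightarrow>
     (\<exists>D1 D2. D = D1 \<union> D2 \<and> (D1 \<in> F1 \<and> card D1 = opt F1) \<and> (D2 \<in> F2 \<and> card D2 = opt F2))" for D
  proof
    assume l: "D \<in> F \<and> card D = opt F"
    then obtain D1 D2 where D: "D = D1 \<union> D2" "D1 \<in> F1" "D2 \<in> F2" unfolding F_def by auto
    then have "card D1 + card D2 = opt F1 + opt F2" using cd l o by simp
    then have "card D1 = opt F1" "card D2 = opt F2"
      using opt_le[OF D(2)] opt_le[OF D(3)] by auto
    then show "\<exists>D1 D2. D = D1 \<union> D2 \<and> (D1 \<in> F1 \<and> card D1 = opt F1) \<and> (D2 \<in> F2 \<and> card D2 = opt F2)"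
      using D by blast
  next
    assume "\<exists>D1 D2. D = D1 \<union> D2 \<and> (D1 \<in> F1 \<and> card D1 = opt F1) \<and> (D2 \<in> F2 \<and> card D2 = opt F2)"
    then show "D \<in> F \<and> card D = opt F" using cd o unfolding F_def by auto
  qed
  show "uniq_opt F \<longleftrightarrow> uniq_opt F1 \<and> uniq_opt F2"
  proof
    assume "uniq_opt F"
    then have u: "D = D'" if "D \<in> F \<and> card D = opt F" "D' \<in> F \<and> card D' = opt F" for D D'
      using that unfolding uniq_opt_def by blast
    have "D1 = A1" if "D1 \<in> F1" "card D1 = opt F1" for D1
    proof -
      have "D1 \<union> A2 \<in> F \<and> card (D1 \<union> A2) = opt F" "A1 \<union> A2 \<in> F \<and> card (A1 \<union> A2) = opt F"
        using mem that A by blast+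
      from u[OF this] show ?thesis using inj that A by blast
    qed
    moreover have "D2 = A2" if "D2 \<in> F2" "card D2 = opt F2" for D2
    proof -
      have "A1 \<union> D2 \<in> F \<and> card (A1 \<union> D2) = opt F" "A1 \<union> A2 \<in> F \<and> card (A1 \<union> A2) = opt F"
        using mem that A by blast+
      from u[OF this] show ?thesis using inj that A by blast
    qed
    ultimately show "uniq_opt F1 \<and> uniq_opt F2" using A unfolding uniq_opt_def by blast
  next
    assume "uniq_opt F1 \<and> uniq_opt F2"
    then have u: "\<And>D1. D1 \<in> F1 \<and> card D1 = opt F1 \<Longrightarrow> D1 = A1"
      "\<And>D2. D2 \<in> F2 \<and> card D2 = opt F2 \<Longrightarrow> D2 = A2"
      using A unfolding uniq_opt_def by blast+
    show "uniq_opt F" unfolding uniq_opt_def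
    proof (rule ex1I[of _ "A1 \<union> A2"])
      show "A1 \<union> A2 \<in> F \<and> card (A1 \<union> A2) = opt F" using mem A by blast
      show "D = A1 \<union> A2" if "D \<in> F \<and> card D = opt F" for D
        using that u unfolding mem by blast
    qed
  qed
qed

text \<open>Product with the family \<open>{{v}}\<close>, whose only member has size 1.\<close>

lemma opt_insert:
  assumes "F1 \<noteq> {}" "\<And>D. D \<in> F1 \<Longrightarrow> D \<subseteq> U" "v \<notin> U" "finite U"
  shows "opt {insert v D | D. D \<in> F1} = opt F1 + 1"
    "uniq_opt {insert v D | D. D \<in> F1} \<longleftrightarrow> uniq_opt F1"
proof -
  have eq: "{insert v D | D. D \<in> F1} = {D1 \<union> D2 | D1 D2. D1 \<in> {{v}} \<and> D2 \<in> F1}" by auto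
  have o: "opt {{v}} = 1" by (rule opt_eqI) auto
  have u: "uniq_opt {{v}}" unfolding uniq_opt_def o by (rule ex1I[of _ "{v}"]) auto
  have "opt {D1 \<union> D2 | D1 D2. D1 \<in> {{v}} \<and> D2 \<in> F1} = opt {{v}} + opt F1"
    using assms(3) by (intro opt_Un_disjoint(1)[of "{{v}}" F1 "{v}" U, OF _ assms(1) _ assms(2) _ _ assms(4)]) simp_all
  then show "opt {insert v D | D. D \<in> F1} = opt F1 + 1" unfolding eq o by simp
  have "uniq_opt {D1 \<union> D2 | D1 D2. D1 \<in> {{v}} \<and> D2 \<in> F1} \<longleftrightarrow> uniq_opt {{v}} \<and> uniq_opt F1"
    using assms(3) by (intro opt_Un_disjoint(2)[of "{{v}}" F1 "{v}" U, OF _ assms(1) _ assms(2) _ _ assms(4)]) simp_all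
  then show "uniq_opt {insert v D | D. D \<in> F1} \<longleftrightarrow> uniq_opt F1" unfolding eq using u by blast
qed

text \<open>In a tie each family contributes an optimal member, and these differ because the
  families are disjoint. Otherwise all optimal members belong to the better family.\<close>

lemma opt_union:
  assumes "F1 \<noteq> {}" "F2 \<noteq> {}" "F1 \<inter> F2 = {}"
  shows "opt (F1 \<union> F2) = min (opt F1) (opt F2)"
    "uniq_opt (F1 \<union> F2) \<longleftrightarrow> (if opt F1 < opt F2 then uniq_opt F1
       else if opt F2 < opt F1 then uniq_opt F2 else False)"
proof -
  obtain A1 A2 where A: "A1 \<in> F1" "card A1 = opt F1" "A2 \<in> F2" "card A2 = opt F2"
    using opt_attained assms(1,2) by metis
  have le: "D \<in> F1 \<union> F2 \<Longrightarrow> min (opt F1) (opt F2) \<le> card D" for D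
    using opt_le[of D F1] opt_le[of D F2] by (auto simp: min_def)
  show o: "opt (F1 \<union> F2) = min (opt F1) (opt F2)"
  proof (cases "opt F1 \<le> opt F2")
    case True
    then show ?thesis using A le by (intro opt_eqI[of A1]) auto
  next
    case False
    then show ?thesis using A le by (intro opt_eqI[of A2]) auto
  qed
  consider "opt F1 < opt F2" | "opt F2 < opt F1" | "opt F1 = opt F2" by linarith
  then show "uniq_opt (F1 \<union> F2) \<longleftrightarrow> (if opt F1 < opt F2 then uniq_opt F1
       else if opt F2 < opt F1 then uniq_opt F2 else False)"
  proof cases
    case 1
    then have "D \<in> F1 \<union> F2 \<and> card D = opt (F1 \<union> F2) \<longleftrightarrow> D \<in> F1 \<and> card D = opt F1" for D
      using o opt_le[of D F2] by auto
    then show ?thesis using 1 unfolding uniq_opt_def by simp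
  next
    case 2
    then have "D \<in> F1 \<union> F2 \<and> card D = opt (F1 \<union> F2) \<longleftrightarrow> D \<in> F2 \<and> card D = opt F2" for D
      using o opt_le[of D F1] by auto
    then show ?thesis using 2 unfolding uniq_opt_def by simp
  next
    case 3
    then have "A1 \<noteq> A2" "A1 \<in> F1 \<union> F2 \<and> card A1 = opt (F1 \<union> F2)"
      "A2 \<in> F1 \<union> F2 \<and> card A2 = opt (F1 \<union> F2)"
      using A o assms(3) by auto
    then show ?thesis using 3 unfolding uniq_opt_def by auto
  qed
qed

section \<open>Partial vertex covers of a piece of the graph\<close>

locale adj_rel =
  fixes adj :: "nat \<Rightarrow> nat \<Rightarrow> bool"
  assumes adj_sym: "adj u v \<Longrightarrow> adj v u" and adj_irrefl: "\<not> adj u u"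
begin

text \<open>The covers of \<open>U - S\<close>, where \<open>Q\<close> are the vertices outside of \<open>U\<close> that are neither deleted
  nor in the cover.\<close>

definition covers :: "nat set \<Rightarrow> nat set \<Rightarrow> nat set \<Rightarrow> nat set set" where
  "covers U S Q = {D. D \<subseteq> U - S \<and> (\<forall>a\<in>U - S. \<forall>b\<in>U - S. adj a b \<longrightarrow> a \<in> D \<or> b \<in> D) \<and>
     (\<forall>a\<in>U - S. \<forall>x\<in>Q. adj a x \<longrightarrow> a \<in> D)}"

definition nbhd :: "nat set \<Rightarrow> nat set" where
  "nbhd U = {x. x \<notin> U \<and> (\<exists>u\<in>U. adj x u)}"

lemma covers_nonempty: "covers U S Q \<noteq> {}"
  unfolding covers_def by (auto intro!: exI[of _ "U - S"])

lemma covers_subset: "D \<in> covers U S Q \<Longrightarrow> D \<subseteq> U"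
  unfolding covers_def by auto

text \<open>A vertex of \<open>Q\<close> without neighbour in \<open>U\<close> imposes nothing. So a
  piece can store its profile over its own neighbourhood and still answer queries about uncovered
  sets in a larger bag.\<close>

lemma covers_restrict:
  assumes "nbhd U \<subseteq> Y" "Q \<inter> U = {}"
  shows "covers U S (Q \<inter> Y) = covers U S Q"
proof -
  have "x \<in> Y" if "a \<in> U" "x \<in> Q" "adj a x" for a x
    using assms that adj_sym unfolding nbhd_def by blast
  then show ?thesis unfolding covers_def by fastforce
qed

text \<open>No edge joins \<open>U1\<close> and \<open>U2\<close>, so the two parts of a cover can
  be chosen independently.\<close>

lemma covers_Un:
  assumes "U1 \<inter> U2 = {}" "nbhd U1 \<inter> U2 = {}" "S1 \<subseteq> U1" "S2 \<subseteq> U2"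
  shows "covers (U1 \<union> U2) (S1 \<union> S2) Q =
    {D1 \<union> D2 | D1 D2. D1 \<in> covers U1 S1 Q \<and> D2 \<in> covers U2 S2 Q}" (is "?L = ?R")
proof
  have d: "(U1 \<union> U2) - (S1 \<union> S2) = (U1 - S1) \<union> (U2 - S2)" using assms by blast
  have na: "\<not> adj a b \<and> \<not> adj b a" if "a \<in> U1" "b \<in> U2" for a b
    using that assms(1,2) adj_sym unfolding nbhd_def by blast
  show "?L \<subseteq> ?R"
  proof
    fix D assume D: "D \<in> ?L"
    have "D = (D \<inter> U1) \<union> (D \<inter> U2)" using D unfolding covers_def by blast
    moreover have "D \<inter> U1 \<in> covers U1 S1 Q" "D \<inter> U2 \<in> covers U2 S2 Q"
      using D unfolding covers_def d using assms(1) by blast+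
    ultimately show "D \<in> ?R" by blast
  qed
  show "?R \<subseteq> ?L"
  proof
    fix D assume "D \<in> ?R"
    then obtain D1 D2 where D: "D = D1 \<union> D2" "D1 \<in> covers U1 S1 Q" "D2 \<in> covers U2 S2 Q" by blast
    then show "D \<in> ?L" unfolding covers_def d using na by blast
  qed
qed

lemma covers_delete: "v \<notin> U \<Longrightarrow> covers (insert v U) (insert v S) Q = covers U S Q"
proof -
  assume "v \<notin> U"
  then have "insert v U - insert v S = U - S" by auto
  then show ?thesis unfolding covers_def by simp
qed

text \<open>Case distinction on whether \<open>v\<close> is in the cover. If it is not, it joins the
  uncovered vertices, which is impossible when one of its neighbours is already uncovered.\<close>

lemma covers_keep:
  assumes "v \<notin> U" "v \<notin> S"
  shows "covers (insert v U) S Q = {insert v D | D. D \<in> covers U S Q} \<union>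
    (if \<exists>x\<in>Q. adj v x then {} else covers U S (insert v Q))" (is "?L = ?R")
proof
  have d: "insert v U - S = insert v (U - S)" using assms by auto
  show "?L \<subseteq> ?R"
  proof
    fix D assume D: "D \<in> ?L"
    show "D \<in> ?R"
    proof (cases "v \<in> D")
      case True
      have "D - {v} \<in> covers U S Q" using D assms unfolding covers_def d by blast
      moreover have "D = insert v (D - {v})" using True by auto
      ultimately show ?thesis by blast
    next
      case False
      then have "D \<in> covers U S (insert v Q)" "\<not> (\<exists>x\<in>Q. adj v x)"
        using D assms adj_sym unfolding covers_def d by blast+
      then show ?thesis by auto
    qed
  qed
  show "?R \<subseteq> ?L"
  proof
    fix D assume "D \<in> ?R"
    then consider D' where "D = insert v D'" "D' \<in> covers U S Q"
      | "\<not> (\<exists>x\<in>Q. adj v x)" "D \<in> covers U S (insert v Q)" by (auto split: if_splits)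
    then show "D \<in> ?L"
    proof cases
      case 1
      then show ?thesis unfolding covers_def d by auto
    next
      case 2
      then show ?thesis unfolding covers_def d using adj_irrefl adj_sym by auto
    qed
  qed
qed

text \<open>Leaves and profiles are defined as data, so that equality of profiles is literally what
  \<open>f_eqd\<close> tests.\<close>

definition leaf :: "nat set \<Rightarrow> nat set \<Rightarrow> nat set \<Rightarrow> data" where
  "leaf U S Q = Node (Atom (int (opt (covers U S Q)))) (bool_atom (uniq_opt (covers U S Q)))"

lemma opt_covers_le: "finite U \<Longrightarrow> opt (covers U S Q) \<le> card U"
  using opt_attained[OF covers_nonempty, of U S Q] covers_subset card_mono by metis

lemma leaf_empty: "leaf {} {} Q = Node (Atom 0) (Atom 1)"
proof -
  have c: "covers {} {} Q = {{}}" unfolding covers_def by auto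
  have o: "opt {{}::nat set} = 0" by (rule opt_eqI) auto
  have "uniq_opt {{}::nat set}" unfolding uniq_opt_def o by (rule ex1I[of _ "{}"]) auto
  then show ?thesis unfolding leaf_def c by (simp add: o)
qed

lemma leaf_delete: "v \<notin> U \<Longrightarrow> leaf (insert v U) (insert v S) Q = leaf U S Q"
  unfolding leaf_def by (simp add: covers_delete)

end

section \<open>Profiles as binary trees over the subsets of a bag\<close>

fun lookup :: "data \<Rightarrow> nat list \<Rightarrow> nat set \<Rightarrow> data" where
  "lookup p [] Q = p"
| "lookup p (y # Y) Q = lookup (if y \<in> Q then right_of p else left_of p) Y Q"

fun ptree :: "nat list \<Rightarrow> nat set \<Rightarrow> (nat set \<Rightarrow> data) \<Rightarrow> data" where
  "ptree [] A f = f A"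
| "ptree (z # Z) A f = Node (ptree Z A f) (ptree Z (insert z A) f)"

text \<open>Repeated entries of \<open>Y\<close> do no harm: the same branch is taken at each of
  them. This admits tuples that are padded by repetition as bags.\<close>

lemma lookup_ptree: "lookup (ptree Y A f) Y Q = f (A \<union> (Q \<inter> set Y))"
  by (induction Y arbitrary: A) auto

lemma ptree_cong: "(\<And>B. A \<subseteq> B \<Longrightarrow> B \<subseteq> A \<union> set Z \<Longrightarrow> f B = g B) \<Longrightarrow> ptree Z A f = ptree Z A g"
proof (induction Z arbitrary: A)
  case (Cons z Z)
  have "ptree Z A f = ptree Z A g" "ptree Z (insert z A) f = ptree Z (insert z A) g"
    by (rule Cons.IH, rule Cons.prems; auto)+
  then show ?case by simp
qed simp

context adj_rel
begin

definition prof :: "nat set \<Rightarrow> nat list \<Rightarrow> nat set \<Rightarrow> data" where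
  "prof U Y S = ptree Y {} (leaf U S)"

lemma lookup_prof:
  assumes "nbhd U \<subseteq> set Y" "Q \<inter> U = {}"
  shows "lookup (prof U Y S) Y Q = leaf U S Q"
  unfolding prof_def lookup_ptree leaf_def using covers_restrict[OF assms] by simp

end


section \<open>Computing profiles\<close>

fun full :: "nat \<Rightarrow> data \<Rightarrow> bool" where
  "full 0 p = True"
| "full (Suc k) p \<longleftrightarrow> is_node p \<and> full k (left_of p) \<and> full k (right_of p)"

lemma full_ptree: "full (length Y) (ptree Y A f)"
  by (induction Y arbitrary: A) auto

fun nodes :: "data \<Rightarrow> nat" where
  "nodes (Atom a) = 1"
| "nodes (Node x y) = 1 + nodes x + nodes y"

lemma get_computes:
  assumes "length A < N" "N > 0"
  shows "full (length Y) p \<Longrightarrow>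
    computes f_get [p, el Y, el A] (lookup p Y (set A)) ((length Y + 1) * (40 * N))"
proof (induction Y arbitrary: p)
  case Nil
  then show ?case using assms by (intro okI; simp add: b_get_def ok_def)
next
  case (Cons y Y)
  have "20 * (length A + 1) \<le> 20 * N" using assms by simp
  then show ?case using Cons.prems Cons.IH[of "left_of p"] Cons.IH[of "right_of p"] mem_computes[of y A]
    by (intro okI; auto simp: b_get_def ok_def)
qed

text \<open>The two recursive calls double the bound. Subtracting 30 makes the induction close with
  30 steps to spare per call, since twice \<open>x - 30\<close> plus 30 is
  \<open>2 * x - 30\<close>.\<close>

lemma tab_computes:
  assumes "\<And>A. set A \<subseteq> set A0 \<union> set Z \<Longrightarrow> length A \<le> length A0 + length Z \<Longrightarrow>
    computes f_leaf [el A, p, y, g, x, m] (f (set A)) K"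
  shows "computes f_tab [el Z, el A0, p, y, g, x, m] (ptree Z (set A0) f) (2 ^ (length Z + 1) * (K + 30) - 30)"
  using assms
proof (induction Z arbitrary: A0)
  case Nil
  have "computes f_leaf [el A0, p, y, g, x, m] (f (set A0)) K" by (rule Nil) auto
  then show ?case by (intro okI; auto simp: b_tab_def ok_def)
next
  case (Cons z Z)
  have 1: "computes f_tab [el Z, el A0, p, y, g, x, m] (ptree Z (set A0) f) (2 ^ (length Z + 1) * (K + 30) - 30)"
    by (rule Cons.IH, rule Cons.prems) auto
  have 2: "computes f_tab [el Z, el (z # A0), p, y, g, x, m] (ptree Z (set (z # A0)) f)
      (2 ^ (length Z + 1) * (K + 30) - 30)"
    by (rule Cons.IH, rule Cons.prems) auto
  \<comment> \<open>Ensures that the subtraction of 30 is not truncated.\<close>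
  have "1 \<le> (2::nat) ^ length Z" by simp
  then have 3: "30 \<le> 2 ^ length Z * (30 + K)" using mult_le_mono[of 1 "2 ^ length Z" 30 "30 + K"] by simp
  show ?case using 1 2 3 by (intro okI; auto simp: b_tab_def ok_def algebra_simps)
qed

lemma eqd_computes: "computes f_eqd [a, b] (bool_atom (a = b)) (30 * nodes a)"
proof (induction a arbitrary: b)
  case (Atom a)
  show ?case by (cases b) (intro okI; auto simp: b_eqd_def ok_def)+
next
  case (Node l r)
  show ?case
  proof (cases b)
    case (Atom x)
    then show ?thesis by (intro okI; auto simp: b_eqd_def ok_def)
  next
    case (Node x y)
    show ?thesis unfolding Node using Node.IH(1)[of x] Node.IH(2)[of y]
      by (intro okI; auto simp: b_eqd_def ok_def)
  qed
qed

text \<open>The time bounds are powers of \<open>N\<close>; constants are absorbed because \<open>N\<close> is large.\<close>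

locale mu = adj_rel +
  fixes n N D :: nat
  assumes n_less: "n < N" and N_ge: "1000 \<le> N" and D_less: "D + 1 < N" and pow_le: "2 ^ (D + 3) < N"
begin

lemma pow_Suc: "1000 * N ^ k \<le> N ^ Suc k"
  using N_ge by simp

lemma sq: "1000 * N \<le> N\<^sup>2"
  using N_ge by (simp add: power2_eq_square)

lemma cube: "1000 * N\<^sup>2 \<le> N ^ 3"
proof -
  have "N ^ 3 = N * N\<^sup>2" by (simp add: power3_eq_cube power2_eq_square)
  then show ?thesis using N_ge by simp
qed

lemma pow_mono: "i \<le> j \<Longrightarrow> N ^ i \<le> N ^ j"
  using N_ge by (intro power_increasing) auto

lemma len_mult: "a < N \<Longrightarrow> (a + 1) * x \<le> N * (x::nat)"
  by (intro mult_right_mono) auto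

definition mat :: data where
  "mat = data_list (map (\<lambda>i. data_list (map (\<lambda>j. bool_atom (adj i j)) [0..<n])) [0..<n])"

lemma adjany_computes:
  assumes "u < n"
  shows "set A \<subseteq> {..<n} \<Longrightarrow>
    computes f_adjany [mat, Atom (int u), el A] (bool_atom (\<exists>v\<in>set A. adj u v)) ((length A + 1) * (60 * N))"
proof (induction A)
  case Nil
  then show ?case using N_ge by (intro okI; simp add: b_adjany_def ok_def)
next
  case (Cons v A)
  let ?row = "\<lambda>i. data_list (map (\<lambda>j. bool_atom (adj i j)) [0..<n])"
  have 1: "computes f_nth [mat, Atom (int u)] (?row u) (20 * (u + 1))"
    using nth_computes[of u "map ?row [0..<n]"] assms unfolding mat_def by simp
  have 2: "computes f_nth [?row u, Atom (int v)] (bool_atom (adj u v)) (20 * (v + 1))"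
    using nth_computes[of v "map (\<lambda>j. bool_atom (adj u j)) [0..<n]"] Cons.prems by simp
  have "20 * (u + 1) \<le> 20 * N" "20 * (v + 1) \<le> 20 * N" using n_less assms Cons.prems by auto
  then show ?case using 1 2 Cons N_ge by (intro okI; auto simp: b_adjany_def ok_def)
qed

definition nbl :: "nat list \<Rightarrow> nat list \<Rightarrow> nat list" where
  "nbl C A = filter (\<lambda>u. u \<notin> set C \<and> (\<exists>c\<in>set C. adj u c)) A"

lemma nbrs_computes:
  assumes "set C \<subseteq> {..<n}" "length C < N"
  shows "set A \<subseteq> {..<n} \<Longrightarrow>
    computes f_nbrs [mat, el C, el A] (el (nbl C A)) ((length A + 1) * (100 * N\<^sup>2))"
proof (induction A)
  case Nil
  then show ?case using N_ge sq by (intro okI; simp add: b_nbrs_def ok_def nbl_def)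
next
  case (Cons a A)
  have 1: "computes f_mem [Atom (int a), el C] (bool_atom (a \<in> set C)) (20 * N)"
    by (rule ok_mono[OF mem_computes]) (use assms in simp)
  have 2: "computes f_adjany [mat, Atom (int a), el C] (bool_atom (\<exists>c\<in>set C. adj a c)) (60 * N\<^sup>2)"
    by (rule ok_mono[OF adjany_computes]) (use assms Cons.prems len_mult[OF assms(2), of "60 * N"] in
        \<open>auto simp: power2_eq_square\<close>)
  show ?case using 1 2 Cons sq N_ge
    by (intro okI; auto simp: b_nbrs_def ok_def nbl_def)
qed

lemma is_node_prof: "is_node (prof U Y S)"
  unfolding prof_def by (cases Y) (auto simp: leaf_def)

lemma full_prof: "full (length Y) (prof U Y S)"
  unfolding prof_def by (rule full_ptree)

lemma get_prof_computes:
  assumes "nbhd U \<subseteq> set Y" "set A \<inter> U = {}" "length A < N" "length Y < N"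
  shows "computes f_get [prof U Y S, el Y, el A] (leaf U S (set A)) (40 * N\<^sup>2)"
proof -
  have "computes f_get [prof U Y S, el Y, el A] (leaf U S (set A)) ((length Y + 1) * (40 * N))"
    unfolding lookup_prof[OF assms(1,2), symmetric]
    by (rule get_computes[OF assms(3) _ full_prof]) (use N_ge in simp)
  then show ?thesis
    by (rule ok_mono) (use len_mult[OF assms(4), of "40 * N"] in \<open>simp add: power2_eq_square\<close>)
qed

lemma addleaf_computes:
  assumes "U1 \<inter> U2 = {}" "nbhd U1 \<inter> U2 = {}" "S1 \<subseteq> U1" "S2 \<subseteq> U2" "finite U1" "finite U2"
  shows "computes f_addleaf [leaf U1 S1 Q, leaf U2 S2 Q] (leaf (U1 \<union> U2) (S1 \<union> S2) Q) 30"
proof -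
  note o = opt_Un_disjoint[where ?F1.0 = "covers U1 S1 Q" and ?F2.0 = "covers U2 S2 Q",
      OF covers_nonempty covers_nonempty covers_subset covers_subset assms(1,5,6)]
  have "leaf (U1 \<union> U2) (S1 \<union> S2) Q = Node
     (Atom (int (opt (covers U1 S1 Q) + opt (covers U2 S2 Q))))
     (bool_atom (uniq_opt (covers U1 S1 Q) \<and> uniq_opt (covers U2 S2 Q)))"
    unfolding leaf_def covers_Un[OF assms(1-4)] by (simp only: o)
  then show ?thesis by (intro okI; simp add: b_addleaf_def ok_def leaf_def)
qed

text \<open>The two families of \<open>covers_keep\<close> are disjoint, because only the members of
  the first contain \<open>v\<close>; so \<open>opt_union\<close> applies, with
  \<open>opt_insert\<close> for the first family.\<close>

lemma minleaf_computes:
  assumes "v \<notin> U" "v \<notin> S" "finite U" "v \<notin> Q"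
  shows "computes f_minleaf [leaf U S Q, leaf U S (insert v Q), bool_atom (\<exists>x\<in>Q. adj v x)]
    (leaf (insert v U) S Q) 50"
proof -
  define F' where "F' = {insert v D | D. D \<in> covers U S Q}"
  let ?F = "covers U S Q" and ?G = "covers U S (insert v Q)"
  have i: "opt F' = opt ?F + 1" "uniq_opt F' \<longleftrightarrow> uniq_opt ?F"
    unfolding F'_def by (rule opt_insert[OF covers_nonempty covers_subset assms(1,3)]; assumption)+
  have ne: "F' \<noteq> {}" unfolding F'_def using covers_nonempty by auto
  have dj: "F' \<inter> ?G = {}" unfolding F'_def using covers_subset assms(1) by blast
  note u = opt_union[OF ne covers_nonempty dj, unfolded i(1) i(2)]
  note k = covers_keep[OF assms(1,2), of Q, folded F'_def]
  show ?thesis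
  proof (cases "\<exists>x\<in>Q. adj v x")
    case True
    then have "leaf (insert v U) S Q = Node (Atom (int (opt ?F) + 1)) (bool_atom (uniq_opt ?F))"
      unfolding leaf_def k using i by simp
    then show ?thesis using True by (intro okI; simp add: b_minleaf_def ok_def leaf_def)
  next
    case False
    then have "leaf (insert v U) S Q = Node (Atom (int (min (opt ?F + 1) (opt ?G))))
       (bool_atom (if opt ?F + 1 < opt ?G then uniq_opt ?F else if opt ?G < opt ?F + 1 then uniq_opt ?G else False))"
      unfolding leaf_def k using u by simp
    then show ?thesis using False by (intro okI; auto simp: b_minleaf_def ok_def leaf_def)
  qed
qed

lemma leaf_add_computes:
  assumes "U1 \<inter> U2 = {}" "nbhd U1 \<inter> U2 = {}" "S1 \<subseteq> U1" "S2 \<subseteq> U2" "finite U1" "finite U2"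
    and "nbhd U1 \<subseteq> set Y" "nbhd U2 \<subseteq> set X" "set A \<inter> (U1 \<union> U2) = {}"
    and "length A < N" "length Y < N" "length X < N"
  shows "computes f_leaf [el A, prof U1 Y S1, el Y, prof U2 X S2, el X, m]
    (leaf (U1 \<union> U2) (S1 \<union> S2) (set A)) (N ^ 3)"
proof -
  have "computes f_get [prof U1 Y S1, el Y, el A] (leaf U1 S1 (set A)) (40 * N\<^sup>2)"
    "computes f_get [prof U2 X S2, el X, el A] (leaf U2 S2 (set A)) (40 * N\<^sup>2)"
    using assms by (intro get_prof_computes; auto)+
  then show ?thesis
    using addleaf_computes[OF assms(1-6), of "set A"] cube sq N_ge is_node_prof[where U = U2 and Y = X and S = S2]
    by (intro okI; auto simp: b_leaf_def ok_def)
qed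

lemma leaf_delete_computes:
  assumes "nbhd U \<subseteq> set Y" "set A \<inter> U = {}" "length A < N" "length Y < N" "v \<notin> U"
  shows "computes f_leaf [el A, prof U Y S, el Y, Atom 1, x, m] (leaf (insert v U) (insert v S) (set A)) (N ^ 3)"
  using get_prof_computes[OF assms(1-4), where S = S] cube sq N_ge
  by (intro okI; auto simp: b_leaf_def ok_def leaf_delete[OF assms(5)])

lemma leaf_zero_computes:
  "computes f_leaf [a, p, y, Atom 2, x, m] (leaf {} {} Q) (N ^ 3)"
  using cube sq N_ge
  by (intro okI; auto simp: b_leaf_def ok_def leaf_empty)

lemma leaf_keep_computes:
  assumes "nbhd U \<subseteq> insert v (set Y)" "set A \<inter> insert v U = {}" "length A + 1 < N" "length Y + 1 < N"
    and "v \<notin> U" "v \<notin> S" "finite U" "v < n" "set A \<subseteq> {..<n}"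
  shows "computes f_leaf [el A, prof U (v # Y) S, el (v # Y), Atom 0, x, mat] (leaf (insert v U) S (set A)) (N ^ 3)"
proof -
  have 1: "computes f_get [prof U (v # Y) S, el (v # Y), el A] (leaf U S (set A)) (40 * N\<^sup>2)"
    "computes f_get [prof U (v # Y) S, el (v # Y), el (v # A)] (leaf U S (set (v # A))) (40 * N\<^sup>2)"
    by (rule get_prof_computes; use assms in auto)+
  have 2: "computes f_adjany [mat, Atom (int v), el A] (bool_atom (\<exists>x\<in>set A. adj v x)) (60 * N\<^sup>2)"
    by (rule ok_mono[OF adjany_computes]) (use assms len_mult[of "length A" "60 * N"] in
        \<open>auto simp: power2_eq_square\<close>)
  have "v \<notin> set A" using assms by auto
  note 3 = minleaf_computes[OF assms(5-7) this]
  show ?thesis using 1 2 3 cube sq N_ge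
    by (intro okI; auto simp: b_leaf_def ok_def)
qed

end

section \<open>Lists of profiles\<close>

lemma app_computes: "computes f_app [el A, el B] (el (A @ B)) (20 * (length A + 1))"
  by (induction A) (rule okI; simp add: b_app_def ok_def)+

definition enc_item :: "(nat list \<Rightarrow> data) \<Rightarrow> nat list \<Rightarrow> data" where
  "enc_item h S = Node (Node (Atom (int (length S))) (h S)) (el S)"

abbreviation enc_items :: "(nat list \<Rightarrow> data) \<Rightarrow> nat list list \<Rightarrow> data" where
  "enc_items h Ss \<equiv> data_list (map (enc_item h) Ss)"

definition ikey :: "(nat list \<Rightarrow> data) \<Rightarrow> nat list \<Rightarrow> nat \<times> data" where
  "ikey h S = (length S, h S)"

definition add_item :: "(nat list \<Rightarrow> data) \<Rightarrow> nat list \<Rightarrow> nat list list \<Rightarrow> nat list list" where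
  "add_item h S Ss = (if ikey h S \<in> ikey h ` set Ss then Ss else S # Ss)"

definition merge_in :: "(nat list \<Rightarrow> data) \<Rightarrow> nat list list \<Rightarrow> nat list \<Rightarrow> nat list list \<Rightarrow> nat list list" where
  "merge_in h Q S = fold (\<lambda>S'. add_item h (S @ S')) Q"

definition merge_items :: "(nat list \<Rightarrow> data) \<Rightarrow> nat list list \<Rightarrow> nat list list \<Rightarrow> nat list list \<Rightarrow> nat list list" where
  "merge_items h B Q = fold (merge_in h Q) B"

text \<open>The invariant that keeps lists short: with distinct keys from \<open>KS\<close> there
  are at most \<open>card KS\<close> items, however many pairs are merged.\<close>

definition keys_in :: "(nat list \<Rightarrow> data) \<Rightarrow> (nat \<times> data) set \<Rightarrow> nat list list \<Rightarrow> bool" where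
  "keys_in h KS A \<longleftrightarrow> distinct (map (ikey h) A) \<and> ikey h ` set A \<subseteq> KS"

lemma keys_in_add: "keys_in h KS A \<Longrightarrow> ikey h S \<in> KS \<Longrightarrow> keys_in h KS (add_item h S A)"
  unfolding keys_in_def add_item_def by auto

lemma keys_in_merge_in:
  "keys_in h KS A \<Longrightarrow> \<forall>S'\<in>set Q. ikey h (S @ S') \<in> KS \<Longrightarrow> keys_in h KS (merge_in h Q S A)"
  unfolding merge_in_def by (induction Q arbitrary: A) (auto intro: keys_in_add)

lemma keys_in_merge_items:
  "keys_in h KS A \<Longrightarrow> \<forall>S\<in>set B. \<forall>S'\<in>set Q. ikey h (S @ S') \<in> KS \<Longrightarrow>
     keys_in h KS (merge_items h B Q A)"
  unfolding merge_items_def by (induction B arbitrary: A) (auto intro: keys_in_merge_in)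

lemma keys_in_length: "keys_in h KS A \<Longrightarrow> finite KS \<Longrightarrow> length A \<le> card KS"
  unfolding keys_in_def by (metis card_mono distinct_card length_map set_map)

lemma merge_in_set:
  "set (merge_in h Q S A) \<subseteq> set A \<union> {S @ S' | S'. S' \<in> set Q}"
  "ikey h ` set (merge_in h Q S A) = ikey h ` set A \<union> {ikey h (S @ S') | S'. S' \<in> set Q}"
proof -
  have "set (add_item h S A) \<subseteq> insert S (set A)"
    "ikey h ` set (add_item h S A) = insert (ikey h S) (ikey h ` set A)" for S A
    unfolding add_item_def by auto
  note a = this
  show "set (merge_in h Q S A) \<subseteq> set A \<union> {S @ S' | S'. S' \<in> set Q}"
    unfolding merge_in_def
  proof (induction Q arbitrary: A)
    case (Cons S' Q)
    show ?case using Cons[of "add_item h (S @ S') A"] a(1)[of "S @ S'" A] by auto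
  qed simp
  show "ikey h ` set (merge_in h Q S A) = ikey h ` set A \<union> {ikey h (S @ S') | S'. S' \<in> set Q}"
    unfolding merge_in_def
  proof (induction Q arbitrary: A)
    case (Cons S' Q)
    show ?case using Cons[of "add_item h (S @ S') A"] a(2)[of "S @ S'" A] by auto
  qed simp
qed

text \<open>Pruning discards items but never a key. The first part yields soundness of the merged
  list, the second its completeness.\<close>

lemma merge_items_set:
  "set (merge_items h B Q A) \<subseteq> set A \<union> {S @ S' | S S'. S \<in> set B \<and> S' \<in> set Q}"
  "ikey h ` set (merge_items h B Q A) =
     ikey h ` set A \<union> {ikey h (S @ S') | S S'. S \<in> set B \<and> S' \<in> set Q}"
proof -
  show "set (merge_items h B Q A) \<subseteq> set A \<union> {S @ S' | S S'. S \<in> set B \<and> S' \<in> set Q}"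
    unfolding merge_items_def
  proof (induction B arbitrary: A)
    case (Cons S B)
    show ?case using Cons[of "merge_in h Q S A"] merge_in_set(1)[of h Q S A] by simp blast
  qed simp
  show "ikey h ` set (merge_items h B Q A) =
     ikey h ` set A \<union> {ikey h (S @ S') | S S'. S \<in> set B \<and> S' \<in> set Q}"
    unfolding merge_items_def
  proof (induction B arbitrary: A)
    case (Cons S B)
    show ?case using Cons[of "merge_in h Q S A"] merge_in_set(2)[of h Q S A] by auto
  qed simp
qed

lemma haskey_computes:
  "computes f_haskey [Node (Atom (int k)) p, enc_items h A] (bool_atom ((k, p) \<in> ikey h ` set A))
     ((length A + 1) * (30 * nodes p + 100))"
proof (induction A)
  case (Cons S A)
  then show ?case using eqd_computes[of "Node (Atom (int k)) p" "Node (Atom (int (length S))) (h S)"]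
    by (intro okI; auto simp: b_haskey_def ok_def enc_item_def ikey_def)
qed (rule okI; simp add: b_haskey_def ok_def)

context mu
begin

lemma const_pow: "c \<le> 1000 \<Longrightarrow> i < j \<Longrightarrow> c * N ^ i \<le> N ^ j"
  using pow_Suc[of i] pow_mono[of "Suc i" j] mult_right_mono[of c 1000 "N ^ i"] by linarith

lemma ins_computes:
  assumes "length A < N" "nodes (h S) < N"
  shows "computes f_ins [enc_item h S, enc_items h A] (enc_items h (add_item h S A)) (N ^ 3)"
proof -
  have "(length A + 1) * (30 * nodes (h S) + 100) \<le> N * (130 * N)"
    using assms N_ge by (intro mult_le_mono) auto
  then have "computes f_haskey [Node (Atom (int (length S))) (h S), enc_items h A]
      (bool_atom (ikey h S \<in> ikey h ` set A)) (130 * N\<^sup>2)"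
    using haskey_computes[of "length S" "h S" h A] unfolding ikey_def
    by (elim ok_mono) (simp add: power2_eq_square)
  then show ?thesis using cube sq N_ge
    by (intro okI; auto simp: b_ins_def ok_def add_item_def enc_item_def)
qed

lemma mergein_computes:
  assumes "\<And>S'. S' \<in> set Q \<Longrightarrow> computes f_tab [Z, Atom 0, p, Y, g S', X, m] (h (S @ S')) (N ^ 5)"
    and "\<And>S'. S' \<in> set Q \<Longrightarrow> ikey h (S @ S') \<in> KS" "\<And>k p. (k, p) \<in> KS \<Longrightarrow> nodes p < N"
    and "finite KS" "card KS < N" "length S < N"
  shows "keys_in h KS A \<Longrightarrow>
    computes f_mergein [Node (Node (Atom (int (length S))) p) (el S), enc_items g Q, enc_items h A, Y, X, Z, m]
     (enc_items h (merge_in h Q S A)) ((length Q + 1) * (2 * N ^ 5))"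
proof -
  have 5: "N ^ 3 * 2 \<le> N ^ 5"
    using const_pow[of 2 3 5] by simp
  show "keys_in h KS A \<Longrightarrow> computes f_mergein [Node (Node (Atom (int (length S))) p) (el S), enc_items g Q, enc_items h A, Y, X, Z, m]
     (enc_items h (merge_in h Q S A)) ((length Q + 1) * (2 * N ^ 5))" using assms(1,2)
  proof (induction Q arbitrary: A)
    case Nil
    then show ?case using 5 cube sq N_ge by (intro okI; simp add: b_mergein_def ok_def merge_in_def)
  next
    case (Cons S' Q)
    have 1: "computes f_tab [Z, Atom 0, p, Y, g S', X, m] (h (S @ S')) (N ^ 5)"
      by (rule Cons) simp
    have k: "ikey h (S @ S') \<in> KS" using Cons.prems by simp
    have "length A < N" using keys_in_length[OF Cons.prems(1)] assms(4,5) by simp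
    moreover have "nodes (h (S @ S')) < N" using k assms(3) unfolding ikey_def by blast
    ultimately have 2: "computes f_ins [enc_item h (S @ S'), enc_items h A]
        (enc_items h (add_item h (S @ S') A)) (N ^ 3)"
      by (rule ins_computes)
    have 3: "computes f_app [el S, el S'] (el (S @ S')) (20 * N)"
      by (rule ok_mono[OF app_computes]) (use assms(6) in simp)
    have 4: "computes f_mergein [Node (Node (Atom (int (length S))) p) (el S), enc_items g Q,
        enc_items h (add_item h (S @ S') A), Y, X, Z, m]
       (enc_items h (merge_in h Q S (add_item h (S @ S') A))) ((length Q + 1) * (2 * N ^ 5))"
      by (rule Cons.IH) (use Cons.prems keys_in_add[OF Cons.prems(1) k] in auto)
    show ?case using 1 2 3 4 5 cube sq N_ge unfolding enc_item_def
      by (intro okI; auto simp: b_mergein_def ok_def merge_in_def)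
  qed
qed

text \<open>There are fewer than \<open>N\<close> items on either side, and each pair costs one
  table and one insertion into a list that stays shorter than \<open>N\<close> by
  \<open>keys_in\<close>.\<close>

lemma merge_computes:
  assumes "\<And>S S'. S \<in> set B \<Longrightarrow> S' \<in> set Q \<Longrightarrow>
      computes f_tab [Z, Atom 0, f S, Y, g S', X, m] (h (S @ S')) (N ^ 5)"
    and "\<And>S S'. S \<in> set B \<Longrightarrow> S' \<in> set Q \<Longrightarrow> ikey h (S @ S') \<in> KS"
    and "\<And>k p. (k, p) \<in> KS \<Longrightarrow> nodes p < N"
    and "finite KS" "card KS < N" "\<And>S. S \<in> set B \<Longrightarrow> length S < N" "length Q < N" "length B < N"
  shows "computes f_merge [enc_items f B, enc_items g Q, Atom 0, Y, X, Z, m]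
     (enc_items h (merge_items h B Q [])) (N ^ 8)"
proof -
  have "keys_in h KS A \<Longrightarrow> computes f_merge [enc_items f B, enc_items g Q, enc_items h A, Y, X, Z, m]
     (enc_items h (merge_items h B Q A)) ((length B + 1) * (3 * N ^ 6))" for A
    using assms(1,2,6)
  proof (induction B arbitrary: A)
    case Nil
    have "N \<le> N ^ 6" using pow_mono[of 1 6] by simp
    then show ?case using N_ge by (intro okI; simp add: b_merge_def ok_def merge_items_def)
  next
    case (Cons S B)
    have "computes f_mergein [Node (Node (Atom (int (length S))) (f S)) (el S), enc_items g Q, enc_items h A, Y, X, Z, m]
       (enc_items h (merge_in h Q S A)) ((length Q + 1) * (2 * N ^ 5))"
      by (rule mergein_computes[where KS = KS]) (use Cons.prems assms(3-5) in auto)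
    then have 1: "computes f_mergein [enc_item f S, enc_items g Q, enc_items h A, Y, X, Z, m]
       (enc_items h (merge_in h Q S A)) (2 * N ^ 6)"
      unfolding enc_item_def using len_mult[OF assms(7), of "2 * N ^ 5"] power_Suc[of N 5]
      by (elim ok_mono) simp
    have "keys_in h KS (merge_in h Q S A)"
      by (rule keys_in_merge_in) (use Cons.prems in auto)
    then have 2: "computes f_merge [enc_items f B, enc_items g Q, enc_items h (merge_in h Q S A), Y, X, Z, m]
     (enc_items h (merge_items h B Q (merge_in h Q S A))) ((length B + 1) * (3 * N ^ 6))"
      by (rule Cons.IH) (use Cons.prems in auto)
    have "N \<le> N ^ 6" using pow_mono[of 1 6] by simp
    then show ?case using 1 2 N_ge
      by (intro okI; auto simp: b_merge_def ok_def merge_items_def)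
  qed
  from this[of "[]"] show ?thesis
    using len_mult[OF assms(8), of "3 * N ^ 6"] power_Suc[of N 6] pow_Suc[of 7]
    unfolding keys_in_def by (auto elim!: ok_mono)
qed

end

section \<open>Counting profiles\<close>

fun trees :: "nat \<Rightarrow> nat \<Rightarrow> data set" where
  "trees n 0 = (\<lambda>(a, b). Node (Atom (int a)) (bool_atom b)) ` ({..n} \<times> UNIV)"
| "trees n (Suc k) = (\<lambda>(l, r). Node l r) ` (trees n k \<times> trees n k)"

lemma finite_trees: "finite (trees n k)"
  by (induction k) auto

text \<open>A tree of depth \<open>k\<close> has \<open>2 ^ k\<close> leaves, each holding one of
  \<open>n + 1\<close> optima and a bit. This is the origin of the exponent in the running
  time.\<close>

lemma card_trees: "card (trees n k) \<le> (2 * (n + 1)) ^ (2 ^ k)"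
proof (induction k)
  case 0
  have "card (trees n 0) \<le> card ({..n} \<times> (UNIV::bool set))"
    unfolding trees.simps by (rule card_image_le) simp
  then show ?case by (simp add: card_cartesian_product)
next
  case (Suc k)
  have "card (trees n (Suc k)) \<le> card (trees n k) * card (trees n k)"
    using card_image_le[of "trees n k \<times> trees n k"] by (simp add: card_cartesian_product finite_trees)
  also have "\<dots> \<le> (2 * (n + 1)) ^ (2 ^ k) * (2 * (n + 1)) ^ (2 ^ k)" using Suc by (intro mult_mono) auto
  finally show ?case by (simp add: power_add[symmetric] mult_2)
qed

lemma (in adj_rel) prof_in_trees: "finite U \<Longrightarrow> card U \<le> n \<Longrightarrow> prof U Y S \<in> trees n (length Y)"
proof -
  assume U: "finite U" "card U \<le> n"
  have "leaf U S Q \<in> trees n 0" for Q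
    unfolding leaf_def using order_trans[OF opt_covers_le[OF U(1)] U(2)]
    by (auto intro!: image_eqI[of _ _ "(opt (covers U S Q), uniq_opt (covers U S Q))"])
  then have "ptree Y A (leaf U S) \<in> trees n (length Y)" for A
    by (induction Y arbitrary: A) auto
  then show ?thesis unfolding prof_def .
qed

lemma ok_unique: "ok P i vs v b \<Longrightarrow> ok P i vs v' b' \<Longrightarrow> v = v'"
  by (auto simp: ok_def)

section \<open>Representative families of deleted sets\<close>

locale mu_items = mu +
  assumes keys_less: "(n + 1) * (2 * (n + 1)) ^ (2 ^ (D + 1)) < N"
begin

definition iprof :: "nat set \<Rightarrow> nat list \<Rightarrow> nat list \<Rightarrow> data" where
  "iprof U Y S = prof U Y (set S)"

text \<open>The rest of the graph sees of a deleted set only its profile, and the budget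
  \<open>k\<close> sees only its size; so agreement in these two is all that a representative has to
  offer. Distinct keys bound the length of the list.\<close>

definition rep :: "nat set \<Rightarrow> nat list \<Rightarrow> nat list list \<Rightarrow> bool" where
  "rep U Y Ss \<longleftrightarrow> (\<forall>S\<in>set Ss. distinct S \<and> set S \<subseteq> U) \<and> distinct (map (ikey (iprof U Y)) Ss) \<and>
     (\<forall>S. S \<subseteq> U \<longrightarrow> (\<exists>S'\<in>set Ss. length S' = card S \<and> prof U Y (set S') = prof U Y S))"

definition KS :: "nat list \<Rightarrow> (nat \<times> data) set" where
  "KS Y = {..n} \<times> trees n (length Y)"

lemma finite_KS: "finite (KS Y)"
  unfolding KS_def using finite_trees by simp

text \<open>The depth is \<open>D + 1\<close> instead of \<open>D\<close> because the union of
  pieces around a vertex is tabulated over the whole tuple, which has \<open>w + 1\<close>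
  entries.\<close>

lemma card_KS: "length Y \<le> D + 1 \<Longrightarrow> card (KS Y) < N"
proof -
  assume "length Y \<le> D + 1"
  then have "(2 * (n + 1)) ^ (2 ^ length Y) \<le> (2 * (n + 1)) ^ (2 ^ (D + 1))"
    by (intro power_increasing) auto
  then have "card (trees n (length Y)) \<le> (2 * (n + 1)) ^ (2 ^ (D + 1))"
    using card_trees order_trans by blast
  then have "card (KS Y) \<le> (n + 1) * (2 * (n + 1)) ^ (2 ^ (D + 1))"
    unfolding KS_def card_cartesian_product by (intro mult_mono) auto
  then show ?thesis using keys_less by simp
qed

lemma nodes_KS: "length Y \<le> D + 1 \<Longrightarrow> (k, p) \<in> KS Y \<Longrightarrow> nodes p < N"
proof -
  assume l: "length Y \<le> D + 1" and p: "(k, p) \<in> KS Y"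
  \<comment> \<open>A leaf of a profile is itself a \<open>Node\<close> of two atoms and has 3
    nodes, whence the exponent \<open>j + 2\<close>.\<close>
  have "p \<in> trees n j \<Longrightarrow> nodes p + 1 = 2 ^ (j + 2)" for p j
    by (induction j arbitrary: p) auto
  then have "nodes p + 1 = 2 ^ (length Y + 2)" using p unfolding KS_def by auto
  also have "\<dots> \<le> 2 ^ (D + 3)" using l by (intro power_increasing) auto
  finally show ?thesis using pow_le by simp
qed

lemma card_lessThan_n: "U \<subseteq> {..<n} \<Longrightarrow> finite U \<and> card U \<le> n"
  using card_mono[of "{..<n}" U] finite_subset[of U "{..<n}"] by simp

lemma ikey_in_KS: "U \<subseteq> {..<n} \<Longrightarrow> distinct S \<Longrightarrow> set S \<subseteq> {..<n} \<Longrightarrow> ikey (iprof U Y) S \<in> KS Y"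
  unfolding ikey_def KS_def iprof_def
  using prof_in_trees[of U n Y "set S"] card_lessThan_n[of U] card_lessThan_n[of "set S"] distinct_card[of S]
  by auto

lemma rep_length:
  assumes "rep U Y Ss" "U \<subseteq> {..<n}" "length Y \<le> D + 1"
  shows "length Ss < N"
proof -
  have "keys_in (iprof U Y) (KS Y) Ss"
    using assms ikey_in_KS[OF assms(2)] unfolding keys_in_def rep_def by auto
  then show ?thesis using keys_in_length[OF _ finite_KS] card_KS[OF assms(3)] by fastforce
qed

lemma rep_item_length:
  assumes "rep U Y Ss" "U \<subseteq> {..<n}" "S \<in> set Ss"
  shows "length S < N"
  using assms card_lessThan_n[of "set S"] distinct_card[of S] n_less unfolding rep_def by fastforce

lemma tab_bound: "length Z \<le> D + 1 \<Longrightarrow> 2 ^ (length Z + 1) * (N ^ 3 + 30) - 30 \<le> N ^ 5"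
proof -
  assume "length Z \<le> D + 1"
  then have "(2::nat) ^ (length Z + 1) \<le> 2 ^ (D + 3)" by (intro power_increasing) auto
  then have "2 ^ (length Z + 1) \<le> N" using pow_le by simp
  then have "2 ^ (length Z + 1) * (N ^ 3 + 30) \<le> N * (2 * N ^ 3)"
    using cube sq N_ge by (intro mult_le_mono) auto
  also have "\<dots> = 2 * N ^ 4" using power_Suc[of N 3] by simp
  also have "\<dots> \<le> N ^ 5" by (rule const_pow) auto
  finally show ?thesis by simp
qed

text \<open>By \<open>addleaf_computes\<close> the leaf of the union is the output of a program run
  on the leaves of the parts. Equal inputs give equal outputs, so the exchange argument follows from
  determinism of evaluation.\<close>

lemma leaf_Un_cong:
  assumes "U1 \<inter> U2 = {}" "nbhd U1 \<inter> U2 = {}" "finite U1" "finite U2"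
    and "S1 \<subseteq> U1" "S2 \<subseteq> U2" "T1 \<subseteq> U1" "T2 \<subseteq> U2"
    and "leaf U1 S1 Q = leaf U1 T1 Q" "leaf U2 S2 Q = leaf U2 T2 Q"
  shows "leaf (U1 \<union> U2) (S1 \<union> S2) Q = leaf (U1 \<union> U2) (T1 \<union> T2) Q"
  using addleaf_computes[of U1 U2 S1 S2 Q] addleaf_computes[of U1 U2 T1 T2 Q] assms ok_unique by metis

lemma leaf_insert_cong:
  assumes "v \<notin> U" "v \<notin> S" "v \<notin> S'" "finite U" "v \<notin> Q"
    and "leaf U S Q = leaf U S' Q" "leaf U S (insert v Q) = leaf U S' (insert v Q)"
  shows "leaf (insert v U) S Q = leaf (insert v U) S' Q"
  using minleaf_computes[of v U S Q] minleaf_computes[of v U S' Q] assms ok_unique by metis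

lemma leaf_eqI_prof:
  assumes "prof U Y S = prof U Y S'" "nbhd U \<subseteq> set Y" "Q \<inter> U = {}"
  shows "leaf U S Q = leaf U S' Q"
  using lookup_prof[OF assms(2,3)] assms(1) by metis

lemma prof_cong:
  "(\<And>Q. Q \<subseteq> set Y \<Longrightarrow> leaf U S Q = leaf U S' Q) \<Longrightarrow> prof U Y S = prof U Y S'"
  unfolding prof_def by (rule ptree_cong) auto

definition merge_rep :: "nat set \<Rightarrow> nat list \<Rightarrow> nat list list \<Rightarrow> nat list list \<Rightarrow> nat list list" where
  "merge_rep U Y A B = merge_items (iprof U Y) A B []"

text \<open>Exchange argument: a set \<open>S\<close> splits into \<open>S \<inter> U1\<close> and
  \<open>S \<inter> U2\<close>, each half is replaced by its representative, and the concatenation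
  has the size and the profile of \<open>S\<close>.\<close>

lemma merge_union:
  assumes r1: "rep U1 Y A" and r2: "rep U2 X B"
    and dj: "U1 \<inter> U2 = {}" "nbhd U1 \<inter> U2 = {}" "set Y \<inter> (U1 \<union> U2) = {}"
    and nb: "nbhd U1 \<subseteq> set Y" "nbhd U2 \<subseteq> set X"
    and le: "U1 \<subseteq> {..<n}" "U2 \<subseteq> {..<n}" "length Y \<le> D + 1" "length X \<le> D + 1"
  shows "computes f_merge [enc_items (iprof U1 Y) A, enc_items (iprof U2 X) B, Atom 0, el Y, el X, el Y, m]
      (enc_items (iprof (U1 \<union> U2) Y) (merge_rep (U1 \<union> U2) Y A B)) (N ^ 8)"
    and "rep (U1 \<union> U2) Y (merge_rep (U1 \<union> U2) Y A B)"
proof -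
  let ?U = "U1 \<union> U2" and ?h = "iprof (U1 \<union> U2) Y"
  have fin: "finite U1" "finite U2" using le card_lessThan_n by auto
  have S: "distinct S" "set S \<subseteq> U1" if "S \<in> set A" for S using r1 that unfolding rep_def by auto
  have S': "distinct S" "set S \<subseteq> U2" if "S \<in> set B" for S using r2 that unfolding rep_def by auto
  have app: "distinct (S @ S')" "set (S @ S') \<subseteq> ?U" if "S \<in> set A" "S' \<in> set B" for S S'
    using S[OF that(1)] S'[OF that(2)] dj(1) by auto
  have key: "ikey ?h (S @ S') \<in> KS Y" if "S \<in> set A" "S' \<in> set B" for S S'
    by (rule ikey_in_KS) (use app[OF that] le in auto)
  have tab: "computes f_tab [el Y, Atom 0, iprof U1 Y S, el Y, iprof U2 X S', el X, m] (?h (S @ S')) (N ^ 5)"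
    if "S \<in> set A" "S' \<in> set B" for S S'
  proof -
    have "computes f_tab [el Y, el [], prof U1 Y (set S), el Y, prof U2 X (set S'), el X, m]
        (ptree Y (set []) (leaf ?U (set S \<union> set S'))) (2 ^ (length Y + 1) * (N ^ 3 + 30) - 30)"
      by (rule tab_computes, rule leaf_add_computes)
        (use dj nb fin le S[OF that(1)] S'[OF that(2)] D_less in auto)
    then show ?thesis unfolding iprof_def prof_def
      by (intro ok_mono[OF _ tab_bound[OF le(3)]]) (simp add: prof_def)
  qed
  show "computes f_merge [enc_items (iprof U1 Y) A, enc_items (iprof U2 X) B, Atom 0, el Y, el X, el Y, m]
      (enc_items ?h (merge_rep ?U Y A B)) (N ^ 8)"
    unfolding merge_rep_def
    by (rule merge_computes[OF tab key nodes_KS[OF le(3)] finite_KS card_KS[OF le(3)]])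
      (use rep_length[OF r1 le(1,3)] rep_length[OF r2 le(2,4)] rep_item_length[OF r1 le(1)] in auto)
  note ms = merge_items_set[of ?h A B "[]", folded merge_rep_def]
  have "keys_in ?h (KS Y) (merge_rep ?U Y A B)"
    unfolding merge_rep_def by (rule keys_in_merge_items) (use key in \<open>auto simp: keys_in_def\<close>)
  then have 1: "distinct (map (ikey ?h) (merge_rep ?U Y A B))" unfolding keys_in_def by simp
  have 2: "\<forall>S\<in>set (merge_rep ?U Y A B). distinct S \<and> set S \<subseteq> ?U"
  proof
    fix S assume "S \<in> set (merge_rep ?U Y A B)"
    from subsetD[OF ms(1) this] obtain S1 S2 where "S = S1 @ S2" "S1 \<in> set A" "S2 \<in> set B" by auto
    then show "distinct S \<and> set S \<subseteq> ?U" using app by metis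
  qed
  have 3: "\<exists>S'\<in>set (merge_rep ?U Y A B). length S' = card S \<and> prof ?U Y (set S') = prof ?U Y S"
    if "S \<subseteq> ?U" for S
  proof -
    obtain S1 where S1: "S1 \<in> set A" "length S1 = card (S \<inter> U1)" "prof U1 Y (set S1) = prof U1 Y (S \<inter> U1)"
      using r1 unfolding rep_def by (metis inf_le2)
    obtain S2 where S2: "S2 \<in> set B" "length S2 = card (S \<inter> U2)" "prof U2 X (set S2) = prof U2 X (S \<inter> U2)"
      using r2 unfolding rep_def by (metis inf_le2)
    have Seq: "S = (S \<inter> U1) \<union> (S \<inter> U2)" using that by auto
    have "card ((S \<inter> U1) \<union> (S \<inter> U2)) = card (S \<inter> U1) + card (S \<inter> U2)"
      by (rule card_Un_disjoint) (use fin dj in auto)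
    then have cd: "card S = card (S \<inter> U1) + card (S \<inter> U2)" using Seq by simp
    have "prof ?U Y (set S1 \<union> set S2) = prof ?U Y ((S \<inter> U1) \<union> (S \<inter> U2))"
    proof (rule prof_cong, rule leaf_Un_cong)
      fix Q assume Q: "Q \<subseteq> set Y"
      show "leaf U1 (set S1) Q = leaf U1 (S \<inter> U1) Q"
        by (rule leaf_eqI_prof[OF S1(3) nb(1)]) (use Q dj in auto)
      show "leaf U2 (set S2) Q = leaf U2 (S \<inter> U2) Q"
        by (rule leaf_eqI_prof[OF S2(3) nb(2)]) (use Q dj in auto)
    qed (use dj fin S S' S1 S2 in auto)
    then have "ikey ?h (S1 @ S2) = (card S, prof ?U Y S)"
      using S1 S2 cd Seq unfolding ikey_def iprof_def by simp
    moreover have "ikey ?h (S1 @ S2) \<in> ikey ?h ` set (merge_rep ?U Y A B)"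
      using ms(2) S1 S2 by auto
    ultimately have "(card S, prof ?U Y S) \<in> ikey ?h ` set (merge_rep ?U Y A B)" by simp
    then show ?thesis unfolding ikey_def iprof_def by auto
  qed
  show "rep ?U Y (merge_rep ?U Y A B)" unfolding rep_def using 1 2 3 by blast
qed

text \<open>Adding \<open>v\<close> to the piece is phrased as a merge with two artificial items:
  \<open>[v]\<close> deletes \<open>v\<close> and \<open>[]\<close> keeps it. Their profiles are the
  atoms by which \<open>f_leaf\<close> selects the operation. At the same time the bag changes from
  \<open>v # Y\<close> to \<open>X\<close>.\<close>

lemma merge_forget:
  assumes r: "rep U (v # Y) A"
    and dj: "v \<notin> U" "set X \<inter> insert v U = {}" "nbhd U \<subseteq> insert v (set Y)"
    and le: "U \<subseteq> {..<n}" "v < n" "set X \<subseteq> {..<n}" "length Y \<le> D" "length X \<le> D + 1"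
  defines "g \<equiv> \<lambda>S. if S = [] then Atom 0 else Atom 1"
  shows "computes f_merge [enc_items (iprof U (v # Y)) A, enc_items g [[v], []], Atom 0, el (v # Y), Atom 0, el X, mat]
      (enc_items (iprof (insert v U) X) (merge_rep (insert v U) X A [[v], []])) (N ^ 8)"
    and "rep (insert v U) X (merge_rep (insert v U) X A [[v], []])"
proof -
  let ?U = "insert v U" and ?h = "iprof (insert v U) X" and ?B = "[[v], []]"
  have fin: "finite U" using le card_lessThan_n by auto
  have S: "distinct S" "set S \<subseteq> U" if "S \<in> set A" for S using r that unfolding rep_def by auto
  have app: "distinct (S @ S')" "set (S @ S') \<subseteq> ?U" if "S \<in> set A" "S' \<in> set ?B" for S S'
    using S[OF that(1)] that(2) dj(1) by auto
  have key: "ikey ?h (S @ S') \<in> KS X" if "S \<in> set A" "S' \<in> set ?B" for S S'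
    by (rule ikey_in_KS) (use app[OF that] le in auto)
  have len: "length X + 1 < N" "length Y + 1 < N"
  proof -
    \<comment> \<open>When \<open>v\<close> is kept, a query set of up to \<open>D + 1\<close>
      vertices is extended by \<open>v\<close>, so \<open>D + 2 < N\<close> is required; this comes
      from \<open>pow_le\<close>.\<close>
    have "(2::nat) * (D + 2) \<le> 2 ^ (D + 3)"
      by (induction D) (auto simp: power_add)
    then show "length X + 1 < N" "length Y + 1 < N" using pow_le le by auto
  qed
  have tab: "computes f_tab [el X, Atom 0, iprof U (v # Y) S, el (v # Y), g S', Atom 0, mat] (?h (S @ S')) (N ^ 5)"
    if "S \<in> set A" "S' \<in> set ?B" for S S'
  proof -
    have "computes f_tab [el X, el [], prof U (v # Y) (set S), el (v # Y), g S', Atom 0, mat]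
        (ptree X (set []) (leaf ?U (set (S @ S')))) (2 ^ (length X + 1) * (N ^ 3 + 30) - 30)"
    proof (rule tab_computes)
      fix Q assume "set Q \<subseteq> set [] \<union> set X" "length Q \<le> length [] + length X"
      then have Q: "set Q \<subseteq> set X" "length Q + 1 < N" using len by auto
      consider "S' = [v]" | "S' = []" using \<open>S' \<in> set ?B\<close> by auto
      then show "computes f_leaf [el Q, prof U (v # Y) (set S), el (v # Y), g S', Atom 0, mat]
          (leaf ?U (set (S @ S')) (set Q)) (N ^ 3)"
      proof cases
        case 1
        have "computes f_leaf [el Q, prof U (v # Y) (set S), el (v # Y), Atom 1, Atom 0, mat]
          (leaf (insert v U) (insert v (set S)) (set Q)) (N ^ 3)"
          by (rule leaf_delete_computes) (use Q dj len in auto)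
        then show ?thesis using 1 unfolding g_def by simp
      next
        case 2
        have "computes f_leaf [el Q, prof U (v # Y) (set S), el (v # Y), Atom 0, Atom 0, mat]
          (leaf (insert v U) (set S) (set Q)) (N ^ 3)"
          by (rule leaf_keep_computes) (use Q dj len le fin S[OF that(1)] in auto)
        then show ?thesis using 2 unfolding g_def by simp
      qed
    qed
    then show ?thesis unfolding iprof_def prof_def
      by (intro ok_mono[OF _ tab_bound[OF le(5)]]) (simp add: prof_def)
  qed
  have l: "length (v # Y) \<le> D + 1" using le by simp
  show "computes f_merge [enc_items (iprof U (v # Y)) A, enc_items g [[v], []], Atom 0, el (v # Y), Atom 0, el X, mat]
      (enc_items ?h (merge_rep ?U X A ?B)) (N ^ 8)"
    unfolding merge_rep_def
    by (rule merge_computes[OF tab key nodes_KS[OF le(5)] finite_KS card_KS[OF le(5)]])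
      (use rep_length[OF r le(1) l] rep_item_length[OF r le(1)] N_ge in auto)
  note ms = merge_items_set[of ?h A ?B "[]", folded merge_rep_def]
  have "keys_in ?h (KS X) (merge_rep ?U X A ?B)"
    unfolding merge_rep_def by (rule keys_in_merge_items) (use key in \<open>auto simp: keys_in_def\<close>)
  then have 1: "distinct (map (ikey ?h) (merge_rep ?U X A ?B))" unfolding keys_in_def by simp
  have 2: "\<forall>S\<in>set (merge_rep ?U X A ?B). distinct S \<and> set S \<subseteq> ?U"
  proof
    fix S assume "S \<in> set (merge_rep ?U X A ?B)"
    from subsetD[OF ms(1) this] obtain S1 S2 where "S = S1 @ S2" "S1 \<in> set A" "S2 \<in> set ?B" by auto
    then show "distinct S \<and> set S \<subseteq> ?U" using app by metis
  qed
  have 3: "\<exists>S'\<in>set (merge_rep ?U X A ?B). length S' = card S \<and> prof ?U X (set S') = prof ?U X S"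
    if "S \<subseteq> ?U" for S
  proof -
    obtain S1 where S1: "S1 \<in> set A" "length S1 = card (S \<inter> U)" "prof U (v # Y) (set S1) = prof U (v # Y) (S \<inter> U)"
      using r unfolding rep_def by (metis inf_le2)
    have lf: "leaf U (set S1) Q = leaf U (S \<inter> U) Q" if "Q \<inter> U = {}" for Q
      by (rule leaf_eqI_prof[OF S1(3)]) (use that dj in auto)
    have vS1: "v \<notin> set S1" using S S1 dj by auto
    have "ikey ?h (S1 @ (if v \<in> S then [v] else [])) = (card S, prof ?U X S)"
    proof (cases "v \<in> S")
      case True
      then have Seq: "S = insert v (S \<inter> U)" using that by auto
      have "card (insert v (S \<inter> U)) = card (S \<inter> U) + 1" using fin dj by simp
      then have cd: "card S = card (S \<inter> U) + 1" using Seq by simp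
      have "prof ?U X (insert v (set S1)) = prof ?U X (insert v (S \<inter> U))"
      proof (rule prof_cong)
        fix Q assume "Q \<subseteq> set X"
        then have "leaf U (set S1) Q = leaf U (S \<inter> U) Q" using lf dj by blast
        then show "leaf ?U (insert v (set S1)) Q = leaf ?U (insert v (S \<inter> U)) Q"
          using leaf_delete[OF dj(1)] by simp
      qed
      then show ?thesis using True S1 cd Seq unfolding ikey_def iprof_def by simp
    next
      case False
      then have Seq: "S \<inter> U = S" using that by auto
      have "prof ?U X (set S1) = prof ?U X S"
      proof (rule prof_cong, rule leaf_insert_cong)
        fix Q assume Q: "Q \<subseteq> set X"
        show "leaf U (set S1) Q = leaf U S Q" "leaf U (set S1) (insert v Q) = leaf U S (insert v Q)"
          using lf[of Q] lf[of "insert v Q"] Q dj unfolding Seq by auto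
        show "v \<notin> Q" using Q dj by auto
      qed (use False vS1 dj fin in auto)
      then show ?thesis using False S1 Seq unfolding ikey_def iprof_def by simp
    qed
    moreover have "ikey ?h (S1 @ (if v \<in> S then [v] else [])) \<in> ikey ?h ` set (merge_rep ?U X A ?B)"
    proof -
      have "(if v \<in> S then [v] else []) \<in> set ?B" by simp
      then show ?thesis unfolding ms(2) using S1(1) by blast
    qed
    ultimately have "(card S, prof ?U X S) \<in> ikey ?h ` set (merge_rep ?U X A ?B)" by simp
    then show ?thesis unfolding ikey_def iprof_def by auto
  qed
  show "rep ?U X (merge_rep ?U X A ?B)" unfolding rep_def using 1 2 3 by blast
qed

end

section \<open>Connected pieces\<close>

context adj_rel
begin

text \<open>Connectivity in terms of cuts, because every use needs an edge that leaves some subset.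
  The empty set counts as connected.\<close>

definition conn :: "nat set \<Rightarrow> bool" where
  "conn C \<longleftrightarrow> (\<forall>A. A \<subseteq> C \<longrightarrow> A \<noteq> {} \<longrightarrow> A \<noteq> C \<longrightarrow> (\<exists>a\<in>A. \<exists>b\<in>C - A. adj a b))"

lemma connD: "conn C \<Longrightarrow> A \<subseteq> C \<Longrightarrow> A \<noteq> {} \<Longrightarrow> A \<noteq> C \<Longrightarrow> \<exists>a\<in>A. \<exists>b\<in>C - A. adj a b"
  unfolding conn_def by blast

lemma conn_singleton: "conn {v}"
  unfolding conn_def by auto

lemma conn_Un:
  assumes "conn A" "conn B" "a \<in> A" "b \<in> B" "adj a b"
  shows "conn (A \<union> B)"
  unfolding conn_def
proof (intro allI impI)
  fix Z assume Z: "Z \<subseteq> A \<union> B" "Z \<noteq> {}" "Z \<noteq> A \<union> B"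
  show "\<exists>a\<in>Z. \<exists>b\<in>A \<union> B - Z. adj a b"
  proof (rule ccontr)
    assume no: "\<not> ?thesis"
    have 1: "Z \<inter> A = {} \<or> Z \<inter> A = A"
      using connD[OF assms(1), of "Z \<inter> A"] no by blast
    have 2: "Z \<inter> B = {} \<or> Z \<inter> B = B"
      using connD[OF assms(2), of "Z \<inter> B"] no by blast
    have "a \<in> Z \<longleftrightarrow> b \<in> Z" using no assms(3-5) adj_sym by blast
    then show False using 1 2 Z assms(3,4) by blast
  qed
qed

lemma component_exists:
  assumes "u \<in> W"
  obtains K where "K \<subseteq> W" "u \<in> K" "conn K" "nbhd K \<inter> W = {}"
proof -
  define R where "R = {(a, b). a \<in> W \<and> b \<in> W \<and> adj a b}"
  define K where "K = {x. (u, x) \<in> R\<^sup>*}"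
  have closed: "K \<subseteq> Z" if "u \<in> Z" "\<And>a b. a \<in> Z \<Longrightarrow> a \<in> K \<Longrightarrow> b \<in> K \<Longrightarrow> adj a b \<Longrightarrow> b \<in> Z" for Z
  proof
    fix x assume "x \<in> K"
    then have "(u, x) \<in> R\<^sup>*" unfolding K_def by simp
    then show "x \<in> Z"
    proof (induction)
      case (step y z)
      then show ?case using that(2)[of y z] rtrancl_into_rtrancl[of u y R z] unfolding K_def R_def by auto
    qed (rule that)
  qed
  have KW: "K \<subseteq> W"
  proof
    fix x assume "x \<in> K"
    then have "(u, x) \<in> R\<^sup>*" unfolding K_def by simp
    then show "x \<in> W" by induction (use assms in \<open>auto simp: R_def\<close>)
  qed
  have u: "u \<in> K" unfolding K_def by simp
  have "conn K" unfolding conn_def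
  proof (intro allI impI, rule ccontr)
    fix A assume A: "A \<subseteq> K" "A \<noteq> {}" "A \<noteq> K" and no: "\<not> (\<exists>a\<in>A. \<exists>b\<in>K - A. adj a b)"
    show False
    proof (cases "u \<in> A")
      case True
      then have "K \<subseteq> A" using no by (intro closed) auto
      then show False using A by auto
    next
      case False
      then have "K \<subseteq> - A" using no adj_sym by (intro closed) auto
      then show False using A by auto
    qed
  qed
  moreover have "nbhd K \<inter> W = {}"
  proof -
    have False if "x \<notin> K" "y \<in> K" "adj x y" "x \<in> W" for x y
    proof -
      have "(y, x) \<in> R" using that KW adj_sym unfolding R_def by auto
      then have "x \<in> K" using that(2) unfolding K_def by auto
      then show False using that by simp
    qed
    then show ?thesis unfolding nbhd_def by auto
  qed
  ultimately show ?thesis using that KW u by blast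
qed

text \<open>For \<open>Y = []\<close> the first condition is void and the fitting pieces are those
  without neighbours. So the function that unites pieces around a vertex also assembles the whole
  graph at the end.\<close>

definition fits :: "nat list \<Rightarrow> nat set \<Rightarrow> nat set \<Rightarrow> bool" where
  "fits Y U C \<longleftrightarrow> (Y \<noteq> [] \<longrightarrow> hd Y \<in> nbhd C) \<and> nbhd C \<subseteq> set Y \<and> C \<inter> set Y = {} \<and> C \<inter> U = {}"

fun gather :: "(nat list \<times> 'b) list \<Rightarrow> nat list \<Rightarrow> nat list \<Rightarrow> nat list" where
  "gather [] Y U = U"
| "gather (e # T) Y U = (if fits Y (set U) (set (fst e)) then gather T Y (fst e @ U) else gather T Y U)"

abbreviation csets :: "(nat list \<times> 'b) list \<Rightarrow> nat set set" where
  "csets T \<equiv> (\<lambda>e. set (fst e)) ` set T"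

lemma nbhd_Un: "nbhd (A \<union> B) \<subseteq> nbhd A \<union> nbhd B"
  unfolding nbhd_def by auto

lemma gather_mono: "set U \<subseteq> set (gather T Y U)"
  by (induction T arbitrary: U) fastforce+

text \<open>A fitting piece contains a neighbour of \<open>v\<close> outside of \<open>Y\<close>,
  which must lie in \<open>C\<close>. To leave \<open>C\<close>, the connected piece would have to
  enter the neighbourhood of \<open>C\<close> and hence \<open>Y\<close>, which it avoids.\<close>

lemma gather_subset:
  assumes "v \<in> C" "nbhd C \<subseteq> set Y" "hd Y = v" "Y \<noteq> []"
  shows "\<forall>e\<in>set T. conn (set (fst e)) \<Longrightarrow> set U \<subseteq> C \<Longrightarrow> set (gather T Y U) \<subseteq> C"
proof (induction T arbitrary: U)
  case (Cons e T)
  have "set (fst e) \<subseteq> C" if f: "fits Y (set U) (set (fst e))"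
  proof (rule ccontr)
    assume n: "\<not> set (fst e) \<subseteq> C"
    obtain c where c: "c \<in> set (fst e)" "adj v c" "c \<notin> set Y"
      using f assms(3,4) unfolding fits_def nbhd_def by auto
    then have "c \<in> C" using assms(1,2) adj_sym unfolding nbhd_def by blast
    then obtain a b where "a \<in> C" "b \<in> set (fst e) - C" "adj a b"
      using connD[of "set (fst e)" "set (fst e) \<inter> C"] Cons.prems(1) c n by auto
    then have "b \<in> set Y" using assms(2) adj_sym unfolding nbhd_def by blast
    then show False using f \<open>b \<in> set (fst e) - C\<close> unfolding fits_def by auto
  qed
  then show ?case using Cons.IH[of U] Cons.IH[of "fst e @ U"] Cons.prems by auto
qed simp

text \<open>The only danger is that \<open>K\<close> is rejected because it meets the vertices
  \<open>U\<close> gathered so far. Then \<open>K\<close> is already contained in \<open>U\<close>: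
  an edge from \<open>U\<close> to the rest of \<open>K\<close> would end in
  \<open>nbhd (set U)\<close>, hence in \<open>Y\<close>, which is disjoint from
  \<open>K\<close>.\<close>

lemma gather_complete:
  assumes "conn K" "nbhd K \<subseteq> set Y" "Y \<noteq> [] \<longrightarrow> hd Y \<in> nbhd K" "K \<inter> set Y = {}" "K \<noteq> {}"
  shows "K \<in> csets T \<Longrightarrow> nbhd (set U) \<subseteq> set Y \<Longrightarrow> K \<subseteq> set (gather T Y U)"
proof (induction T arbitrary: U)
  case (Cons e T)
  have n: "nbhd (set (fst e @ U)) \<subseteq> set Y" if "fits Y (set U) (set (fst e))"
    using that nbhd_Un[of "set (fst e)" "set U"] Cons.prems unfolding fits_def by auto
  show ?case
  proof (cases "set (fst e) = K")
    case True
    show ?thesis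
    proof (cases "K \<inter> set U = {}")
      case True
      then have "fits Y (set U) (set (fst e))" using \<open>set (fst e) = K\<close> assms unfolding fits_def by auto
      then show ?thesis using gather_mono[of "fst e @ U" T Y] \<open>set (fst e) = K\<close> by auto
    next
      case False
      have "K \<subseteq> set U"
      proof (rule ccontr)
        assume "\<not> K \<subseteq> set U"
        then obtain a b where "a \<in> set U" "b \<in> K - set U" "adj a b"
          using connD[OF assms(1), of "K \<inter> set U"] False by auto
        then have "b \<in> nbhd (set U)" using adj_sym unfolding nbhd_def by auto
        then show False using Cons.prems(2) assms(4) \<open>b \<in> K - set U\<close> by auto
      qed
      then show ?thesis using gather_mono[of U "e # T" Y] by blast
    qed
  next
    case False
    then have "K \<in> csets T" using Cons.prems(1) by auto
    then show ?thesis using Cons.IH n Cons.prems(2) by simp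
  qed
qed simp

text \<open>The only property of tree decompositions that is used: a connected set whose neighbourhood lies
  in a bag contains a vertex that can be eliminated.\<close>

definition elim_bags :: "nat set \<Rightarrow> nat \<Rightarrow> nat set set \<Rightarrow> bool" where
  "elim_bags A w Bs \<longleftrightarrow> Bs \<noteq> {} \<and> (\<forall>B\<in>Bs. finite B \<and> card B \<le> w + 1) \<and>
     (\<forall>C B. conn C \<longrightarrow> C \<subseteq> A \<longrightarrow> C \<noteq> {} \<longrightarrow> B \<in> Bs \<longrightarrow> nbhd C \<subseteq> B \<longrightarrow> (\<exists>v\<in>C. \<exists>B'\<in>Bs. insert v (nbhd C) \<subseteq> B'))"

text \<open>The parameter \<open>k\<close> measures the progress of the saturation: each round
  raises it by one, so \<open>n\<close> rounds suffice.\<close>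

definition complete :: "nat set set \<Rightarrow> nat set \<Rightarrow> nat \<Rightarrow> (nat list \<times> 'b) list \<Rightarrow> bool" where
  "complete Bs A k T \<longleftrightarrow> (\<forall>C. C \<subseteq> A \<longrightarrow> C \<noteq> {} \<longrightarrow> conn C \<longrightarrow> card C \<le> k \<longrightarrow>
     (\<exists>B\<in>Bs. nbhd C \<subseteq> B) \<longrightarrow> C \<in> csets T)"

text \<open>A component \<open>K\<close> of \<open>C - {v}\<close> is smaller than \<open>C\<close>,
  and its neighbourhood lies in \<open>Y\<close> and so in the bag \<open>B\<close>; hence it is in
  the table. As \<open>C\<close> is connected, an edge leaves \<open>K\<close> within
  \<open>C\<close>, and it can only lead to \<open>v\<close>, so \<open>K\<close> fits.\<close>

lemma gather_eq:
  assumes T: "\<forall>e\<in>set T. conn (set (fst e))" and c: "complete Bs A k T"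
    and C: "conn C" "C \<subseteq> A" "finite C" "card C \<le> Suc k" "v \<in> C"
    and Y: "hd Y = v" "set Y = insert v (nbhd C)" "B \<in> Bs" "set Y \<subseteq> B"
  shows "set (v # gather T Y []) = C"
proof
  have ne: "Y \<noteq> []" using Y(2) by auto
  show "set (v # gather T Y []) \<subseteq> C"
    using gather_subset[OF C(5) _ Y(1) ne T, of "[]"] C(5) Y(2) by auto
  show "C \<subseteq> set (v # gather T Y [])"
  proof
    fix u assume u: "u \<in> C"
    show "u \<in> set (v # gather T Y [])"
    proof (cases "u = v")
      case False
      then have "u \<in> C - {v}" using u by simp
      then obtain K where K: "K \<subseteq> C - {v}" "u \<in> K" "conn K" "nbhd K \<inter> (C - {v}) = {}"
        by (rule component_exists)
      have nb: "nbhd K \<subseteq> set Y" using K(1,4) unfolding Y(2) nbhd_def by blast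
      obtain a b where ab: "a \<in> K" "b \<in> C - K" "adj a b"
        using connD[OF C(1), of K] K C(5) by blast
      then have "b \<in> nbhd K" using adj_sym unfolding nbhd_def by auto
      then have "b = v" using K(4) ab by auto
      then have "v \<in> nbhd K" using \<open>b \<in> nbhd K\<close> by simp
      have "card K < card C" using K(1) C(3,5) by (intro psubset_card_mono) auto
      then have "K \<in> csets T"
        using c[unfolded complete_def, rule_format, of K] K(1-3) C(2,4) subset_trans[OF nb Y(4)] Y(3) by auto
      moreover have "K \<inter> set Y = {}" using K(1) Y(2) unfolding nbhd_def by auto
      ultimately have "K \<subseteq> set (gather T Y [])"
        using \<open>v \<in> nbhd K\<close> Y(1) K(2)
        by (intro gather_complete[OF K(3) nb]) (auto simp: nbhd_def)
      then show ?thesis using K(2) by auto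
    qed simp
  qed
qed

end

section \<open>Tables of pieces\<close>

locale mu_graph = mu_items +
  assumes adj_less: "adj u v \<Longrightarrow> u < n" and tuples_less: "n * n ^ (D + 1) < N"
begin

definition Vl :: "nat list" where "Vl = rev [0..<n]"

lemma Vl_simps: "set Vl = {..<n}" "length Vl = n" "distinct Vl"
  unfolding Vl_def by auto

definition nbrs :: "nat list \<Rightarrow> nat list" where
  "nbrs C = nbl C Vl"

lemma set_nbrs: "set (nbrs C) = nbhd (set C)"
  unfolding nbrs_def nbl_def nbhd_def using Vl_simps(1) adj_less by auto

lemma distinct_nbrs: "distinct (nbrs C)"
  unfolding nbrs_def nbl_def using Vl_simps(3) by simp

lemma distinct_less_N: "distinct C \<Longrightarrow> set C \<subseteq> {..<n} \<Longrightarrow> length C < N"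
  using card_lessThan_n[of "set C"] distinct_card[of C] n_less by simp

text \<open>Soundness of a table entry. The loop variable \<open>w\<close> does not occur, so an
  answer found at a small width is correct as well.\<close>

definition piece :: "nat list \<times> nat list list \<Rightarrow> bool" where
  "piece e \<longleftrightarrow> fst e \<noteq> [] \<and> distinct (fst e) \<and> set (fst e) \<subseteq> {..<n} \<and> conn (set (fst e)) \<and>
     length (nbrs (fst e)) \<le> D + 1 \<and> rep (set (fst e)) (nbrs (fst e)) (snd e)"

definition enc_piece :: "nat list \<times> nat list list \<Rightarrow> data" where
  "enc_piece e = Node (el (fst e)) (Node (el (nbrs (fst e)))
     (enc_items (iprof (set (fst e)) (nbrs (fst e))) (snd e)))"

abbreviation enc_table :: "(nat list \<times> nat list list) list \<Rightarrow> data" where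
  "enc_table T \<equiv> data_list (map enc_piece T)"

lemma all_le: "length A < N \<Longrightarrow> length B < N \<Longrightarrow> computes f_all [el A, el B, bool_atom b]
     (bool_atom (\<forall>x\<in>set A. (x \<in> set B) = b)) (50 * N\<^sup>2)"
  using len_mult[of "length A" "50 * N"]
  by (intro ok_mono[OF all_computes]) (auto simp: power2_eq_square)

lemma fits_computes:
  assumes "distinct C" "set C \<subseteq> {..<n}" "distinct U" "set U \<subseteq> {..<n}" "length Y \<le> D + 1"
  shows "computes f_fits [el C, el (nbrs C), el Y, el U] (bool_atom (fits Y (set U) (set C))) (N ^ 3)"
proof -
  have l: "length C < N" "length U < N" "length Y < N" "length (nbrs C) < N"
  proof -
    have "set (nbrs C) \<subseteq> {..<n}" using Vl_simps(1) unfolding nbrs_def nbl_def by auto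
    then show "length (nbrs C) < N" by (rule distinct_less_N[OF distinct_nbrs])
    show "length C < N" "length U < N" "length Y < N" using distinct_less_N assms D_less by auto
  qed
  have 1: "computes f_mem [Atom (int y), el (nbrs C)] (bool_atom (y \<in> nbhd (set C))) (20 * N)" for y
    unfolding set_nbrs[symmetric] by (rule ok_mono[OF mem_computes]) (use l in simp)
  note a = all_le[of "nbrs C" Y True, simplified] all_le[of C Y False, simplified] all_le[of C U False, simplified]
  show ?thesis
    using 1[of "hd Y"] a l cube sq N_ge
    by (cases Y) (intro okI; auto simp: b_fits_def ok_def fits_def set_nbrs)+
qed

text \<open>The induction carries along the conditions under which \<open>merge_union\<close>
  applies. The resulting items are only claimed to exist, since any representative family will
  do.\<close>

lemma gather_computes:
  assumes Y: "length Y \<le> D + 1"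
  shows "\<forall>e\<in>set T. piece e \<Longrightarrow> rep (set U) Y A \<Longrightarrow> distinct U \<Longrightarrow> set U \<subseteq> {..<n} \<Longrightarrow>
      set U \<inter> set Y = {} \<Longrightarrow> nbhd (set U) \<subseteq> set Y \<Longrightarrow>
    \<exists>A'. computes f_gather [enc_table T, el Y, el U, enc_items (iprof (set U) Y) A, m]
      (Node (el (gather T Y U)) (enc_items (iprof (set (gather T Y U)) Y) A')) ((length T + 1) * (2 * N ^ 8)) \<and>
      rep (set (gather T Y U)) Y A' \<and> distinct (gather T Y U) \<and> set (gather T Y U) \<subseteq> {..<n} \<and>
      set (gather T Y U) \<inter> set Y = {} \<and> nbhd (set (gather T Y U)) \<subseteq> set Y"
proof (induction T arbitrary: U A)
  case Nil
  have "10 \<le> 2 * N ^ 8" using const_pow[of 1 1 8] N_ge by simp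
  then have "computes f_gather [enc_table [], el Y, el U, enc_items (iprof (set U) Y) A, m]
      (Node (el U) (enc_items (iprof (set U) Y) A)) (2 * N ^ 8)"
    by (intro okI; simp add: b_gather_def ok_def)
  then show ?case using Nil by auto
next
  case (Cons e T)
  let ?C = "fst e" and ?X = "nbrs (fst e)"
  have p: "?C \<noteq> []" "distinct ?C" "set ?C \<subseteq> {..<n}" "length ?X \<le> D + 1" "rep (set ?C) ?X (snd e)"
    and T: "\<forall>e\<in>set T. piece e"
    using Cons.prems(1) unfolding piece_def by auto
  have t: "computes f_fits [el ?C, el ?X, el Y, el U] (bool_atom (fits Y (set U) (set ?C))) (N ^ 3)"
    by (rule fits_computes) (use p Cons.prems Y in auto)
  have N3: "2 * N ^ 3 \<le> N ^ 8" "1000 * N \<le> N ^ 8" using const_pow[of 2 3 8] const_pow[of 1000 1 8] by simp_all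
  show ?case
  proof (cases "fits Y (set U) (set ?C)")
    case False
    obtain A' where A': "computes f_gather [enc_table T, el Y, el U, enc_items (iprof (set U) Y) A, m]
      (Node (el (gather T Y U)) (enc_items (iprof (set (gather T Y U)) Y) A')) ((length T + 1) * (2 * N ^ 8))"
      "rep (set (gather T Y U)) Y A' \<and> distinct (gather T Y U) \<and> set (gather T Y U) \<subseteq> {..<n} \<and>
      set (gather T Y U) \<inter> set Y = {} \<and> nbhd (set (gather T Y U)) \<subseteq> set Y"
      using Cons.IH[OF T Cons.prems(2-)] by blast
    have "computes f_gather [enc_table (e # T), el Y, el U, enc_items (iprof (set U) Y) A, m]
      (Node (el (gather T Y U)) (enc_items (iprof (set (gather T Y U)) Y) A')) ((length (e # T) + 1) * (2 * N ^ 8))"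
      using t A'(1) False N3 N_ge by (intro okI; simp add: b_gather_def ok_def enc_piece_def)
    then show ?thesis using A'(2) False by auto
  next
    case True
    have nb: "nbhd (set ?C) \<subseteq> set Y" "set ?C \<inter> set Y = {}" "set ?C \<inter> set U = {}"
      using True unfolding fits_def by auto
    have dj: "set U \<inter> set ?C = {}" "nbhd (set U) \<inter> set ?C = {}" "set Y \<inter> (set U \<union> set ?C) = {}"
      using nb Cons.prems by auto
    have eq: "set U \<union> set ?C = set (?C @ U)" by auto
    note mu = merge_union[OF Cons.prems(2) p(5) dj Cons.prems(6) _ Cons.prems(4) p(3) Y p(4), unfolded eq]
    define A2 where "A2 = merge_rep (set (?C @ U)) Y A (snd e)"
    have m1: "computes f_merge [enc_items (iprof (set U) Y) A, enc_items (iprof (set ?C) ?X) (snd e), Atom 0,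
        el Y, el ?X, el Y, m] (enc_items (iprof (set (?C @ U)) Y) A2) (N ^ 8)"
      and m2: "rep (set (?C @ U)) Y A2"
      using mu unfolding A2_def set_nbrs by blast+
    have pre: "distinct (?C @ U)" "set (?C @ U) \<subseteq> {..<n}" "set (?C @ U) \<inter> set Y = {}"
        "nbhd (set (?C @ U)) \<subseteq> set Y"
      using Cons.prems p nb nbhd_Un[of "set ?C" "set U"] by auto
    have ap: "computes f_app [el ?C, el U] (el (?C @ U)) (20 * N)"
      by (rule ok_mono[OF app_computes]) (use distinct_less_N[OF p(2,3)] in simp)
    obtain A' where A': "computes f_gather [enc_table T, el Y, el (?C @ U), enc_items (iprof (set (?C @ U)) Y) A2, m]
      (Node (el (gather T Y (?C @ U))) (enc_items (iprof (set (gather T Y (?C @ U))) Y) A')) ((length T + 1) * (2 * N ^ 8))"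
      "rep (set (gather T Y (?C @ U))) Y A' \<and> distinct (gather T Y (?C @ U)) \<and> set (gather T Y (?C @ U)) \<subseteq> {..<n} \<and>
      set (gather T Y (?C @ U)) \<inter> set Y = {} \<and> nbhd (set (gather T Y (?C @ U))) \<subseteq> set Y"
      using Cons.IH[OF T m2 pre] by blast
    have "computes f_gather [enc_table (e # T), el Y, el U, enc_items (iprof (set U) Y) A, m]
      (Node (el (gather T Y (?C @ U))) (enc_items (iprof (set (gather T Y (?C @ U))) Y) A')) ((length (e # T) + 1) * (2 * N ^ 8))"
      using t A'(1) m1 ap True N3 N_ge
      by (intro okI; simp add: b_gather_def ok_def enc_piece_def del: set_append map_append)
    then show ?thesis using A'(2) True by auto
  qed
qed

lemma rep_empty: "rep {} Y [[]]"
  unfolding rep_def by auto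

lemma start_computes:
  assumes Y: "length Y \<le> D + 1" and T: "\<forall>e\<in>set T. piece e" "length T < N"
  shows "\<exists>A. computes f_start [enc_table T, el Y, m]
      (Node (el (gather T Y [])) (enc_items (iprof (set (gather T Y [])) Y) A)) (N ^ 10) \<and>
      rep (set (gather T Y [])) Y A \<and> distinct (gather T Y []) \<and> set (gather T Y []) \<subseteq> {..<n} \<and>
      set (gather T Y []) \<inter> set Y = {} \<and> nbhd (set (gather T Y [])) \<subseteq> set Y"
proof -
  have "nbhd (set []) \<subseteq> set Y" unfolding nbhd_def by simp
  then obtain A where A: "computes f_gather [enc_table T, el Y, el [], enc_items (iprof (set []) Y) [[]], m]
      (Node (el (gather T Y [])) (enc_items (iprof (set (gather T Y [])) Y) A)) ((length T + 1) * (2 * N ^ 8))"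
      "rep (set (gather T Y [])) Y A \<and> distinct (gather T Y []) \<and> set (gather T Y []) \<subseteq> {..<n} \<and>
      set (gather T Y []) \<inter> set Y = {} \<and> nbhd (set (gather T Y [])) \<subseteq> set Y"
    using gather_computes[OF Y T(1), of "[]" "[[]]" m] rep_empty by auto
  have "computes f_tab [el Y, el [], Atom 0, Atom 0, Atom 2, Atom 0, Atom 0]
      (ptree Y (set []) (leaf {} {})) (2 ^ (length Y + 1) * (N ^ 3 + 30) - 30)"
    by (rule tab_computes, rule leaf_zero_computes)
  then have 1: "computes f_tab [el Y, Atom 0, Atom 0, Atom 0, Atom 2, Atom 0, Atom 0]
      (iprof {} Y []) (N ^ 5)"
    using tab_bound[OF Y] unfolding iprof_def prof_def by (auto elim!: ok_mono)
  have "(length T + 1) * (2 * N ^ 8) \<le> 2 * N ^ 9"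
    using len_mult[OF T(2), of "2 * N ^ 8"] power_Suc[of N 8] by simp
  moreover have "5 * N ^ 9 \<le> N ^ 10" "2 * N ^ 5 \<le> N ^ 9" "1000 * N \<le> N ^ 9"
    using const_pow[of 5 9 10] const_pow[of 2 5 9] const_pow[of 1000 1 9] by simp_all
  ultimately have "computes f_start [enc_table T, el Y, m]
      (Node (el (gather T Y [])) (enc_items (iprof (set (gather T Y [])) Y) A)) (N ^ 10)"
    using A(1) 1 N_ge by (intro okI; simp add: b_start_def ok_def enc_item_def)
  then show ?thesis using A(2) by blast
qed

end

section \<open>The saturation loop\<close>

text \<open>Each fitting piece contains a neighbour of \<open>v\<close>, so \<open>v\<close> holds
  the union together.\<close>

lemma (in adj_rel) gather_conn:
  assumes "hd Y = v" "Y \<noteq> []"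
  shows "\<forall>e\<in>set T. conn (set (fst e)) \<Longrightarrow> conn (insert v (set U)) \<Longrightarrow>
    conn (insert v (set (gather T Y U)))"
proof (induction T arbitrary: U)
  case (Cons e T)
  have "conn (insert v (set (fst e @ U)))" if f: "fits Y (set U) (set (fst e))"
  proof -
    obtain c where "c \<in> set (fst e)" "adj v c"
      using f assms unfolding fits_def nbhd_def by auto
    then have "conn (insert v (set U) \<union> set (fst e))"
      using Cons.prems by (intro conn_Un[of _ _ v c]) auto
    moreover have "insert v (set (fst e @ U)) = insert v (set U) \<union> set (fst e)" by auto
    ultimately show ?thesis by metis
  qed
  then show ?case using Cons by auto
qed simp

section \<open>Enumerating tuples of vertices\<close>

lemma down_computes: "computes f_down [Atom (int n)] (el (rev [0..<n])) (20 * (n + 1))"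
  by (induction n) (rule okI; simp add: b_down_def ok_def)+

abbreviation enc_lists :: "nat list list \<Rightarrow> data" where
  "enc_lists Ys \<equiv> data_list (map el Ys)"

lemma consall_computes:
  "computes f_consall [Atom (int v), enc_lists A, enc_lists B] (enc_lists (map ((#) v) A @ B)) (20 * (length A + 1))"
  by (induction A) (rule okI; simp add: b_consall_def ok_def)+

definition cons_each :: "nat list \<Rightarrow> nat list list \<Rightarrow> nat list list" where
  "cons_each A Ys = concat (map (\<lambda>v. map ((#) v) Ys) A)"

lemma ext_computes:
  "computes f_ext [el A, enc_lists Ys] (enc_lists (cons_each A Ys)) ((length A + 1) * (20 * length Ys + 50))"
proof (induction A)
  case Nil
  show ?case by (intro okI; simp add: b_ext_def ok_def cons_each_def)
next
  case (Cons v A)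
  then show ?case using consall_computes[of v Ys "cons_each A Ys"]
    by (intro okI; simp add: b_ext_def ok_def cons_each_def)
qed

definition tuples :: "nat \<Rightarrow> nat \<Rightarrow> nat list list \<Rightarrow> bool" where
  "tuples n w Ys \<longleftrightarrow> set Ys = {Y. length Y = w \<and> set Y \<subseteq> {..<n}} \<and> length Ys = n ^ w"

lemma tuples_cons_each:
  assumes "tuples n w Ys"
  shows "tuples n (Suc w) (cons_each (rev [0..<n]) Ys)"
proof -
  have "set (cons_each (rev [0..<n]) Ys) = {v # Y | v Y. v < n \<and> Y \<in> set Ys}"
    unfolding cons_each_def by auto
  also have "\<dots> = {Y. length Y = Suc w \<and> set Y \<subseteq> {..<n}}"
    using assms unfolding tuples_def by (auto simp: length_Suc_conv)
  finally show ?thesis using assms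
    unfolding tuples_def cons_each_def by (simp add: length_concat sum_list_triv comp_def)
qed

context mu_graph
begin

text \<open>A success always prepends an entry, even if the same set is present already. Such
  duplicates are rejected by the disjointness test of \<open>fits\<close>, and the number of
  attempts bounds the length of the table.\<close>

lemma derive_computes:
  assumes v: "v < n" "set Y \<subseteq> {..<n}" "length Y \<le> D" and T: "\<forall>e\<in>set T. piece e" "length T < N"
  defines "C \<equiv> insert v (set (gather T (v # Y) []))"
  shows "\<exists>T'. computes f_derive [mat, el Vl, el (v # Y), enc_table T] (enc_table T') (N ^ 12) \<and>
    (\<forall>e\<in>set T'. piece e) \<and> length T' \<le> Suc (length T) \<and>
    csets T' = (if nbhd C \<subseteq> insert v (set Y) then insert C (csets T) else csets T)"
proof -
  let ?Y = "v # Y"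
  define U where "U = gather T ?Y []"
  have Yl: "length ?Y \<le> D + 1" using v by simp
  obtain A where A: "computes f_start [enc_table T, el ?Y, mat]
      (Node (el U) (enc_items (iprof (set U) ?Y) A)) (N ^ 10)"
    "rep (set U) ?Y A" "distinct U" "set U \<subseteq> {..<n}" "set U \<inter> set ?Y = {}" "nbhd (set U) \<subseteq> set ?Y"
    using start_computes[OF Yl T, of mat] unfolding U_def by blast
  define Cl where "Cl = v # U"
  have C: "C = set Cl" unfolding C_def Cl_def U_def by simp
  have Cl: "distinct Cl" "set Cl \<subseteq> {..<n}" "length Cl < N"
    using A v distinct_less_N[of Cl] unfolding Cl_def by auto
  let ?X = "nbrs Cl"
  have X: "set ?X \<subseteq> {..<n}" "set ?X = nbhd C" "distinct ?X"
    using Vl_simps(1) set_nbrs distinct_nbrs unfolding nbrs_def nbl_def C by auto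
  have lX: "length ?X < N" by (rule distinct_less_N) (use X in auto)
  have n1: "computes f_nbrs [mat, el Cl, el Vl] (el ?X) (100 * N ^ 3)"
  proof -
    have "computes f_nbrs [mat, el Cl, el Vl] (el ?X) ((length Vl + 1) * (100 * N\<^sup>2))"
      unfolding nbrs_def by (rule nbrs_computes) (use Cl Vl_simps in auto)
    moreover have "N * N\<^sup>2 = N ^ 3" by (simp add: power3_eq_cube power2_eq_square)
    ultimately show ?thesis
      using len_mult[OF n_less, of "100 * N\<^sup>2"] Vl_simps(2) by (auto elim!: ok_mono)
  qed
  have al: "computes f_all [el ?X, el ?Y, Atom 1] (bool_atom (nbhd C \<subseteq> insert v (set Y))) (50 * N\<^sup>2)"
  proof -
    have "(\<forall>x\<in>set ?X. (x \<in> set ?Y) = True) = (nbhd C \<subseteq> insert v (set Y))" using X(2) by auto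
    then show ?thesis using all_le[of ?X ?Y True] lX Yl D_less by simp
  qed
  have pw: "2 * N ^ 10 \<le> N ^ 12" "1000 * N ^ 3 \<le> N ^ 10" "2 * N ^ 8 \<le> N ^ 10"
    using const_pow[of 2 10 12] const_pow[of 1000 3 10] const_pow[of 2 8 10] by simp_all
  have pw2: "3 * N ^ 10 \<le> N ^ 11" "3 * N ^ 11 \<le> N ^ 12"
    using const_pow[of 3 10 11] const_pow[of 3 11 12] by simp_all
  show ?thesis
  proof (cases "nbhd C \<subseteq> insert v (set Y)")
    case False
    have "computes f_close [mat, el ?Y, enc_table T, Node (el U) (enc_items (iprof (set U) ?Y) A), el ?X]
       (enc_table T) (N ^ 10)"
      using al False cube sq N_ge pw by (intro okI; simp add: b_close_def ok_def)
    then have "computes f_derive [mat, el Vl, el ?Y, enc_table T] (enc_table T) (N ^ 12)"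
      using A(1) n1 pw pw2 cube sq N_ge unfolding Cl_def by (intro okI; simp add: b_derive_def ok_def)
    then show ?thesis using False T by auto
  next
    case True
    let ?g = "\<lambda>S. if S = [] then Atom 0 else Atom 1"
    define A' where "A' = merge_rep C ?X A [[v], []]"
    have vC: "v \<notin> nbhd C" unfolding C nbhd_def Cl_def by auto
    have Cu: "C = insert v (set U)" unfolding C Cl_def by simp
    \<comment> \<open>As \<open>v\<close> belongs to \<open>C\<close>, it is not a neighbour of
      \<open>C\<close>, so the neighbourhood fits into the tail \<open>Y\<close> of the
      tuple.\<close>
    have "card (nbhd C) \<le> card (set Y)" using True vC by (intro card_mono) auto
    then have lX': "length ?X \<le> D + 1"
      using card_length[of Y] v(3) distinct_card[OF X(3)] X(2) by simp
    note mf = merge_forget[OF A(2), of ?X]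
    have m: "computes f_merge [enc_items (iprof (set U) ?Y) A, enc_items ?g [[v], []], Atom 0, el ?Y, Atom 0, el ?X, mat]
        (enc_items (iprof C ?X) A') (N ^ 8)" "rep C ?X A'"
      unfolding A'_def Cu by (rule mf; use A X v lX' Cu in \<open>auto simp: nbhd_def\<close>)+
    have cl: "computes f_close [mat, el ?Y, enc_table T, Node (el U) (enc_items (iprof (set U) ?Y) A), el ?X]
       (enc_table ((Cl, A') # T)) (N ^ 10)"
      using al True m(1) cube sq N_ge pw by (intro okI; simp add: b_close_def ok_def enc_item_def enc_piece_def C Cl_def)
    then have "computes f_derive [mat, el Vl, el ?Y, enc_table T] (enc_table ((Cl, A') # T)) (N ^ 12)"
      using A(1) n1 pw pw2 cube sq N_ge unfolding Cl_def by (intro okI; simp add: b_derive_def ok_def)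
    moreover have "piece (Cl, A')"
    proof -
      have "conn (set Cl)" using gather_conn[of ?Y v T "[]"] T(1) conn_singleton
        unfolding piece_def Cl_def U_def by auto
      then show ?thesis unfolding piece_def using Cl lX' m(2) C by (simp add: Cl_def)
    qed
    ultimately show ?thesis using True T C by (intro exI[of _ "(Cl, A') # T"]) auto
  qed
qed

text \<open>The table grows during a round, so each tuple meets an intermediate table
  \<open>T0\<close>. It is recorded that \<open>T0\<close> is sound and contains all sets present at
  the start of the round.\<close>

definition tried where
  "tried T T' Y \<longleftrightarrow> (\<exists>T0. (\<forall>e\<in>set T0. piece e) \<and> csets T \<subseteq> csets T0 \<and>
     (nbhd (set (hd Y # gather T0 Y [])) \<subseteq> set Y \<longrightarrow> set (hd Y # gather T0 Y []) \<in> csets T'))"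

lemma tried_mono: "tried T1 T' Y \<Longrightarrow> csets T \<subseteq> csets T1 \<Longrightarrow> tried T T' Y"
  unfolding tried_def using subset_trans[of "csets T"] by (elim exE conjE, intro exI conjI) assumption+

lemma loop_y_computes:
  "\<forall>Y\<in>set Ys. Y \<noteq> [] \<and> set Y \<subseteq> {..<n} \<and> length Y \<le> D + 1 \<Longrightarrow> \<forall>e\<in>set T. piece e \<Longrightarrow>
   length T + length Ys < N \<Longrightarrow>
   \<exists>T'. computes f_loop_y [mat, el Vl, enc_lists Ys, enc_table T] (enc_table T') ((length Ys + 1) * (2 * N ^ 12)) \<and>
     (\<forall>e\<in>set T'. piece e) \<and> length T' \<le> length T + length Ys \<and> csets T \<subseteq> csets T' \<and>
     (\<forall>Y\<in>set Ys. tried T T' Y)"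
proof (induction Ys arbitrary: T)
  case Nil
  have "20 \<le> 2 * N ^ 12" using const_pow[of 20 0 12] by simp
  then have "computes f_loop_y [mat, el Vl, enc_lists [], enc_table T] (enc_table T) (2 * N ^ 12)"
    by (intro okI; simp add: b_loop_y_def ok_def)
  then show ?case using Nil by auto
next
  case (Cons Z Ys)
  obtain v Y where Z: "Z = v # Y" using Cons.prems(1) by (cases Z) auto
  have vY: "v < n" "set Y \<subseteq> {..<n}" "length Y \<le> D" using Cons.prems(1) Z by auto
  obtain T1 where T1: "computes f_derive [mat, el Vl, el (v # Y), enc_table T] (enc_table T1) (N ^ 12)"
    "\<forall>e\<in>set T1. piece e" "length T1 \<le> Suc (length T)"
    "csets T1 = (if nbhd (insert v (set (gather T (v # Y) []))) \<subseteq> insert v (set Y)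
       then insert (insert v (set (gather T (v # Y) []))) (csets T) else csets T)"
    using derive_computes[OF vY Cons.prems(2)] Cons.prems(3) by auto
  have sub: "csets T \<subseteq> csets T1" unfolding T1(4) by auto
  obtain T' where T': "computes f_loop_y [mat, el Vl, enc_lists Ys, enc_table T1] (enc_table T') ((length Ys + 1) * (2 * N ^ 12))"
     "\<forall>e\<in>set T'. piece e" "length T' \<le> length T1 + length Ys" "csets T1 \<subseteq> csets T'"
     "\<forall>Y\<in>set Ys. tried T1 T' Y"
    using Cons.IH[OF _ T1(2)] Cons.prems T1(3) by auto
  have "100 \<le> N ^ 12" using const_pow[of 100 0 12] by simp
  then have "computes f_loop_y [mat, el Vl, enc_lists (Z # Ys), enc_table T] (enc_table T') ((length (Z # Ys) + 1) * (2 * N ^ 12))"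
    using T1(1) T'(1) unfolding Z by (intro okI; simp add: b_loop_y_def ok_def)
  moreover have "tried T T' Z"
  proof -
    have "csets T1 \<subseteq> csets T'" by (rule T'(4))
    then show ?thesis using T1(4) Cons.prems(2) unfolding Z tried_def
      by (intro exI[of _ T]) (auto split: if_splits)
  qed
  moreover have "\<forall>Y\<in>set Ys. tried T T' Y"
    using T'(5) tried_mono[OF _ sub] by blast
  moreover have "csets T \<subseteq> csets T'" using sub T'(4) by (rule subset_trans)
  moreover have "length T' \<le> length T + length (Z # Ys)" using T'(3) T1(3) by simp
  ultimately show ?case using T'(2) unfolding set_simps(2) ball_simps by blast
qed

text \<open>For a set \<open>C\<close> of the next size, \<open>elim_bags\<close> supplies the
  vertex \<open>v\<close> to be eliminated. One of the tuples lists \<open>v\<close> and the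
  neighbours of \<open>C\<close>, and by \<open>gather_eq\<close> trying it produces exactly
  \<open>C\<close>.\<close>

lemma complete_step:
  assumes Bs: "elim_bags {..<n} w Bs" and c: "complete Bs {..<n} k T"
    and Ys: "tuples n (Suc w) Ys" and sub: "csets T \<subseteq> csets T'"
    and T': "\<forall>Y\<in>set Ys. tried T T' Y"
  shows "complete Bs {..<n} (Suc k) T'"
  unfolding complete_def
proof (intro allI impI)
  fix C assume C: "C \<subseteq> {..<n}" "C \<noteq> {}" "conn C" "card C \<le> Suc k" and "\<exists>B\<in>Bs. nbhd C \<subseteq> B"
  then obtain v B where v: "v \<in> C" "B \<in> Bs" "insert v (nbhd C) \<subseteq> B"
    using Bs unfolding elim_bags_def by meson
  have fin: "finite B" "card B \<le> w + 1" using Bs v(2) unfolding elim_bags_def by auto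
  have vn: "v \<notin> nbhd C" using v(1) unfolding nbhd_def by auto
  have finn: "finite (nbhd C)" using v(3) fin(1) finite_subset by auto
  have "card (insert v (nbhd C)) \<le> w + 1" using card_mono[OF fin(1) v(3)] fin(2) by simp
  then have cn: "card (nbhd C) \<le> w" using vn finn by simp
  obtain xs where xs: "set xs = nbhd C" "distinct xs" using finite_distinct_list[OF finn] by auto
  \<comment> \<open>A bag has at most \<open>w + 1\<close> vertices, one of which is
    \<open>v\<close>; so at most \<open>w\<close> neighbours remain, and copies of \<open>v\<close>
    fill the tuple up to length \<open>w + 1\<close>.\<close>
  define Y where "Y = v # xs @ replicate (w - length xs) v"
  have lx: "length xs \<le> w" using distinct_card[OF xs(2)] xs(1) cn by simp
  have Y: "hd Y = v" "set Y = insert v (nbhd C)" "length Y = Suc w"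
    unfolding Y_def using xs lx by auto
  have "nbhd C \<subseteq> {..<n}" using adj_less unfolding nbhd_def by auto
  then have "Y \<in> set Ys" using Ys Y v(1) C(1) unfolding tuples_def by auto
  then obtain T0 where T0: "\<forall>e\<in>set T0. piece e" "csets T \<subseteq> csets T0"
    "nbhd (set (hd Y # gather T0 Y [])) \<subseteq> set Y \<longrightarrow> set (hd Y # gather T0 Y []) \<in> csets T'"
    using bspec[OF T' \<open>Y \<in> set Ys\<close>] unfolding tried_def by (elim exE conjE) (rule that)
  have c0: "complete Bs {..<n} k T0" using c unfolding complete_def
    by (intro allI impI subsetD[OF T0(2)]) simp
  have p0: "\<forall>e\<in>set T0. conn (set (fst e))" using T0(1) unfolding piece_def by auto
  have "finite C" "set Y \<subseteq> B" using C(1) card_lessThan_n v(3) Y(2) by auto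
  then have "set (v # gather T0 Y []) = C"
    using gather_eq[OF p0 c0 C(3,1) _ C(4) v(1) Y(1,2) v(2)] by blast
  then show "C \<in> csets T'" using T0(3) Y by auto
qed

text \<open>The list \<open>W\<close> is a unary counter of rounds. Completeness is conditional on a
  family of bags for the current \<open>w\<close>, while soundness of the table is not.\<close>

lemma loop_r_computes:
  assumes Ys: "tuples n (Suc w) Ys" and w: "w \<le> D" and lYs: "length Ys < N"
  shows "\<forall>e\<in>set T. piece e \<Longrightarrow> length T + length W * length Ys < N \<Longrightarrow>
   \<exists>T'. computes f_loop_r [mat, el Vl, el W, enc_lists Ys, enc_table T] (enc_table T') ((length W + 1) * (3 * N ^ 13)) \<and>
     (\<forall>e\<in>set T'. piece e) \<and> length T' < N \<and>
     (\<forall>Bs k. elim_bags {..<n} w Bs \<longrightarrow> complete Bs {..<n} k T \<longrightarrow> complete Bs {..<n} (k + length W) T')"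
proof (induction W arbitrary: T)
  case Nil
  have "20 \<le> 3 * N ^ 13" using const_pow[of 20 0 13] by simp
  then have "computes f_loop_r [mat, el Vl, el [], enc_lists Ys, enc_table T] (enc_table T) (3 * N ^ 13)"
    by (intro okI; simp add: b_loop_r_def ok_def)
  then show ?case using Nil by auto
next
  case (Cons x W)
  have Y: "\<forall>Y\<in>set Ys. Y \<noteq> [] \<and> set Y \<subseteq> {..<n} \<and> length Y \<le> D + 1"
    using Ys w unfolding tuples_def by auto
  obtain T1 where T1: "computes f_loop_y [mat, el Vl, enc_lists Ys, enc_table T] (enc_table T1) ((length Ys + 1) * (2 * N ^ 12))"
     "\<forall>e\<in>set T1. piece e" "length T1 \<le> length T + length Ys" "csets T \<subseteq> csets T1"
     "\<forall>Y\<in>set Ys. tried T T1 Y"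
    using loop_y_computes[OF Y Cons.prems(1)] Cons.prems(2) by auto
  obtain T' where T': "computes f_loop_r [mat, el Vl, el W, enc_lists Ys, enc_table T1] (enc_table T') ((length W + 1) * (3 * N ^ 13))"
    "\<forall>e\<in>set T'. piece e" "length T' < N"
    "\<forall>Bs k. elim_bags {..<n} w Bs \<longrightarrow> complete Bs {..<n} k T1 \<longrightarrow> complete Bs {..<n} (k + length W) T'"
    using Cons.IH[OF T1(2)] T1(3) Cons.prems(2) by auto
  have "(length Ys + 1) * (2 * N ^ 12) \<le> 2 * N ^ 13"
    using len_mult[OF lYs, of "2 * N ^ 12"] power_Suc[of N 12] by simp
  moreover have "100 \<le> N ^ 13" using const_pow[of 100 0 13] by simp
  ultimately have "computes f_loop_r [mat, el Vl, el (x # W), enc_lists Ys, enc_table T] (enc_table T') ((length (x # W) + 1) * (3 * N ^ 13))"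
    using T1(1) T'(1) by (intro okI; simp add: b_loop_r_def ok_def)
  moreover have "complete Bs {..<n} (k + length (x # W)) T'" if "elim_bags {..<n} w Bs" "complete Bs {..<n} k T" for Bs k
    using T'(4)[rule_format, OF that(1) complete_step[OF that Ys T1(4,5)]] by simp
  ultimately show ?case using T'(2,3) by blast
qed

section \<open>Reading off the answer\<close>

definition good :: "int \<Rightarrow> nat list \<Rightarrow> bool" where
  "good k S \<longleftrightarrow> int (length S) \<le> k \<and> uniq_opt (covers {..<n} (set S) {})"

definition good_answer :: "int \<Rightarrow> data \<Rightarrow> bool" where
  "good_answer k y \<longleftrightarrow>
    (if \<exists>S. S \<subseteq> {..<n} \<and> int (card S) \<le> k \<and> uniq_opt (covers {..<n} S {})
     then \<exists>xs. distinct xs \<and> set xs \<subseteq> {..<n} \<and> good k xs \<and> y = Node (Atom 1) (el xs)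
     else y = Atom 0)"

lemma choose_computes:
  "computes f_choose [enc_items (iprof {..<n} []) A, Atom k]
    (case find (good k) A of None \<Rightarrow> Atom 0 | Some S \<Rightarrow> Node (Atom 1) (el S)) (40 * (length A + 1))"
proof (induction A)
  case (Cons S A)
  then show ?case
    by (intro okI; auto simp: b_choose_def ok_def enc_item_def iprof_def prof_def leaf_def good_def)
qed (rule okI; simp add: b_choose_def ok_def)

text \<open>Over the empty bag a profile is a single leaf, whose bit tells whether the minimum
  vertex cover is unique. A representative shares this leaf and the size with the solution that it
  replaces.\<close>

lemma good_answer_find:
  assumes "rep {..<n} [] A"
  shows "good_answer k (case find (good k) A of None \<Rightarrow> Atom 0 | Some S \<Rightarrow> Node (Atom 1) (el S))"
proof (cases "\<exists>S. S \<subseteq> {..<n} \<and> int (card S) \<le> k \<and> uniq_opt (covers {..<n} S {})")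
  case True
  then obtain S where S: "S \<subseteq> {..<n}" "int (card S) \<le> k" "uniq_opt (covers {..<n} S {})" by blast
  then obtain S' where S': "S' \<in> set A" "length S' = card S" "prof {..<n} [] (set S') = prof {..<n} [] S"
    using assms unfolding rep_def by blast
  then have "good k S'" using S unfolding good_def prof_def leaf_def by (auto split: if_splits)
  then have "find (good k) A \<noteq> None" using S'(1) unfolding find_None_iff by blast
  then obtain xs where xs: "find (good k) A = Some xs" by auto
  then have "xs \<in> set A" "good k xs" by (auto simp: find_Some_iff)
  then show ?thesis using True xs assms unfolding good_answer_def rep_def by auto
next
  case False
  have "find (good k) A = None"
    unfolding find_None_iff good_def using False assms unfolding rep_def by (auto simp: distinct_card)
  then show ?thesis using False unfolding good_answer_def by simp
qed

lemma n_pow_less: "w \<le> D + 1 \<Longrightarrow> n ^ w < N"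
proof (cases "n = 0")
  case True
  then show "n ^ w < N" using N_ge by (cases w) auto
next
  case False
  assume "w \<le> D + 1"
  then have "n ^ w \<le> n ^ (D + 1)" using False by (intro power_increasing) auto
  also have "\<dots> \<le> n * n ^ (D + 1)" using False by simp
  finally show "n ^ w < N" using tuples_less by simp
qed

text \<open>The component of a vertex has empty neighbourhood, which lies in any bag; at least one
  bag exists by \<open>elim_bags\<close>.\<close>

lemma cover_all:
  assumes Bs: "elim_bags {..<n} w Bs" and c: "complete Bs {..<n} n T"
  shows "{..<n} \<subseteq> set (gather T [] [])"
proof
  fix u assume "u \<in> {..<n}"
  then obtain K where K: "K \<subseteq> {..<n}" "u \<in> K" "conn K" "nbhd K \<inter> {..<n} = {}"
    by (rule component_exists)
  have nb: "nbhd K = {}" using K(4) adj_less unfolding nbhd_def by blast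
  have "Bs \<noteq> {}" using Bs unfolding elim_bags_def by simp
  then have "K \<in> csets T" using c K nb card_lessThan_n[OF K(1)] unfolding complete_def by auto
  then have "K \<subseteq> set (gather T [] [])"
    using K nb by (intro gather_complete) (auto simp: nbhd_def)
  then show "u \<in> set (gather T [] [])" using K(2) by auto
qed

text \<open>The answer is correct as soon as the gathered pieces cover all vertices, for whatever
  \<open>w\<close>. The family \<open>Bs\<close> only serves to exclude failure at
  \<open>w = D\<close>, which ends the recursion and bounds the number of passes.\<close>

lemma loop_w_computes:
  assumes Bs: "elim_bags {..<n} D Bs"
  shows "w \<le> D \<Longrightarrow> tuples n w Ys \<Longrightarrow>
    \<exists>y. computes f_loop_w [mat, el Vl, Atom k, enc_lists Ys] y ((D - w + 1) * N ^ 16) \<and> good_answer k y"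
proof (induction "D - w" arbitrary: w Ys rule: less_induct)
  case less
  define Zs where "Zs = cons_each Vl Ys"
  have Zs: "tuples n (Suc w) Zs" unfolding Zs_def Vl_def by (rule tuples_cons_each) (use less in simp)
  have lY: "length Ys < N" "length Zs < N"
    using less.prems Zs n_pow_less[of w] n_pow_less[of "Suc w"] unfolding tuples_def by auto
  have e: "computes f_ext [el Vl, enc_lists Ys] (enc_lists Zs) (70 * N\<^sup>2)"
  proof -
    have "(length Vl + 1) * (20 * length Ys + 50) \<le> N * (70 * N)"
      using n_less lY(1) Vl_simps(2) N_ge by (intro mult_le_mono) auto
    then show ?thesis unfolding Zs_def
      by (intro ok_mono[OF ext_computes]) (simp add: power2_eq_square)
  qed
  have "length Vl * length Zs < N"
  proof -
    have "n * n ^ Suc w < N"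
    proof (cases "n = 0")
      case False
      then have "n ^ Suc w \<le> n ^ (D + 1)" using less.prems(1) by (intro power_increasing) auto
      then have "n * n ^ Suc w \<le> n * n ^ (D + 1)" by (rule mult_le_mono2)
      then show ?thesis using tuples_less by (rule le_less_trans)
    qed (use N_ge in simp)
    then show ?thesis using Zs Vl_simps(2) unfolding tuples_def by simp
  qed
  then obtain T where T: "computes f_loop_r [mat, el Vl, el Vl, enc_lists Zs, enc_table []] (enc_table T) ((length Vl + 1) * (3 * N ^ 13))"
    "\<forall>e\<in>set T. piece e" "length T < N"
    "\<forall>Bs k. elim_bags {..<n} w Bs \<longrightarrow> complete Bs {..<n} k ([]::(nat list \<times> nat list list) list) \<longrightarrow> complete Bs {..<n} (k + length Vl) T"
    using loop_r_computes[OF Zs less.prems(1) lY(2), of "[]" Vl] by (auto simp del: power_Suc)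
  let ?U = "gather T [] []"
  have 0: "length ([]::nat list) \<le> D + 1" by simp
  obtain A where A: "computes f_start [enc_table T, el [], mat]
      (Node (el ?U) (enc_items (iprof (set ?U) []) A)) (N ^ 10)"
      "rep (set ?U) [] A" "distinct ?U" "set ?U \<subseteq> {..<n}"
    using start_computes[OF 0 T(2,3), of mat] by blast
  have al: "computes f_all [el Vl, el ?U, Atom 1] (bool_atom ({..<n} \<subseteq> set ?U)) (50 * N\<^sup>2)"
  proof -
    have "(\<forall>x\<in>set Vl. (x \<in> set ?U) = True) = ({..<n} \<subseteq> set ?U)" using Vl_simps by auto
    then show ?thesis using all_le[of Vl ?U True] n_less distinct_less_N[OF A(3,4)] Vl_simps by simp
  qed
  have r: "(length Vl + 1) * (3 * N ^ 13) \<le> 3 * N ^ 14"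
    using len_mult[OF n_less, of "3 * N ^ 13"] power_Suc[of N 13] Vl_simps(2) by simp
  have pw: "5 * N ^ 14 \<le> N ^ 15" "2 * N ^ 10 \<le> N ^ 14" "N ^ 3 * 2 \<le> N ^ 14" "5 * N ^ 15 \<le> N ^ 16"
    using const_pow[of 5 14 15] const_pow[of 2 10 14] const_pow[of 2 3 14] const_pow[of 5 15 16] by simp_all
  show ?case
  proof (cases "{..<n} \<subseteq> set ?U")
    case True
    then have U: "set ?U = {..<n}" using A(4) by auto
    let ?y = "case find (good k) A of None \<Rightarrow> Atom 0 | Some S \<Rightarrow> Node (Atom 1) (el S)"
    have rA: "rep {..<n} [] A" using A(2) U by simp
    have "computes f_choose [enc_items (iprof {..<n} []) A, Atom k] ?y (40 * N)"
      by (rule ok_mono[OF choose_computes]) (use rep_length[OF rA] in simp)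
    then have "computes f_loop_w [mat, el Vl, Atom k, enc_lists Ys] ?y (N ^ 16)"
      using e T(1) A(1) al True r pw cube sq N_ge unfolding U
      by (intro okI; simp add: b_loop_w_def ok_def)
    then have "computes f_loop_w [mat, el Vl, Atom k, enc_lists Ys] ?y ((D - w + 1) * N ^ 16)"
      by (rule ok_mono) simp
    then show ?thesis using good_answer_find[OF rA] by blast
  next
    case False
    have "w \<noteq> D"
    proof
      assume wD: "w = D"
      \<comment> \<open>Vacuous, since a nonempty subset of \<open>{..<n}\<close> has positive
        cardinality.\<close>
      have "complete Bs {..<n} 0 ([]::(nat list \<times> nat list list) list)" unfolding complete_def using card_lessThan_n by fastforce
      then have "complete Bs {..<n} n T" using T(4)[rule_format, of Bs 0] Bs wD Vl_simps(2) by simp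
      then show False using cover_all[OF Bs] False by blast
    qed
    then have wD: "Suc w \<le> D" "D - Suc w < D - w" using less.prems(1) by auto
    obtain y where y: "computes f_loop_w [mat, el Vl, Atom k, enc_lists Zs] y ((D - Suc w + 1) * N ^ 16)" "good_answer k y"
      using less.hyps[OF wD(2,1) Zs] by blast
    have "D - w + 1 = Suc (D - Suc w + 1)" using wD by simp
    then have eq: "(D - w + 1) * N ^ 16 = (D - Suc w + 1) * N ^ 16 + N ^ 16" by simp
    have "computes f_loop_w [mat, el Vl, Atom k, enc_lists Ys] y ((D - w + 1) * N ^ 16)"
      unfolding eq using e T(1) A(1) al False y(1) r pw cube sq N_ge
      by (intro okI; simp add: b_loop_w_def ok_def)
    then show ?thesis using y(2) by blast
  qed
qed

lemma main_computes:
  assumes "elim_bags {..<n} D Bs"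
  shows "\<exists>y. computes f_main [Node (Atom (int n)) (Node (Atom k) mat)] y (N ^ 18) \<and> good_answer k y"
proof -
  have "tuples n 0 [[]]" unfolding tuples_def by auto
  then obtain y where y: "computes f_loop_w [mat, el Vl, Atom k, enc_lists [[]]] y ((D - 0 + 1) * N ^ 16)" "good_answer k y"
    using loop_w_computes[OF assms, of 0 "[[]]" k] by blast
  have "(D + 1) * N ^ 16 \<le> N ^ 17" using D_less power_Suc[of N 16] mult_right_mono[of "D + 1" N "N ^ 16"] by simp
  moreover have "5 * N ^ 17 \<le> N ^ 18" "2 * N ^ 2 \<le> N ^ 17"
    using const_pow[of 5 17 18] const_pow[of 2 2 17] by simp_all
  moreover have "computes f_down [Atom (int n)] (el Vl) (20 * N)"
    unfolding Vl_def by (rule ok_mono[OF down_computes]) (use n_less in simp)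
  ultimately have "computes f_main [Node (Atom (int n)) (Node (Atom k) mat)] y (N ^ 18)"
    using y(1) sq N_ge by (intro okI; simp add: b_main_def ok_def)
  then show ?thesis using y(2) by blast
qed

end

section \<open>Tree decompositions\<close>

lemma rtrancl_distinct_path:
  "(x, y) \<in> R\<^sup>* \<Longrightarrow> \<exists>xs. xs \<noteq> [] \<and> hd xs = x \<and> last xs = y \<and> distinct xs \<and> successively (\<lambda>a b. (a, b) \<in> R) xs"
proof (induction rule: rtrancl_induct)
  case base
  show ?case by (intro exI[of _ "[x]"]) auto
next
  case (step y z)
  then obtain xs where xs: "xs \<noteq> []" "hd xs = x" "last xs = y" "distinct xs"
    "successively (\<lambda>a b. (a, b) \<in> R) xs" by blast
  show ?case
  proof (cases "z \<in> set xs")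
    case True
    then obtain ys zs where "xs = ys @ z # zs" by (auto simp: in_set_conv_decomp)
    then show ?thesis using xs
      by (intro exI[of _ "ys @ [z]"]) (auto simp: successively_append_iff hd_append)
  next
    case False
    then show ?thesis using xs step(2)
      by (intro exI[of _ "xs @ [z]"]) (auto simp: successively_append_iff)
  qed
qed

text \<open>A path from \<open>t\<close> to \<open>p\<close> with distinct nodes that avoids the
  edge between them has at least three nodes, so the edge closes it to a cycle.\<close>

lemma tree_bridge:
  assumes T: "is_tree T" and e: "{t, p} \<in> edges T"
    and r: "(t, p) \<in> ({(u, v). {u, v} \<in> edges T} - {(t, p), (p, t)})\<^sup>*"
  shows False
proof -
  have "card {t, p} = 2" using T e unfolding is_tree_def simple_graph_def by blast
  then have tp: "t \<noteq> p" by auto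
  obtain xs where xs: "xs \<noteq> []" "hd xs = t" "last xs = p" "distinct xs"
    "successively (\<lambda>a b. (a, b) \<in> {(u, v). {u, v} \<in> edges T} - {(t, p), (p, t)}) xs"
    using rtrancl_distinct_path[OF r] by blast
  have "3 \<le> length xs"
  proof (rule ccontr)
    assume "\<not> 3 \<le> length xs"
    then consider x where "xs = [x]" | x y where "xs = [x, y]"
      using xs(1) by (cases xs; cases "tl xs"; cases "tl (tl xs)") auto
    then show False using xs tp by cases auto
  qed
  moreover have "{xs ! i, xs ! Suc i} \<in> edges T" if "Suc i < length xs" for i
    using xs(5) that unfolding successively_conv_nth by auto
  moreover have "{last xs, hd xs} \<in> edges T" using xs(2,3) e by (simp add: insert_commute)
  ultimately have "is_cycle T xs" using xs(4) unfolding is_cycle_def by blast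
  then show False using T unfolding is_tree_def by blast
qed

text \<open>A walk that uses the edge between \<open>t\<close> and \<open>p\<close> visits
  \<open>t\<close>, and from there its remainder is no longer than the whole. Applied to a shortest
  path, this excludes the second alternative.\<close>

lemma relpow_avoid:
  "(x, s) \<in> E ^^ j \<Longrightarrow> (x, s) \<in> (E - {(t, p), (p, t)})\<^sup>* \<or> (\<exists>i\<le>j. (t, s) \<in> E ^^ i)"
proof (induction j arbitrary: x)
  case (Suc j)
  obtain y where y: "(x, y) \<in> E" "(y, s) \<in> E ^^ j" using relpow_Suc_D2[OF Suc.prems] by blast
  show ?case
  proof (cases "(x, y) \<in> E - {(t, p), (p, t)}")
    case True
    then show ?thesis using Suc.IH[OF y(2)] by (meson converse_rtrancl_into_rtrancl le_SucI)
  next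
    case False
    then have "x = t \<or> y = t" using y(1) by auto
    then show ?thesis using Suc.prems y(2) by (metis le_refl le_SucI)
  qed
qed simp

lemma adj_rel_edges:
  assumes simple: "simple_graph G"
  shows "adj_rel (\<lambda>u v. {u, v} \<in> edges G)"
proof
  show "{v, u} \<in> edges G" if "{u, v} \<in> edges G" for u v using that by (simp add: insert_commute)
  show "{u, u} \<notin> edges G" for u
  proof
    assume "{u, u} \<in> edges G"
    then have "card {u, u} = 2" using simple unfolding simple_graph_def by (elim conjE) (drule (1) bspec, simp)
    then show False by simp
  qed
qed

locale decomposed_graph =
  fixes G :: "nat graph" and T :: "'b graph" and B
  assumes simple: "simple_graph G" and td: "tree_decomposition G T B"
begin

sublocale adj_rel "\<lambda>u v. {u, v} \<in> edges G"
  by (rule adj_rel_edges[OF simple])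

definition E where "E = {(u, v). {u, v} \<in> edges T}"

definition E_on where "E_on Z = {(u, v). {u, v} \<in> edges T \<and> u \<in> Z \<and> v \<in> Z}"

lemma tree: "is_tree T" using td unfolding tree_decomposition_def by simp

lemma td_simps:
  "e \<in> edges G \<Longrightarrow> \<exists>x\<in>verts T. e \<subseteq> B x"
  "v \<in> verts G \<Longrightarrow> is_tree (induced T {x. v \<in> B x})"
  "x \<in> verts T \<Longrightarrow> B x \<subseteq> verts G"
  using td unfolding tree_decomposition_def by auto

lemma bag_of_edge: "{u, v} \<in> edges G \<Longrightarrow> \<exists>x\<in>verts T. u \<in> B x \<and> v \<in> B x"
  using td_simps(1)[of "{u, v}"] by simp

lemma vertex_connected:
  assumes "v \<in> verts G" "x \<in> verts T" "y \<in> verts T" "v \<in> B x" "v \<in> B y"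
  shows "(x, y) \<in> (E_on {x. v \<in> B x})\<^sup>*"
proof -
  have "is_tree (induced T {x. v \<in> B x})" using td_simps(2) assms(1) by blast
  then have "(x, y) \<in> {(u, w). {u, w} \<in> edges (induced T {x. v \<in> B x})}\<^sup>*"
    using assms unfolding is_tree_def connected_graph_def by (simp add: induced_def)
  moreover have "{(u, w). {u, w} \<in> edges (induced T {x. v \<in> B x})} = E_on {x. v \<in> B x}"
    unfolding induced_def E_on_def by auto
  ultimately show ?thesis by simp
qed

lemma edge_verts: "{u, v} \<in> edges G \<Longrightarrow> u \<in> verts G \<and> v \<in> verts G"
  using simple unfolding simple_graph_def by (auto dest!: bspec[of _ _ "{u, v}"])

lemma tree_edge_verts: "{u, v} \<in> edges T \<Longrightarrow> u \<in> verts T \<and> v \<in> verts T"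
  using tree unfolding is_tree_def simple_graph_def by (auto dest!: bspec[of _ _ "{u, v}"])

text \<open>The bags of one vertex are connected, and adjacent vertices share a bag. Hence the
  vertices of \<open>C\<close> that occur in a bag reachable from \<open>x\<close> are closed under
  adjacency in \<open>C\<close>, and so they are all of \<open>C\<close>.\<close>

lemma connected_bags:
  assumes C: "conn C" "C \<subseteq> verts G" and x: "x \<in> verts T" "B x \<inter> C \<noteq> {}"
    and y: "y \<in> verts T" "B y \<inter> C \<noteq> {}"
  shows "(x, y) \<in> (E_on {z. B z \<inter> C \<noteq> {}})\<^sup>*"
proof -
  define R where "R = {z \<in> verts T. (x, z) \<in> (E_on {z. B z \<inter> C \<noteq> {}})\<^sup>*}"
  define A where "A = {c \<in> C. \<exists>z\<in>R. c \<in> B z}"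
  have all: "z \<in> R" if c: "c \<in> A" "z \<in> verts T" "c \<in> B z" for c z
  proof -
    obtain z' where z': "z' \<in> R" "c \<in> B z'" using c(1) unfolding A_def by auto
    have "(z', z) \<in> (E_on {x. c \<in> B x})\<^sup>*"
      by (rule vertex_connected) (use c z' C(2) in \<open>auto simp: A_def R_def\<close>)
    moreover have "E_on {x. c \<in> B x} \<subseteq> E_on {z. B z \<inter> C \<noteq> {}}"
      using c(1) unfolding A_def E_on_def by blast
    ultimately have "(z', z) \<in> (E_on {z. B z \<inter> C \<noteq> {}})\<^sup>*" using rtrancl_mono by blast
    then show ?thesis using z'(1) c(2) unfolding R_def by auto
  qed
  have "x \<in> R" unfolding R_def using x by simp
  then have "A \<noteq> {}" using x(2) unfolding A_def by auto
  have "A = C"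
  proof (rule ccontr)
    assume "A \<noteq> C"
    then obtain a b where ab: "a \<in> A" "b \<in> C - A" "{a, b} \<in> edges G"
      using connD[OF C(1), of A] \<open>A \<noteq> {}\<close> unfolding A_def by auto
    obtain z where "z \<in> verts T" "a \<in> B z" "b \<in> B z" using bag_of_edge[OF ab(3)] by blast
    then have "b \<in> A" using all[OF ab(1)] ab(2) unfolding A_def by auto
    then show False using ab(2) by simp
  qed
  then have "y \<in> R" using all y by auto
  then show ?thesis unfolding R_def by simp
qed

lemma E_sym: "(E - {(t, p), (p, t)})\<inverse> = E - {(t, p), (p, t)}"
  unfolding E_def by (auto simp: insert_commute)

text \<open>Take a bag \<open>B t\<close> containing the neighbourhood and a bag \<open>B s\<close>
  meeting \<open>C\<close> at minimal distance. If \<open>B t\<close> missed \<open>C\<close>, let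
  \<open>p\<close> be the next node towards \<open>s\<close>. By minimality some neighbour
  \<open>u\<close> of \<open>C\<close> is missing from \<open>B p\<close>. The bags of
  \<open>u\<close>, followed by bags meeting \<open>C\<close> and by the path from \<open>s\<close>
  back to \<open>p\<close>, connect \<open>t\<close> to \<open>p\<close> without using their edge,
  which is impossible in a tree.\<close>

lemma eliminable:
  assumes C: "conn C" "C \<noteq> {}" "C \<subseteq> verts G" and t0: "t0 \<in> verts T" "nbhd C \<subseteq> B t0"
  shows "\<exists>v\<in>C. \<exists>t\<in>verts T. insert v (nbhd C) \<subseteq> B t"
proof -
  define P where "P k \<longleftrightarrow> (\<exists>t s. t \<in> verts T \<and> s \<in> verts T \<and> nbhd C \<subseteq> B t \<and> B s \<inter> C \<noteq> {} \<and> (t, s) \<in> E ^^ k)" for k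
  have "\<exists>k. P k"
  proof -
    obtain c where c: "c \<in> C" using C(2) by auto
    then have "is_tree (induced T {x. c \<in> B x})" using td_simps(2) C(3) by blast
    then obtain s where s: "s \<in> verts T" "c \<in> B s" unfolding is_tree_def induced_def by auto
    then have "(t0, s) \<in> E\<^sup>*" using tree t0(1) unfolding is_tree_def connected_graph_def E_def by blast
    then obtain k where "(t0, s) \<in> E ^^ k" using rtrancl_power by blast
    then show ?thesis using s c t0 unfolding P_def by blast
  qed
  define k where "k = (LEAST k. P k)"
  have "P k" unfolding k_def using \<open>\<exists>k. P k\<close> by (rule LeastI_ex)
  then obtain t s where ts: "t \<in> verts T" "s \<in> verts T" "nbhd C \<subseteq> B t" "B s \<inter> C \<noteq> {}" "(t, s) \<in> E ^^ k"
    unfolding P_def by blast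
  have least: "\<not> P i" if "i < k" for i using that unfolding k_def by (rule not_less_Least)
  have "B t \<inter> C \<noteq> {}"
  proof (rule ccontr)
    assume tC: "\<not> B t \<inter> C \<noteq> {}"
    then obtain j where j: "k = Suc j" using ts by (cases k) auto
    obtain p where p: "(t, p) \<in> E" "(p, s) \<in> E ^^ j" using relpow_Suc_D2 ts(5) j by metis
    have pT: "p \<in> verts T" using p(1) tree_edge_verts unfolding E_def by auto
    have "\<not> nbhd C \<subseteq> B p" using least[of j] j p(2) pT ts unfolding P_def by blast
    then obtain u where u: "u \<in> nbhd C" "u \<notin> B p" by blast
    then obtain c where c: "c \<in> C" "{u, c} \<in> edges G" unfolding nbhd_def by auto
    obtain r where r: "r \<in> verts T" "u \<in> B r" "c \<in> B r" using bag_of_edge[OF c(2)] by blast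
    let ?E = "E - {(t, p), (p, t)}"
    have "(t, r) \<in> (E_on {x. u \<in> B x})\<^sup>*"
      by (rule vertex_connected) (use u ts r c edge_verts in auto)
    moreover have "E_on {x. u \<in> B x} \<subseteq> ?E" using u(2) unfolding E_on_def E_def by auto
    ultimately have 1: "(t, r) \<in> ?E\<^sup>*" using rtrancl_mono by blast
    have "(r, s) \<in> (E_on {z. B z \<inter> C \<noteq> {}})\<^sup>*"
      by (rule connected_bags) (use C r c ts in auto)
    moreover have "E_on {z. B z \<inter> C \<noteq> {}} \<subseteq> ?E" using tC unfolding E_on_def E_def by auto
    ultimately have 2: "(r, s) \<in> ?E\<^sup>*" using rtrancl_mono by blast
    \<comment> \<open>Otherwise \<open>t\<close> and \<open>s\<close> would be at distance at most
      \<open>j\<close>, below the minimum \<open>k = Suc j\<close>.\<close>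
    have "\<not> (\<exists>i\<le>j. (t, s) \<in> E ^^ i)"
      using least ts(1-4) unfolding P_def j less_Suc_eq_le by blast
    then have "(p, s) \<in> ?E\<^sup>*" using relpow_avoid[OF p(2)] by blast
    then have 3: "(s, p) \<in> ?E\<^sup>*" using E_sym rtrancl_converseI by metis
    have "(t, p) \<in> ?E\<^sup>*" using rtrancl_trans[OF rtrancl_trans[OF 1 2] 3] .
    then show False using tree_bridge[OF tree, of t p] p(1) unfolding E_def by auto
  qed
  then show ?thesis using ts by blast
qed

lemma elim_bags_td_width: "elim_bags (verts G) (td_width T B) (B ` verts T)"
  unfolding elim_bags_def
proof (intro conjI ballI allI impI)
  have fin: "finite (verts T)" "verts T \<noteq> {}" using tree unfolding is_tree_def simple_graph_def by auto
  show "B ` verts T \<noteq> {}" using fin by simp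
  fix X assume X: "X \<in> B ` verts T"
  then show "finite X" using td_simps(3) simple unfolding simple_graph_def
    by (auto intro: finite_subset)
  have "card X \<le> Max ((\<lambda>x. card (B x)) ` verts T)" using X fin by (intro Max_ge) auto
  then show "card X \<le> td_width T B + 1" unfolding td_width_def by simp
next
  fix C X assume C: "conn C" "C \<noteq> {}" "C \<subseteq> verts G" "X \<in> B ` verts T" "nbhd C \<subseteq> X"
  obtain t0 where t0: "t0 \<in> verts T" "X = B t0" using C(4) by auto
  obtain v t where "v \<in> C" "t \<in> verts T" "insert v (nbhd C) \<subseteq> B t"
    using eliminable[OF C(1-3) t0(1)] C(5) t0(2) by auto
  then show "\<exists>v\<in>C. \<exists>B'\<in>B ` verts T. insert v (nbhd C) \<subseteq> B'"
    by (intro bexI[of _ v] bexI[of _ "B t"]) auto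
qed

end

section \<open>Correctness and running time\<close>

text \<open>The decomposition with a single bag shows that the minimum is taken over a nonempty
  set.\<close>

lemma treewidth_attained:
  fixes G :: "'a graph"
  assumes "simple_graph G"
  shows "\<exists>(T :: nat graph) B. tree_decomposition G T B \<and> td_width T B = treewidth G"
proof -
  define T where "T = \<lparr>verts = {0::nat}, edges = {}\<rparr>"
  have "is_tree T"
    unfolding T_def is_tree_def simple_graph_def connected_graph_def is_cycle_def by simp
  moreover have "induced T UNIV = T" unfolding induced_def T_def by simp
  ultimately have "tree_decomposition G T (\<lambda>_. verts G)"
    using assms unfolding tree_decomposition_def simple_graph_def T_def by auto
  then have "\<exists>w (T :: nat graph) B. tree_decomposition G T B \<and> td_width T B = w" by blast
  from LeastI_ex[OF this] show ?thesis unfolding treewidth_def .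
qed

lemma covers_eq:
  assumes "simple_graph G" "verts G = {..<n}"
  shows "adj_rel.covers (\<lambda>u v. {u, v} \<in> edges G) {..<n} S {} = {D. vertex_cover (delete_verts G S) D}"
proof -
  interpret adj_rel "\<lambda>u v. {u, v} \<in> edges G" by (rule adj_rel_edges[OF assms(1)])
  have pair: "\<exists>a b. e = {a, b}" if "e \<in> edges G" for e
  proof -
    have "card e = 2" using assms(1) that unfolding simple_graph_def by simp
    then show ?thesis unfolding card_2_iff by blast
  qed
  have "(\<forall>a\<in>{..<n} - S. \<forall>b\<in>{..<n} - S. {a, b} \<in> edges G \<longrightarrow> a \<in> D \<or> b \<in> D) \<longleftrightarrow>
      (\<forall>e\<in>{e \<in> edges G. e \<subseteq> {..<n} - S}. e \<inter> D \<noteq> {})" (is "?l \<longleftrightarrow> ?r") for D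
  proof
    assume l: ?l
    show ?r
    proof
      fix e assume e: "e \<in> {e \<in> edges G. e \<subseteq> {..<n} - S}"
      then obtain a b where "e = {a, b}" using pair by blast
      then show "e \<inter> D \<noteq> {}" using l e by auto
    qed
  next
    assume r: ?r
    show ?l
    proof (intro ballI impI)
      fix a b assume "a \<in> {..<n} - S" "b \<in> {..<n} - S" "{a, b} \<in> edges G"
      then have "{a, b} \<inter> D \<noteq> {}" by (intro bspec[OF r]) simp
      then show "a \<in> D \<or> b \<in> D" by auto
    qed
  qed
  then show ?thesis
    unfolding covers_def vertex_cover_def delete_verts_def induced_def assms(2)
    by (simp add: Int_absorb1)
qed

lemma ex1_minimum_vertex_cover:
  assumes "{D. vertex_cover H D} \<noteq> {}"
  shows "(\<exists>!C. minimum_vertex_cover H C) \<longleftrightarrow> uniq_opt {D. vertex_cover H D}"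
proof -
  have "minimum_vertex_cover H C \<longleftrightarrow> C \<in> {D. vertex_cover H D} \<and> card C = opt {D. vertex_cover H D}" for C
    unfolding minimum_vertex_cover_def
    using opt_le[of _ "{D. vertex_cover H D}"] opt_attained[OF assms]
    by (auto intro!: le_antisym)
  then show ?thesis unfolding uniq_opt_def by simp
qed

text \<open>With \<open>m = max 2 n\<close> one has \<open>n + 1 \<le> m ^ 2\<close> and
  \<open>2 * (n + 1) \<le> m ^ 3\<close>, so the bound on the number of keys is at most
  \<open>m ^ (2 + 6 * 2 ^ d)\<close>; moreover \<open>1000 \<le> m ^ 10\<close>. The factor 16
  leaves ample room above these exponents, also for \<open>d = 0\<close>.\<close>

lemma mu_graph_max_pow:
  assumes G: "simple_graph G" "verts G = {..<n}"
  shows "mu_graph (\<lambda>u v. {u, v} \<in> edges G) n ((max 2 n) ^ (16 * 2 ^ d)) d"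
proof -
  define m where "m = max 2 n"
  define N where "N = m ^ (16 * 2 ^ d)"
  have m: "2 \<le> m" "n \<le> m" unfolding m_def by auto
  have lt: "m ^ i < N" if "i < 16 * 2 ^ d" for i
    unfolding N_def using m that by (intro power_strict_increasing) auto
  have dd: "d + 1 \<le> 2 ^ d" by (induction d) auto
  have pw: "(1::nat) \<le> 2 ^ d" by simp
  have two: "2 ^ i \<le> m ^ i" for i using m by (intro power_mono) auto
  have sq: "n + 1 \<le> m\<^sup>2"
  proof -
    have "2 * m \<le> m * m" using m by (intro mult_right_mono) auto
    then show ?thesis using m unfolding power2_eq_square by linarith
  qed
  have "n < N" using lt[of 1] m pw by simp
  moreover have "1000 \<le> N"
  proof -
    have "(1000::nat) \<le> 2 ^ 10" by simp
    also have "\<dots> \<le> m ^ 10" by (rule two)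
    also have "\<dots> < N" by (rule lt) (use pw in linarith)
    finally show ?thesis by simp
  qed
  moreover have p3: "2 ^ (d + 3) < N" using two[of "d + 3"] lt[of "d + 3"] dd pw by linarith
  moreover have "d + 1 < N"
  proof -
    have "(2::nat) ^ d \<le> 2 ^ (d + 3)" by (intro power_increasing) auto
    then show ?thesis using dd p3 by linarith
  qed
  moreover have "(n + 1) * (2 * (n + 1)) ^ (2 ^ (d + 1)) < N"
  proof -
    have "2 * (n + 1) \<le> m * m\<^sup>2" using sq m by (intro mult_le_mono) auto
    then have "2 * (n + 1) \<le> m ^ 3" by (simp only: power3_eq_cube power2_eq_square mult.assoc)
    then have "(2 * (n + 1)) ^ (2 ^ (d + 1)) \<le> (m ^ 3) ^ (2 ^ (d + 1))" by (intro power_mono) auto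
    then have "(n + 1) * (2 * (n + 1)) ^ (2 ^ (d + 1)) \<le> m\<^sup>2 * (m ^ 3) ^ (2 ^ (d + 1))"
      using sq by (intro mult_le_mono)
    also have "\<dots> = m ^ (2 + 6 * 2 ^ d)" by (simp flip: power_mult power_add)
    also have "\<dots> < N" by (rule lt) (use pw in linarith)
    finally show ?thesis .
  qed
  moreover have "n * n ^ (d + 1) < N"
  proof -
    have "n * n ^ (d + 1) \<le> m * m ^ (d + 1)" using m by (intro mult_le_mono power_mono) auto
    also have "\<dots> = m ^ (d + 2)" by (simp add: power2_eq_square)
    also have "\<dots> < N" by (rule lt) (use dd pw in linarith)
    finally show ?thesis .
  qed
  moreover have "u < n" if "{u, v} \<in> edges G" for u v
    using G that unfolding simple_graph_def by (auto dest!: bspec[of _ _ "{u, v}"])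
  ultimately have "mu_graph (\<lambda>u v. {u, v} \<in> edges G) n N d"
    by (intro mu_graph.intro mu_items.intro mu.intro adj_rel_edges[OF G(1)] mu_axioms.intro
        mu_items_axioms.intro mu_graph_axioms.intro)
  then show ?thesis unfolding N_def m_def .
qed

lemma computes_runs: "computes f_main [x] y b \<Longrightarrow> \<exists>t\<le>b. runs mu_prog x y t"
proof -
  assume c: "computes f_main [x] y b"
  have "hd mu_prog = mu_prog ! f_main" unfolding mu_prog_nth by (simp add: mu_prog_def)
  then show ?thesis using c halts_eval[of mu_prog f_main "[x]"]
    unfolding runs_def ok_def by (auto simp: mu_prog_def)
qed

text \<open>The exponent 288 is 16 times 18: the program takes at most \<open>N ^ 18\<close> steps
  for \<open>N = (max 2 n) ^ (16 * 2 ^ d)\<close>. One program serves all instances, as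
  \<open>N\<close> and \<open>d\<close> occur only in the analysis.\<close>

lemma mu_prog_solves:
  "solves_within mu_prog mu_vc (\<lambda>(G, k). (max 2 (card (verts G))) ^ (288 * 2 ^ treewidth G))"
  unfolding solves_within_def
proof
  fix i assume "i \<in> instances mu_vc"
  then obtain G k where i: "i = (G, k)" "simple_graph G" "verts G = {0..<card (verts G)}"
    unfolding mu_vc_def by auto
  define n where "n = card (verts G)"
  have V: "verts G = {..<n}" using i(3) unfolding n_def by (simp add: lessThan_atLeast0)
  define d where "d = treewidth G"
  define N where "N = (max 2 n) ^ (16 * 2 ^ d)"
  interpret mu_graph "\<lambda>u v. {u, v} \<in> edges G" n N d
    unfolding N_def by (rule mu_graph_max_pow[OF i(2) V])
  obtain T :: "nat graph" and B where T: "tree_decomposition G T B" "td_width T B = d"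
    using treewidth_attained[OF i(2)] unfolding d_def by blast
  interpret decomposed_graph G T B by unfold_locales (use i(2) T(1) in auto)
  obtain y where y: "computes f_main [Node (Atom (int n)) (Node (Atom k) mat)] y (N ^ 18)" "good_answer k y"
    using main_computes[of _ k] elim_bags_td_width unfolding T(2) V by blast
  have enc: "encode mu_vc i = Node (Atom (int n)) (Node (Atom k) mat)"
    unfolding mu_vc_def encode_mu_vc_def i(1) mat_def by (simp add: Let_def n_def)
  have sol: "mu_vc_solution G k S \<longleftrightarrow> S \<subseteq> {..<n} \<and> int (card S) \<le> k \<and> uniq_opt (covers {..<n} S {})" for S
    unfolding mu_vc_solution_def covers_eq[OF i(2) V] V
    using ex1_minimum_vertex_cover[of "delete_verts G S"] covers_nonempty[of "{..<n}" S "{}"]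
    unfolding covers_eq[OF i(2) V] by simp
  have "answer mu_vc i y"
    using y(2) unfolding mu_vc_def answer_mu_vc_def i(1) good_answer_def good_def
    by (auto simp: sol distinct_card split: if_splits)
  moreover have "N ^ 18 = (max 2 n) ^ (288 * 2 ^ d)" unfolding N_def by (simp add: power_mult[symmetric])
  moreover obtain t where "t \<le> N ^ 18" "runs mu_prog (encode mu_vc i) y t"
    using computes_runs[OF y(1)] unfolding enc by blast
  ultimately show "\<exists>y t. runs mu_prog (encode mu_vc i) y t \<and> answer mu_vc i y \<and>
      t \<le> (case i of (G, k) \<Rightarrow> (max 2 (card (verts G))) ^ (288 * 2 ^ treewidth G))"
    unfolding n_def d_def by (intro exI[of _ y] exI[of _ t]) (simp add: i(1))
qed

section \<open>The XP bound in terms of the input size\<close>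

lemma computable_one: "computable_nat_fun (\<lambda>_. 1)"
  unfolding computable_nat_fun_def runs_def
  by (rule exI[of _ "[Lit 1]"]) (auto intro: eval_Lit)

text \<open>The language has no multiplication; the power is obtained from \<open>c\<close> by
  \<open>d\<close> doublings.\<close>

lemma computable_exp: "computable_nat_fun (\<lambda>d. c * 2 ^ d)"
proof -
  define P where "P = [Cond (Var 0) (Call 1 [Call 0 [Prim Sub (Var 0) (Lit 1)]]) (Lit (int c)),
    Prim Add (Var 0) (Var 0)]"
  have dbl: "ok P 1 [Atom a] (Atom (a + a)) 3" for a
    by (intro okI) (auto simp: P_def)
  have "\<exists>b. ok P 0 [Atom (int d)] (Atom (int (c * 2 ^ d))) b" for d
  proof (induction d)
    case 0
    have "ok P 0 [Atom 0] (Atom (int c)) 3" by (intro okI) (auto simp: P_def)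
    then show ?case by auto
  next
    case (Suc d)
    then obtain b where b: "ok P 0 [Atom (int d)] (Atom (int (c * 2 ^ d))) b" by blast
    have "ok P 0 [Atom (int (Suc d))] (Atom (int (c * 2 ^ Suc d))) (20 + b)"
    proof (rule okI)
      have P0: "P ! 0 = Cond (Var 0) (Call 1 [Call 0 [Prim Sub (Var 0) (Lit 1)]]) (Lit (int c))"
        unfolding P_def by simp
      note s = b dbl[of "int (c * 2 ^ d)"]
      show "0 < length P" unfolding P_def by simp
      show "expr_safe P [Atom (int (Suc d))] (P ! 0)" "expr_val P [Atom (int (Suc d))] (P ! 0) = Atom (int (c * 2 ^ Suc d))"
        "expr_time P [Atom (int (Suc d))] (P ! 0) \<le> 20 + b"
        unfolding P0 using s by (auto simp: ok_def)
    qed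
    then show ?case by blast
  qed
  moreover have "P \<noteq> []" "hd P = P ! 0" unfolding P_def by auto
  ultimately show ?thesis
    unfolding computable_nat_fun_def runs_def ok_def using halts_eval[of P 0] by metis
qed

lemma data_size_list: "length xs \<le> data_size (data_list xs)"
  by (induction xs) auto

text \<open>The matrix alone is a list of \<open>n\<close> rows, and the surrounding nodes bring the
  size to at least 2. This turns a bound in \<open>max 2 n\<close> into one in the input
  size.\<close>

lemma data_size_encode: "max 2 (card (verts G)) \<le> data_size (encode_mu_vc (G, k))"
proof -
  have "card (verts G) \<le> data_size (data_list (map (\<lambda>i. data_list (map (\<lambda>j.
      Atom (if {i, j} \<in> edges G then 1 else 0)) [0..<card (verts G)])) [0..<card (verts G)]))"
    by (rule order_trans[OF _ data_size_list]) simp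
  then show ?thesis unfolding encode_mu_vc_def by (simp add: Let_def)
qed

(* The base is max 2 n because n^O(...) allows constant factors, which n^m itself cannot
   absorb when n < 2. *)
theorem theorem3:
  shows "(\<exists>P (c :: nat). solves_within P mu_vc
            (\<lambda>(G, k). (max 2 (card (verts G))) ^ (c * 2 ^ treewidth G)))
         \<and> in_XP mu_vc (\<lambda>(G, k). treewidth G)"
proof
  show "\<exists>P (c :: nat). solves_within P mu_vc
            (\<lambda>(G, k). (max 2 (card (verts G))) ^ (c * 2 ^ treewidth G))"
    using mu_prog_solves by blast
  have "\<exists>y t. runs mu_prog (encode mu_vc i) y t \<and> answer mu_vc i y \<and>
      t \<le> 1 * data_size (encode mu_vc i) ^ (288 * 2 ^ (case i of (G, k) \<Rightarrow> treewidth G))"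
    if i: "i \<in> instances mu_vc" for i
  proof -
    obtain G k where Gk: "i = (G, k)" by (cases i)
    have e: "encode mu_vc i = encode_mu_vc (G, k)" unfolding mu_vc_def Gk by simp
    obtain y t where yt: "runs mu_prog (encode mu_vc i) y t" "answer mu_vc i y"
      "t \<le> (max 2 (card (verts G))) ^ (288 * 2 ^ treewidth G)"
      using mu_prog_solves i unfolding solves_within_def Gk by fastforce
    moreover have "(max 2 (card (verts G))) ^ (288 * 2 ^ treewidth G) \<le>
        data_size (encode mu_vc i) ^ (288 * 2 ^ treewidth G)"
      unfolding e by (rule power_mono[OF data_size_encode]) simp
    ultimately show ?thesis using order_trans unfolding Gk by fastforce
  qed
  then show "in_XP mu_vc (\<lambda>(G, k). treewidth G)"
    unfolding in_XP_def solves_within_def using computable_one computable_exp[of 288] by blast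
qed

end
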